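(* Let $\beta\in(1,2)$ and $\tau\in(0,0.5)$, and let $f$ and $\Lambda_{\beta,\tau}$ be as defined in the context. The dynamical system $(\Lambda_{\beta,\tau},f)$ has topological entropy $h(f_{|\Lambda_{\beta,\tau}})=\log\beta$, and there is an ergodic Borel probability measure $\nu$ on $\Lambda_{\beta,\tau}$ for $f$ of full entropy, that is, with metric entropy $h(f_{|\Lambda_{\beta,\tau}},\nu)=h(f_{|\Lambda_{\beta,\tau}})=\log\beta$.
   Context: For $\beta\in(1,2)$ and $\tau\in(0,0.5)$, the map $f:[0,1]^2\to[0,1]^2$ is given by $$f(x,y)=\begin{cases}(\beta x,\ \tau y), & x\in[0,\beta^{-1}],\\ (\beta x-1,\ \tau y+(1-\tau)), & x\in(\beta^{-1},1],\end{cases}$$ and its attractor is $$\Lambda_{\beta,\tau}=\mathrm{closure}\Big(\bigcap_{i=0}^{\infty}f^i([0,1]^2)\Big).$$ Entropy is defined as follows for a dynamical system $(X,f)$ on a compact space $X$ (applied to $X=\Lambda_{\beta,\tau}$ and the restriction of $f$, which is not assumed continuous). For a covering $\mathfrak{U}$ of $X$ put $H(\mathfrak{U})=\log\sharp\mathfrak{U}$, where $\sharp\mathfrak{U}$ is the minimal number of elements of $\mathfrak{U}$ that cover $X$; $\mathfrak{U}_1\vee\mathfrak{U}_2$ is the covering consisting of the intersections of elements of $\mathfrak{U}_1$ with elements of $\mathfrak{U}_2$; and $$h(f,\mathfrak{U})=\lim_{n\to\infty}\frac1n H(\mathfrak{U}\vee f^{-1}(\mathfrak{U})\vee\dots\vee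 f^{-n}(\mathfrak{U})).$$ The topological entropy is $h(f)=\sup\{h(f,\mathfrak{U}) : \mathfrak{U}\text{ is an open covering of }X\}$. A Borel probability measure $\mu$ on $X$ is ergodic with respect to $f$ if it is invariant, $\mu\circ f^{-1}=\mu$, and every Borel set $B$ with $f^{-1}(B)=B$ has measure zero or one. For a finite measurable partition $\mathfrak{P}$ of $X$ put $H(\mu,\mathfrak{P})=-\sum_{P\in\mathfrak{P}}\mu(P)\log\mu(P)$ (with $0\log0=0$) and $$h(f,\mu,\mathfrak{P})=\lim_{n\to\infty}\frac1n H(\mu,\mathfrak{P}\vee f^{-1}(\mathfrak{P})\vee\dots\vee f^{-n}(\mathfrak{P})).$$ The metric entropy is $h(f,\mu)=\sup\{h(f,\mu,\mathfrak{P}) : \mathfrak{P}\text{ is a finite measurable partition of }X\}$. *)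

theory Defs
  imports "HOL-Probability.Probability_Measure"
begin

section \<open>Coverings and topological entropy\<close>

definition cover_join :: "'a set set \<Rightarrow> 'a set set \<Rightarrow> 'a set set" where
  "cover_join U V = {A \<inter> B | A B. A \<in> U \<and> B \<in> V}"

text \<open>The system is a map of a subset \<open>X\<close> of the ambient type, so preimages are taken
  within \<open>X\<close>. As coverings are sets of sets, coinciding elements of a pulled-back or joined
  covering are identified; for partitions the only element that can arise repeatedly is the
  empty set.\<close>

definition cover_pullback :: "'a set \<Rightarrow> ('a \<Rightarrow> 'a) \<Rightarrow> 'a set set \<Rightarrow> 'a set set" where
  "cover_pullback X f U = (\<lambda>A. f -` A \<inter> X) ` U"

primrec dyn_join :: "'a set \<Rightarrow> ('a \<Rightarrow> 'a) \<Rightarrow> 'a set set \<Rightarrow> nat \<Rightarrow> 'a set set" where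
  "dyn_join X f U 0 = U"
| "dyn_join X f U (Suc n) = cover_join (dyn_join X f U n) (cover_pullback X (f ^^ Suc n) U)"

text \<open>If \<open>U\<close> has no finite subcover of \<open>X\<close> the following number is unspecified. This does not
  occur below: if \<open>X\<close> is compact, \<open>U\<close> is an open covering and \<open>f\<close> maps \<open>X\<close> into itself, then
  every \<open>dyn_join X f U n\<close> has a finite subcover, and the limit defining
  \<open>cover_entropy X f U\<close> exists by subadditivity (continuity of \<open>f\<close> is not needed).\<close>

definition cover_number :: "'a set \<Rightarrow> 'a set set \<Rightarrow> nat" where
  "cover_number X U = (LEAST k. \<exists>V\<subseteq>U. finite V \<and> \<Union>V = X \<and> card V = k)"

definition cover_H :: "'a set \<Rightarrow> 'a set set \<Rightarrow> real" where
  "cover_H X U = ln (real (cover_number X U))"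

definition cover_entropy :: "'a set \<Rightarrow> ('a \<Rightarrow> 'a) \<Rightarrow> 'a set set \<Rightarrow> real" where
  "cover_entropy X f U = lim (\<lambda>n. 1 / real n * cover_H X (dyn_join X f U n))"

definition open_covering :: "'a::topological_space set \<Rightarrow> 'a set set \<Rightarrow> bool" where
  "open_covering X U \<longleftrightarrow> (\<forall>A\<in>U. openin (top_of_set X) A) \<and> \<Union>U = X"

definition topological_entropy :: "'a::topological_space set \<Rightarrow> ('a \<Rightarrow> 'a) \<Rightarrow> ereal" where
  "topological_entropy X f = (SUP U\<in>{U. open_covering X U}. ereal (cover_entropy X f U))"


section \<open>Ergodic measures and metric entropy\<close>

definition ergodic_borel_prob ::
  "'a::topological_space set \<Rightarrow> ('a \<Rightarrow> 'a) \<Rightarrow> 'a measure \<Rightarrow> bool" where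
  "ergodic_borel_prob X f \<mu> \<longleftrightarrow>
     prob_space \<mu> \<and> sets \<mu> = sets (restrict_space borel X) \<and>
     f \<in> measurable \<mu> \<mu> \<and> distr \<mu> \<mu> f = \<mu> \<and>
     (\<forall>B\<in>sets \<mu>. f -` B \<inter> X = B \<longrightarrow> measure \<mu> B = 0 \<or> measure \<mu> B = 1)"

definition partition_H :: "'a measure \<Rightarrow> 'a set set \<Rightarrow> real" where
  "partition_H \<mu> P = - (\<Sum>A\<in>P. measure \<mu> A * ln (measure \<mu> A))"

definition partition_entropy :: "('a \<Rightarrow> 'a) \<Rightarrow> 'a measure \<Rightarrow> 'a set set \<Rightarrow> real" where
  "partition_entropy f \<mu> P = lim (\<lambda>n. 1 / real n * partition_H \<mu> (dyn_join (space \<mu>) f P n))"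

definition metric_entropy :: "('a \<Rightarrow> 'a) \<Rightarrow> 'a measure \<Rightarrow> ereal" where
  "metric_entropy f \<mu> =
     (SUP P\<in>{P. finite P \<and> P \<subseteq> sets \<mu> \<and> partition_on (space \<mu>) P}.
        ereal (partition_entropy f \<mu> P))"


section \<open>The map and its attractor\<close>

text \<open>Only the values on the unit square matter; it is mapped into itself for
  \<open>\<beta> \<in> (1,2)\<close> and \<open>\<tau> \<in> (0,1/2)\<close>.\<close>

definition skew_map :: "real \<Rightarrow> real \<Rightarrow> real \<times> real \<Rightarrow> real \<times> real" where
  "skew_map \<beta> \<tau> = (\<lambda>(x, y).
     if x \<le> inverse \<beta> then (\<beta> * x, \<tau> * y) else (\<beta> * x - 1, \<tau> * y + (1 - \<tau>)))"

definition attractor :: "real \<Rightarrow> real \<Rightarrow> (real \<times> real) set" where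
  "attractor \<beta> \<tau> = closure (\<Inter>i. (skew_map \<beta> \<tau> ^^ i) ` ({0..1} \<times> {0..1}))"

end

theory Submission
  imports Defs "HOL-Probability.Probability"
begin

text \<open>Points with the same \<open>n\<close> forward digits stay close for \<open>n\<close> steps, and the number of digit words
  grows like \<open>\<beta> ^ n\<close> up to a polynomial factor; this bounds the entropy of every open covering and, by
  coding itineraries and Gibbs' inequality, the entropy of every finite partition for every
  invariant measure, without continuity of the map. The strips below and above height \<open>1/2\<close> read
  off the digits, and a cell of their \<open>n\<close>-fold join has width at most \<open>\<beta> powr -n\<close>, so covering
  \<open>[0,1]\<close> gives the opposite inequality, and so does any invariant measure whose first marginal has
  bounded density.

  Such a measure is obtained from the map induced on \<open>{0<..1}\<close> by the first time at which the digits
  deviate from those of 1. All its branches are full and affine, so it preserves the product of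
  Lebesgue measure and the law \<open>\<eta>\<close> of the height determined by an independent sequence of past
  blocks; spreading this product over the tower of return times gives the measure. For ergodicity,
  vertical contraction forces an invariant set to be a union of fibres almost everywhere, and its
  distribution function satisfies the self-similarity of Lebesgue measure, which is contracting
  and hence has the linear function as its only solution.\<close>

section \<open>Itineraries and topological entropy\<close>

text \<open>The map jumps across the line over \<open>inverse \<beta>\<close>, so the classical
  arguments for continuous maps of compact spaces break down at three places. Forward invariance of
  the closure that defines the attractor has to be extracted from the geometry of the fibres. A
  partition can be compared with orbits known up to \<delta> only outside a small set, which is why
  the coding has a correction term. Weak limits of orbit averages may fail to be invariant, so the
  measure is built explicitly. Giving digit 0 to the point \<open>inverse \<beta>\<close> makes the
  one-dimensional map left-continuous: intervals are open on the left and closed on the right, and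
  the orbit of 1 never reaches 0. Level \<open>n\<close> of the tower is spread affinely over
  \<open>{0<..orb n}\<close> with density \<open>inverse \<beta> ^ n\<close>; up to normalisation
  the first marginal is therefore Parry's density, and \<open>\<beta> / (\<beta> - 1)\<close> is the
  sum of the geometric series bounding it. The inequality \<open>\<tau> < 1 / 2\<close> puts the
  images of the two branches on different sides of height 1/2, so that digits can be read off
  heights and the map is injective on the square.\<close>

lemma fekete_convergent:
  fixes a :: "nat \<Rightarrow> real"
  assumes nonneg: "\<And>n. 0 \<le> a n"
    and sub: "\<And>m n. 0 < m \<Longrightarrow> 0 < n \<Longrightarrow> a (m + n) \<le> a m + a n"
  shows "convergent (\<lambda>n. a n / real n)"
proof -
  define L where "L = (INF n\<in>{1..}. a n / real n)"
  have bdd: "bdd_below ((\<lambda>n. a n / real n) ` {1..})"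
    by (rule bdd_belowI2[of _ 0]) (simp add: nonneg)
  have lower: "L \<le> a n / real n" if "n \<ge> 1" for n
    unfolding L_def by (rule cINF_lower[OF bdd]) (use that in simp)
  have mult: "a (q * k + r) \<le> real q * a k + a r" if "0 < k" "0 < r" for q k r
  proof (induction q)
    case (Suc q)
    have "a (Suc q * k + r) = a (k + (q * k + r))" by (simp add: algebra_simps)
    also have "\<dots> \<le> a k + a (q * k + r)" using that by (intro sub) auto
    also have "\<dots> \<le> real (Suc q) * a k + a r" using Suc by (simp add: algebra_simps)
    finally show ?case .
  qed simp
  have "(\<lambda>n. a n / real n) \<longlonglongrightarrow> L"
  proof (rule LIMSEQ_I)
    fix e :: real assume "0 < e"
    then have "L < L + e / 2" by simp
    then obtain k where k: "k \<ge> 1" "a k / real k < L + e / 2"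
      unfolding L_def using cINF_less_iff[OF _ bdd, of "L + e/2"] by (auto simp: L_def)
    define M where "M = Max (a ` {1..k})"
    obtain N :: nat where N: "real N > M / (e / 2)" using reals_Archimedean2 by blast
    have "norm (a n / real n - L) < e" if n: "n \<ge> max N 1" for n
    proof -
      \<comment> \<open>The remainder is taken in \<open>{1..k}\<close> instead of
        \<open>{0..k - 1}\<close>, because subadditivity is assumed for positive arguments
        only.\<close>
      define q where "q = (n - 1) div k"
      define r where "r = (n - 1) mod k + 1"
      have nqr: "n = q * k + r" unfolding q_def r_def using n by simp
      have r: "1 \<le> r" "r \<le> k" unfolding r_def using k
        by (auto simp: Suc_le_eq)
      have "a r \<le> M" unfolding M_def using r by (intro Max_ge) auto
      have qk: "real q * real k \<le> real n" by (subst nqr) simp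
      have "a n \<le> real q * a k + a r" using mult[of k r q] k r nqr by simp
      also have "real q * a k = (real q * real k) * (a k / real k)" using k by simp
      also have "\<dots> \<le> real n * (a k / real k)"
        using qk nonneg by (intro mult_right_mono) auto
      finally have "a n / real n \<le> (real n * (a k / real k) + M) / real n"
        using \<open>a r \<le> M\<close> n by (intro divide_right_mono) auto
      also have "\<dots> = a k / real k + M / real n" using n by (simp add: field_simps)
      also have "M / real n < e / 2"
      proof -
        have "real N \<le> real n" using n by simp
        then have "M / (e / 2) < real n" using N by linarith
        then show ?thesis using \<open>0 < e\<close> n by (simp add: field_simps)
      qed
      finally have "a n / real n < L + e" using k by simp
      then show ?thesis using lower[of n] n by simp
    qed
    then show "\<exists>no. \<forall>n\<ge>no. norm (a n / real n - L) < e" by blast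
  qed
  then show ?thesis by (rule convergentI)
qed

text \<open>A join up to index \<open>n\<close> involves \<open>n + 1\<close> iterates, so its
  entropy is term \<open>n + 1\<close> of an ordinary subadditive sequence, yet it is divided by
  \<open>n\<close>. The quotient \<open>(n + 1) / n\<close> tends to 1.\<close>

lemma fekete_convergent_Suc:
  fixes a :: "nat \<Rightarrow> real"
  assumes nonneg: "\<And>n. 0 \<le> a n"
    and sub: "\<And>m n. a (Suc (m + n)) \<le> a m + a n"
  shows "convergent (\<lambda>n. 1 / real n * a n)"
proof -
  define b where "b n = a (n - 1)" for n
  have "convergent (\<lambda>n. b n / real n)"
  proof (rule fekete_convergent)
    fix m n :: nat assume "0 < m" "0 < n"
    then show "b (m + n) \<le> b m + b n"
      using sub[of "m - 1" "n - 1"] by (cases m; cases n) (auto simp: b_def)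
  qed (simp add: b_def nonneg)
  then obtain L where "(\<lambda>n. b n / real n) \<longlonglongrightarrow> L" by (auto simp: convergent_def)
  then have "(\<lambda>n. b (Suc n) / real (Suc n)) \<longlonglongrightarrow> L" by (rule LIMSEQ_Suc)
  moreover have "(\<lambda>n. real (Suc n) / real n) \<longlonglongrightarrow> 1" by (rule LIMSEQ_Suc_n_over_n)
  ultimately have "(\<lambda>n. b (Suc n) / real (Suc n) * (real (Suc n) / real n)) \<longlonglongrightarrow> L * 1"
    by (rule tendsto_mult)
  moreover have "b (Suc n) / real (Suc n) * (real (Suc n) / real n) = 1 / real n * a n" for n
    by (simp add: b_def)
  ultimately have "(\<lambda>n. 1 / real n * a n) \<longlonglongrightarrow> L * 1" by (simp only:)
  then show ?thesis by (rule convergentI)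
qed

section \<open>Itinerary cells as the elements of dynamical joins\<close>

definition itin_cell :: "'a set \<Rightarrow> ('a \<Rightarrow> 'a) \<Rightarrow> nat \<Rightarrow> (nat \<Rightarrow> 'a set) \<Rightarrow> 'a set" where
  "itin_cell X f n a = {x \<in> X. \<forall>i\<le>n. (f ^^ i) x \<in> a i}"

lemma itin_cell_Suc:
  "itin_cell X f (Suc n) a = itin_cell X f n a \<inter> ((f ^^ Suc n) -` a (Suc n) \<inter> X)"
  by (auto simp: itin_cell_def le_Suc_eq)

lemma itin_cell_cong: "(\<And>i. i \<le> n \<Longrightarrow> a i = b i) \<Longrightarrow> itin_cell X f n a = itin_cell X f n b"
  by (auto simp: itin_cell_def)

text \<open>Concatenation of words: the second one is read from time \<open>Suc m\<close> on.
  Forward invariance supplies the membership of the shifted point in \<open>X\<close>, which the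
  cell of the long word does not record.\<close>

lemma itin_cell_append:
  assumes "f ` X \<subseteq> X"
  shows "itin_cell X f m a \<inter> ((f ^^ Suc m) -` itin_cell X f n b \<inter> X) =
    itin_cell X f (Suc (m + n)) (\<lambda>i. if i \<le> m then a i else b (i - Suc m))"
    (is "?L = ?R")
proof -
  have inX: "(f ^^ i) x \<in> X" if "x \<in> X" for i x
    using that assms by (induction i) auto
  have shift: "(f ^^ j) ((f ^^ Suc m) x) = (f ^^ (j + Suc m)) x" for j x
    by (simp only: funpow_add o_apply)
  have "(\<forall>i\<le>Suc (m + n). (f ^^ i) x \<in> (if i \<le> m then a i else b (i - Suc m))) \<longleftrightarrow>
     (\<forall>i\<le>m. (f ^^ i) x \<in> a i) \<and> (\<forall>j\<le>n. (f ^^ (j + Suc m)) x \<in> b j)" (is "?A \<longleftrightarrow> ?B") for x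
  proof
    assume A: ?A
    have "(f ^^ (j + Suc m)) x \<in> b j" if "j \<le> n" for j
      using A[rule_format, of "j + Suc m"] that by simp
    moreover have "(f ^^ i) x \<in> a i" if "i \<le> m" for i using A[rule_format, of i] that by simp
    ultimately show ?B by blast
  next
    assume B: ?B
    show ?A
    proof (intro allI impI)
      fix i assume "i \<le> Suc (m + n)"
      then show "(f ^^ i) x \<in> (if i \<le> m then a i else b (i - Suc m))"
        using B[THEN conjunct1, rule_format, of i] B[THEN conjunct2, rule_format, of "i - Suc m"]
        by (cases "i \<le> m") (simp_all del: funpow.simps)
    qed
  qed
  then show ?thesis
    unfolding itin_cell_def using inX by (auto simp only: shift vimage_eq Int_iff mem_Collect_eq)
qed

lemma Union_itin_cell:
  assumes "\<Union>P = X" "f ` X \<subseteq> X"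
  shows "\<Union>(itin_cell X f n ` ({..n} \<rightarrow>\<^sub>E P)) = X"
proof
  show "\<Union>(itin_cell X f n ` ({..n} \<rightarrow>\<^sub>E P)) \<subseteq> X" by (auto simp: itin_cell_def)
  show "X \<subseteq> \<Union>(itin_cell X f n ` ({..n} \<rightarrow>\<^sub>E P))"
  proof
    fix x assume x: "x \<in> X"
    have "(f ^^ i) x \<in> X" for i using x assms(2) by (induction i) auto
    then have "\<forall>i. \<exists>A\<in>P. (f ^^ i) x \<in> A" using assms(1) by blast
    then obtain a where a: "\<And>i. a i \<in> P" "\<And>i. (f ^^ i) x \<in> a i" by metis
    then have "x \<in> itin_cell X f n (restrict a {..n})" using x by (auto simp: itin_cell_def)
    moreover have "restrict a {..n} \<in> {..n} \<rightarrow>\<^sub>E P" using a by auto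
    ultimately show "x \<in> \<Union>(itin_cell X f n ` ({..n} \<rightarrow>\<^sub>E P))" by blast
  qed
qed

text \<open>The assumption on \<open>U\<close> matters at index 0, where the join is
  \<open>U\<close> itself while cells always lie inside \<open>X\<close>.\<close>

lemma mem_dyn_join_iff:
  assumes "U \<subseteq> Pow X"
  shows "D \<in> dyn_join X f U n \<longleftrightarrow> (\<exists>a. (\<forall>i\<le>n. a i \<in> U) \<and> D = itin_cell X f n a)"
proof (induction n arbitrary: D)
  case 0
  have "itin_cell X f 0 a = a 0" if "a 0 \<in> U" for a
    using that assms by (auto simp: itin_cell_def)
  then show ?case
  proof (intro iffI)
    assume "D \<in> dyn_join X f U 0"
    then show "\<exists>a. (\<forall>i\<le>0. a i \<in> U) \<and> D = itin_cell X f 0 a"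
      using assms by (intro exI[of _ "\<lambda>_. D"]) (auto simp: itin_cell_def)
  qed auto
next
  case (Suc n)
  show ?case
  proof
    assume "D \<in> dyn_join X f U (Suc n)"
    then obtain E C where EC: "E \<in> dyn_join X f U n" "C \<in> U" "D = E \<inter> ((f ^^ Suc n) -` C \<inter> X)"
      by (auto simp: cover_join_def cover_pullback_def)
    then obtain a where a: "\<forall>i\<le>n. a i \<in> U" "E = itin_cell X f n a" using Suc.IH by blast
    have "D = itin_cell X f (Suc n) (a(Suc n := C))"
      unfolding itin_cell_Suc EC(3) a(2) by (subst itin_cell_cong[of n a "a(Suc n := C)"]) auto
    moreover have "\<forall>i\<le>Suc n. (a(Suc n := C)) i \<in> U" using a(1) EC(2) by (auto simp: le_Suc_eq)
    ultimately show "\<exists>a. (\<forall>i\<le>Suc n. a i \<in> U) \<and> D = itin_cell X f (Suc n) a" by blast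
  next
    assume "\<exists>a. (\<forall>i\<le>Suc n. a i \<in> U) \<and> D = itin_cell X f (Suc n) a"
    then obtain a where a: "\<forall>i\<le>Suc n. a i \<in> U" "D = itin_cell X f (Suc n) a" by blast
    have "itin_cell X f n a \<in> dyn_join X f U n" unfolding Suc.IH using a(1) by (intro exI[of _ a]) auto
    then show "D \<in> dyn_join X f U (Suc n)"
      unfolding a(2) itin_cell_Suc dyn_join.simps cover_join_def cover_pullback_def using a(1) by blast
  qed
qed

text \<open>Extensional words form a finite index set when \<open>U\<close> is finite; sums and
  products over cells are later taken over words, although different words may have the same
  cell.\<close>

lemma dyn_join_eq_PiE:
  assumes "U \<subseteq> Pow X"
  shows "dyn_join X f U n = itin_cell X f n ` ({..n} \<rightarrow>\<^sub>E U)"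
proof (intro set_eqI iffI)
  fix D assume "D \<in> dyn_join X f U n"
  then obtain a where a: "\<forall>i\<le>n. a i \<in> U" "D = itin_cell X f n a"
    using mem_dyn_join_iff[OF assms] by blast
  then have "D = itin_cell X f n (restrict a {..n})"
    using itin_cell_cong[of n a "restrict a {..n}" X f] by simp
  moreover have "restrict a {..n} \<in> {..n} \<rightarrow>\<^sub>E U" using a by auto
  ultimately show "D \<in> itin_cell X f n ` ({..n} \<rightarrow>\<^sub>E U)" by blast
next
  fix D assume "D \<in> itin_cell X f n ` ({..n} \<rightarrow>\<^sub>E U)"
  then show "D \<in> dyn_join X f U n"
    unfolding mem_dyn_join_iff[OF assms] by (auto simp: PiE_iff)
qed

section \<open>Cover numbers and the existence of the entropy of a covering\<close>

lemma cover_number_le: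
  "V \<subseteq> U \<Longrightarrow> finite V \<Longrightarrow> \<Union>V = X \<Longrightarrow> cover_number X U \<le> card V"
  unfolding cover_number_def by (rule Least_le) blast

lemma cover_number_attained:
  assumes "V \<subseteq> U" "finite V" "\<Union>V = X"
  obtains W where "W \<subseteq> U" "finite W" "\<Union>W = X" "card W = cover_number X U"
proof -
  have "\<exists>W\<subseteq>U. finite W \<and> \<Union>W = X \<and> card W = cover_number X U"
    unfolding cover_number_def by (rule LeastI_ex) (use assms in blast)
  then show ?thesis using that by blast
qed

lemma cover_number_ge_1:
  assumes "V \<subseteq> U" "finite V" "\<Union>V = X" "X \<noteq> {}"
  shows "1 \<le> cover_number X U"
proof -
  obtain W where "finite W" "\<Union>W = X" "card W = cover_number X U"
    using cover_number_attained[OF assms(1-3)] by metis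
  then show ?thesis using assms(4) by (metis Sup_empty card_eq_0_iff less_one not_less)
qed

lemma dyn_join_finite_subcover:
  assumes "U \<subseteq> Pow X" "f ` X \<subseteq> X" "V \<subseteq> U" "finite V" "\<Union>V = X"
  obtains W where "W \<subseteq> dyn_join X f U n" "finite W" "\<Union>W = X"
proof
  let ?W = "itin_cell X f n ` ({..n} \<rightarrow>\<^sub>E V)"
  show "?W \<subseteq> dyn_join X f U n"
    unfolding dyn_join_eq_PiE[OF assms(1)] by (intro image_mono PiE_mono assms(3))
  show "finite ?W" using assms(4) by (simp add: finite_PiE)
  show "\<Union>?W = X" by (rule Union_itin_cell[OF assms(5,2)])
qed

text \<open>Intersecting the members of a minimal subcover at time \<open>m\<close> with the
  preimages under \<open>f ^^ Suc m\<close> of those of a minimal subcover at time \<open>n\<close>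
  yields a subcover of the longer join.\<close>

lemma cover_number_dyn_join_submult:
  assumes "U \<subseteq> Pow X" "f ` X \<subseteq> X" "V \<subseteq> U" "finite V" "\<Union>V = X"
  shows "cover_number X (dyn_join X f U (Suc (m + n))) \<le>
    cover_number X (dyn_join X f U m) * cover_number X (dyn_join X f U n)"
proof -
  obtain A where A: "A \<subseteq> dyn_join X f U m" "finite A" "\<Union>A = X"
      "card A = cover_number X (dyn_join X f U m)"
    by (metis dyn_join_finite_subcover[OF assms] cover_number_attained)
  obtain B where B: "B \<subseteq> dyn_join X f U n" "finite B" "\<Union>B = X"
      "card B = cover_number X (dyn_join X f U n)"
    by (metis dyn_join_finite_subcover[OF assms] cover_number_attained)
  define W where "W = (\<lambda>(C, D). C \<inter> ((f ^^ Suc m) -` D \<inter> X)) ` (A \<times> B)"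
  have "W \<subseteq> dyn_join X f U (Suc (m + n))"
  proof
    fix E assume "E \<in> W"
    then obtain C D where CD: "C \<in> A" "D \<in> B" "E = C \<inter> ((f ^^ Suc m) -` D \<inter> X)"
      by (auto simp: W_def)
    obtain a where a: "\<forall>i\<le>m. a i \<in> U" "C = itin_cell X f m a"
      using CD A mem_dyn_join_iff[OF assms(1)] by blast
    obtain b where b: "\<forall>i\<le>n. b i \<in> U" "D = itin_cell X f n b"
      using CD B mem_dyn_join_iff[OF assms(1)] by blast
    show "E \<in> dyn_join X f U (Suc (m + n))"
      unfolding mem_dyn_join_iff[OF assms(1)] CD(3) a(2) b(2) itin_cell_append[OF assms(2)]
      by (rule exI[of _ "\<lambda>i. if i \<le> m then a i else b (i - Suc m)"]) (use a b in auto)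
  qed
  moreover have "finite W" unfolding W_def using A B by simp
  moreover have "\<Union>W = X"
  proof
    show "\<Union>W \<subseteq> X" using A by (auto simp: W_def)
    show "X \<subseteq> \<Union>W"
    proof
      fix x assume x: "x \<in> X"
      have "(f ^^ i) x \<in> X" for i using x assms(2) by (induction i) auto
      then obtain D where D: "D \<in> B" "(f ^^ Suc m) x \<in> D" using B by blast
      obtain C where C: "C \<in> A" "x \<in> C" using A x by blast
      have "x \<in> C \<inter> ((f ^^ Suc m) -` D \<inter> X)" using C D x by simp
      then show "x \<in> \<Union>W" unfolding W_def using C D by blast
    qed
  qed
  ultimately have "cover_number X (dyn_join X f U (Suc (m + n))) \<le> card W"
    by (rule cover_number_le)
  also have "\<dots> \<le> card (A \<times> B)" unfolding W_def using A B by (intro card_image_le) simp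
  finally show ?thesis using A B by (simp add: card_cartesian_product)
qed

lemma open_covering_finite_subcover:
  assumes "compact X" "open_covering X U"
  obtains V where "V \<subseteq> U" "finite V" "\<Union>V = X"
proof -
  have "\<forall>A\<in>U. \<exists>G. open G \<and> A = X \<inter> G"
    using assms(2) by (auto simp: open_covering_def openin_open)
  then obtain G where G: "\<And>A. A \<in> U \<Longrightarrow> open (G A)" "\<And>A. A \<in> U \<Longrightarrow> A = X \<inter> G A" by metis
  have "X \<subseteq> \<Union>(G ` U)" using assms(2) G(2) unfolding open_covering_def by blast
  then obtain V where V: "V \<subseteq> U" "finite V" "X \<subseteq> \<Union>(G ` V)"
    using compactE_image[OF assms(1), of U G] G(1) by metis
  have "\<Union>V = X"
  proof
    show "\<Union>V \<subseteq> X" using V(1) G(2) by blast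
    show "X \<subseteq> \<Union>V" using V(1,3) G(2) by blast
  qed
  then show ?thesis using that V by blast
qed

lemma cover_entropy_tendsto:
  assumes "U \<subseteq> Pow X" "f ` X \<subseteq> X" "V \<subseteq> U" "finite V" "\<Union>V = X" "X \<noteq> {}"
  shows "(\<lambda>n. 1 / real n * cover_H X (dyn_join X f U n)) \<longlonglongrightarrow> cover_entropy X f U"
proof -
  have ge1: "1 \<le> cover_number X (dyn_join X f U n)" for n
    by (rule dyn_join_finite_subcover[OF assms(1-5), of n], rule cover_number_ge_1[OF _ _ _ assms(6)])
  have "convergent (\<lambda>n. 1 / real n * cover_H X (dyn_join X f U n))"
  proof (rule fekete_convergent_Suc)
    fix m n
    show "0 \<le> cover_H X (dyn_join X f U n)" unfolding cover_H_def using ge1[of n] by simp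
    have pos: "0 < real (cover_number X (dyn_join X f U k))" for k
      using ge1[of k] by simp
    have "real (cover_number X (dyn_join X f U (Suc (m + n)))) \<le>
      real (cover_number X (dyn_join X f U m)) * real (cover_number X (dyn_join X f U n))"
      using cover_number_dyn_join_submult[OF assms(1-5), of m n]
      by (metis of_nat_le_iff of_nat_mult)
    then have "ln (real (cover_number X (dyn_join X f U (Suc (m + n))))) \<le>
      ln (real (cover_number X (dyn_join X f U m)) * real (cover_number X (dyn_join X f U n)))"
      by (rule ln_mono[OF _ pos])
    then show "cover_H X (dyn_join X f U (Suc (m + n))) \<le>
      cover_H X (dyn_join X f U m) + cover_H X (dyn_join X f U n)"
      unfolding cover_H_def using pos by (simp add: ln_mult)
  qed
  then show ?thesis unfolding cover_entropy_def by (simp add: convergent_LIMSEQ_iff)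
qed

section \<open>Spanning families and the upper bound for coverings\<close>

text \<open>Bowen's spanning sets, phrased with pieces that are small in the metric of the first
  \<open>n\<close> steps. The bound \<open>g\<close> may depend on \<delta>, but its growth rate
  \<open>h\<close> may not; this one hypothesis feeds the upper bounds for coverings and for
  partitions.\<close>

definition spanning_growth :: "'a::metric_space set \<Rightarrow> ('a \<Rightarrow> 'a) \<Rightarrow> real \<Rightarrow> bool" where
  "spanning_growth X f h \<longleftrightarrow> (\<forall>\<delta>>0. \<exists>g. (\<lambda>n. 1 / real n * ln (g n)) \<longlonglongrightarrow> h \<and>
     (\<forall>n. \<exists>\<W>. finite \<W> \<and> \<Union>\<W> = X \<and> real (card \<W>) \<le> g n \<and>
       (\<forall>W\<in>\<W>. \<forall>p\<in>W. \<forall>q\<in>W. \<forall>i\<le>n. dist ((f ^^ i) p) ((f ^^ i) q) < \<delta>)))"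

text \<open>With \<delta> a Lebesgue number of the covering, every iterate of a sufficiently small
  piece lies in one member of \<open>U\<close>. Each piece thus lies in one element of the join, and
  a spanning family yields a subcover that is no larger.\<close>

lemma cover_entropy_le:
  fixes X :: "'a::real_normed_vector set"
  assumes "compact X" "X \<noteq> {}" "f ` X \<subseteq> X" "spanning_growth X f h" "open_covering X U"
  shows "cover_entropy X f U \<le> h"
proof -
  have sub: "U \<subseteq> Pow X" using assms(5) by (auto simp: open_covering_def)
  obtain V where V: "V \<subseteq> U" "finite V" "\<Union>V = X"
    using open_covering_finite_subcover assms(1,5) by metis
  have "\<forall>A\<in>U. \<exists>G. open G \<and> A = X \<inter> G"
    using assms(5) by (auto simp: open_covering_def openin_open)
  then obtain G where G: "\<And>A. A \<in> U \<Longrightarrow> open (G A)" "\<And>A. A \<in> U \<Longrightarrow> A = X \<inter> G A" by metis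
  have "X \<subseteq> \<Union>(G ` U)" using assms(5) G(2) unfolding open_covering_def by blast
  moreover have "G ` U \<noteq> {}" using \<open>X \<subseteq> \<Union>(G ` U)\<close> assms(2) by auto
  moreover have "\<And>B. B \<in> G ` U \<Longrightarrow> open B" using G by blast
  ultimately obtain \<delta> where \<delta>: "0 < \<delta>" "\<And>T. T \<subseteq> X \<Longrightarrow> diameter T < \<delta> \<Longrightarrow> \<exists>B\<in>G ` U. T \<subseteq> B"
    using Lebesgue_number_lemma[OF assms(1), of "G ` U"] by metis
  have inX: "(f ^^ i) x \<in> X" if "x \<in> X" for i x
    using that assms(3) by (induction i) auto
  \<comment> \<open>Half of \<delta>, because strict bounds on distances only give a non-strict
    bound on the diameter, and the diameter must be strictly below the Lebesgue number.\<close>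
  obtain g where g: "(\<lambda>n. 1 / real n * ln (g n)) \<longlonglongrightarrow> h"
    and W: "\<And>n. \<exists>\<W>. finite \<W> \<and> \<Union>\<W> = X \<and> real (card \<W>) \<le> g n \<and>
       (\<forall>W\<in>\<W>. \<forall>p\<in>W. \<forall>q\<in>W. \<forall>i\<le>n. dist ((f ^^ i) p) ((f ^^ i) q) < \<delta> / 2)"
    using assms(4)[unfolded spanning_growth_def, rule_format, of "\<delta> / 2"] \<open>0 < \<delta>\<close> by auto
  have "cover_H X (dyn_join X f U n) \<le> ln (g n)" for n
  proof -
    obtain \<W> where \<W>': "finite \<W> \<and> \<Union>\<W> = X \<and> real (card \<W>) \<le> g n \<and>
       (\<forall>W\<in>\<W>. \<forall>p\<in>W. \<forall>q\<in>W. \<forall>i\<le>n. dist ((f ^^ i) p) ((f ^^ i) q) < \<delta> / 2)"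
      using W[of n] ..
    then have \<W>: "finite \<W>" "\<Union>\<W> = X" "real (card \<W>) \<le> g n"
       "\<And>W p q i. W \<in> \<W> \<Longrightarrow> p \<in> W \<Longrightarrow> q \<in> W \<Longrightarrow> i \<le> n \<Longrightarrow> dist ((f ^^ i) p) ((f ^^ i) q) < \<delta> / 2"
      by (simp_all only:)
    have "\<exists>D\<in>dyn_join X f U n. W \<subseteq> D" if "W \<in> \<W>" for W
    proof -
      have "\<exists>A\<in>U. (f ^^ i) ` W \<subseteq> A" if "i \<le> n" for i
      proof -
        have "diameter ((f ^^ i) ` W) \<le> \<delta> / 2"
        proof (rule diameter_le)
          show "(f ^^ i) ` W \<noteq> {} \<or> 0 \<le> \<delta> / 2" using \<delta>(1) by simp
          fix y z assume "y \<in> (f ^^ i) ` W" "z \<in> (f ^^ i) ` W"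
          then show "norm (y - z) \<le> \<delta> / 2"
            using \<W>(4)[OF \<open>W \<in> \<W>\<close> _ _ that] by (auto simp: dist_norm[symmetric] intro!: less_imp_le)
        qed
        moreover have "(f ^^ i) ` W \<subseteq> X" using inX \<open>W \<in> \<W>\<close> \<W>(2) by blast
        ultimately obtain A where "A \<in> U" "(f ^^ i) ` W \<subseteq> G A"
          using \<delta>(2)[of "(f ^^ i) ` W"] \<delta>(1) by fastforce
        with \<open>(f ^^ i) ` W \<subseteq> X\<close> show ?thesis using G(2) by blast
      qed
      then obtain a where a: "\<And>i. i \<le> n \<Longrightarrow> a i \<in> U" "\<And>i. i \<le> n \<Longrightarrow> (f ^^ i) ` W \<subseteq> a i" by metis
      have "W \<subseteq> itin_cell X f n a" using a(2) \<open>W \<in> \<W>\<close> \<W>(2) by (auto simp: itin_cell_def)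
      moreover have "itin_cell X f n a \<in> dyn_join X f U n"
        unfolding mem_dyn_join_iff[OF sub] using a(1) by blast
      ultimately show ?thesis by blast
    qed
    then obtain D where D: "\<And>W. W \<in> \<W> \<Longrightarrow> D W \<in> dyn_join X f U n" "\<And>W. W \<in> \<W> \<Longrightarrow> W \<subseteq> D W" by metis
    have DX: "D W \<subseteq> X" if "W \<in> \<W>" for W
      using D(1)[OF that] unfolding mem_dyn_join_iff[OF sub] by (auto simp: itin_cell_def)
    have Dcov: "D ` \<W> \<subseteq> dyn_join X f U n" "finite (D ` \<W>)" "\<Union>(D ` \<W>) = X"
    proof -
      show "D ` \<W> \<subseteq> dyn_join X f U n" using D(1) by blast
      show "finite (D ` \<W>)" using \<W>(1) by simp
      show "\<Union>(D ` \<W>) = X"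
      proof
        show "\<Union>(D ` \<W>) \<subseteq> X" using DX by blast
        show "X \<subseteq> \<Union>(D ` \<W>)" using D(2) \<W>(2) by blast
      qed
    qed
    have ge: "1 \<le> cover_number X (dyn_join X f U n)"
      by (rule cover_number_ge_1[OF Dcov assms(2)])
    have "cover_number X (dyn_join X f U n) \<le> card (D ` \<W>)"
      by (rule cover_number_le[OF Dcov])
    also have "card (D ` \<W>) \<le> card \<W>" using \<W>(1) by (rule card_image_le)
    finally have "real (cover_number X (dyn_join X f U n)) \<le> g n" using \<W>(3) by linarith
    then show ?thesis unfolding cover_H_def using ge by (intro ln_mono) auto
  qed
  then have "1 / real n * cover_H X (dyn_join X f U n) \<le> 1 / real n * ln (g n)" for n
    by (intro mult_left_mono) auto
  then show ?thesis
    using LIMSEQ_le[OF cover_entropy_tendsto[OF sub assms(3) V assms(2)] g] by blast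
qed

section \<open>Entropy of partitions\<close>

text \<open>Sum \<open>ln t \<le> t - 1\<close> at \<open>t = q i / p i\<close> with weights
  \<open>p i\<close>. Since \<open>ln 0\<close> is an ordinary real number here, zeros of
  \<open>q\<close> must be zeros of \<open>p\<close>, or an infinite term would go unnoticed. Only
  the inequality between the totals enters, so \<open>q\<close> may be a subprobability.\<close>

lemma gibbs_inequality:
  fixes p q :: "'i \<Rightarrow> real"
  assumes "finite I" "\<And>i. i \<in> I \<Longrightarrow> 0 \<le> p i" "\<And>i. i \<in> I \<Longrightarrow> 0 \<le> q i"
    and "\<And>i. i \<in> I \<Longrightarrow> q i = 0 \<Longrightarrow> p i = 0" "sum q I \<le> sum p I"
  shows "- (\<Sum>i\<in>I. p i * ln (p i)) \<le> - (\<Sum>i\<in>I. p i * ln (q i))"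
proof -
  have "p i * ln (q i) - p i * ln (p i) \<le> q i - p i" if i: "i \<in> I" for i
  proof (cases "p i = 0")
    case False
    then have pos: "0 < p i" "0 < q i" using assms(2-4)[OF i] by force+
    have "ln (q i / p i) \<le> q i / p i - 1" using pos by (intro ln_le_minus_one) simp
    then have "p i * ln (q i / p i) \<le> p i * (q i / p i - 1)" using pos by (intro mult_left_mono) auto
    then show ?thesis using pos by (simp add: ln_div algebra_simps)
  qed (use assms(3)[OF i] in simp)
  then have "(\<Sum>i\<in>I. p i * ln (q i) - p i * ln (p i)) \<le> (\<Sum>i\<in>I. q i - p i)" by (rule sum_mono)
  then show ?thesis using assms(5) by (simp add: sum_subtractf)
qed

lemma (in finite_measure) sum_measure_Int_cover:
  assumes "finite J" "disjoint_family_on C J" "C ` J \<subseteq> sets M" "\<Union>(C ` J) = space M" "A \<in> sets M"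
  shows "(\<Sum>j\<in>J. measure M (A \<inter> C j)) = measure M A"
proof -
  have "measure M (\<Union>j\<in>J. A \<inter> C j) = (\<Sum>j\<in>J. measure M (A \<inter> C j))"
    using assms by (intro finite_measure_finite_Union) (auto simp: disjoint_family_on_def)
  moreover have "(\<Union>j\<in>J. A \<inter> C j) = A"
    using assms(4) sets.sets_into_space[OF assms(5)] by blast
  ultimately show ?thesis by simp
qed

text \<open>Two indices of a disjoint family with the same set have the empty set, whose
  contribution is \<open>g 0 = 0\<close>. So nothing is lost when a join, being a set of sets,
  identifies coinciding cells.\<close>

lemma sum_measure_image_disjoint:
  fixes F :: "'i \<Rightarrow> 'a set" and g :: "real \<Rightarrow> real"
  assumes "finite I" "disjoint_family_on F I" "g 0 = 0"
  shows "(\<Sum>D\<in>F ` I. g (measure M D)) = (\<Sum>i\<in>I. g (measure M (F i)))"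
proof (subst sum.reindex_nontrivial[OF assms(1)])
  fix i j assume "i \<in> I" "j \<in> I" "i \<noteq> j" "F i = F j"
  then have "F i = {}" using assms(2) unfolding disjoint_family_on_def by blast
  then show "g (measure M (F i)) = 0" using assms(3) by simp
qed simp

lemma UN_vimage_cover:
  "\<Union>(C ` J) = X \<Longrightarrow> (\<And>x. x \<in> X \<Longrightarrow> g x \<in> X) \<Longrightarrow> (\<Union>b\<in>J. g -` C b \<inter> X) = X"
  by blast

lemma itin_cell_disjoint:
  assumes "partition_on X P"
  shows "disjoint_family_on (itin_cell X f n) ({..n} \<rightarrow>\<^sub>E P)"
  unfolding disjoint_family_on_def
proof (intro ballI impI)
  fix a b assume ab: "a \<in> {..n} \<rightarrow>\<^sub>E P" "b \<in> {..n} \<rightarrow>\<^sub>E P" "a \<noteq> b"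
  then obtain i where i: "i \<le> n" "a i \<noteq> b i" using PiE_ext[of a _ _ b] by (metis atMost_iff)
  then have "a i \<inter> b i = {}"
    using ab assms by (intro disjointD[OF partition_onD2[OF assms]]) (auto simp: PiE_iff)
  then show "itin_cell X f n a \<inter> itin_cell X f n b = {}"
    using i(1) unfolding itin_cell_def by blast
qed

section \<open>Invariant measures and the existence of the entropy of a partition\<close>

locale measure_preserving_map = prob_space M for M :: "'a measure" +
  fixes f :: "'a \<Rightarrow> 'a"
  assumes meas[measurable]: "f \<in> measurable M M" and inv: "distr M M f = M"
begin

lemma image_space: "f ` space M \<subseteq> space M"
  using measurable_space[OF meas] by blast

lemma funpow_measurable[measurable]: "(f ^^ n) \<in> measurable M M"
proof (induction n)
  case (Suc n)
  then show ?case using measurable_comp[OF Suc meas] by simp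
qed (simp add: id_def)

lemma funpow_inv: "distr M M (f ^^ n) = M"
proof (induction n)
  case (Suc n)
  have "distr M M (f ^^ Suc n) = distr (distr M M (f ^^ n)) M f"
    by (subst distr_distr) auto
  also have "\<dots> = M" by (simp only: Suc inv)
  finally show ?case .
qed (simp add: id_def)

lemma measure_vimage_funpow:
  "A \<in> sets M \<Longrightarrow> measure M ((f ^^ n) -` A \<inter> space M) = measure M A"
  using measure_distr[OF funpow_measurable, of A n] funpow_inv by simp

lemma itin_cell_sets[measurable]:
  assumes "\<And>i. i \<le> n \<Longrightarrow> a i \<in> sets M"
  shows "itin_cell (space M) f n a \<in> sets M"
proof -
  have "itin_cell (space M) f n a = (\<Inter>i\<in>{..n}. (f ^^ i) -` a i \<inter> space M)"
    by (auto simp: itin_cell_def)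
  also have "\<dots> \<in> sets M" using assms by (intro sets.finite_INT) (auto intro: measurable_sets[OF funpow_measurable])
  finally show ?thesis .
qed

context
  fixes P :: "'a set set"
  assumes fin: "finite P" and sets: "P \<subseteq> sets M" and part: "partition_on (space M) P"
begin

abbreviation "cell \<equiv> itin_cell (space M) f"
abbreviation "words (n :: nat) \<equiv> {..n} \<rightarrow>\<^sub>E P"

lemma finite_words: "finite (words n)" using fin by (simp add: finite_PiE)

lemma cell_sets: "a \<in> words n \<Longrightarrow> cell n a \<in> sets M"
  by (rule itin_cell_sets) (rule subsetD[OF sets], erule PiE_mem, simp)

lemma Pow_space: "P \<subseteq> Pow (space M)" using partition_onD1[OF part] by blast

lemma Union_cell: "\<Union>(cell n ` words n) = space M"
  by (rule Union_itin_cell[OF partition_onD1[OF part, symmetric] image_space])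

lemma sum_cells: "A \<in> sets M \<Longrightarrow> (\<Sum>a\<in>words n. measure M (A \<inter> cell n a)) = measure M A"
  by (rule sum_measure_Int_cover[OF finite_words itin_cell_disjoint[OF part] image_subsetI[OF cell_sets] Union_cell])

lemma sum_cell: "(\<Sum>a\<in>words n. measure M (cell n a)) = 1"
proof -
  have "space M \<inter> cell n a = cell n a" for a
    unfolding itin_cell_def by blast
  then show ?thesis using sum_cells[OF sets.top, of n] by (simp only: prob_space)
qed

lemma partition_H_dyn_join:
  "partition_H M (dyn_join (space M) f P n) =
    - (\<Sum>a\<in>words n. measure M (cell n a) * ln (measure M (cell n a)))"
  unfolding partition_H_def dyn_join_eq_PiE[OF Pow_space]
  by (subst sum_measure_image_disjoint[OF finite_words itin_cell_disjoint[OF part], of "\<lambda>t. t * ln t" M])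
    simp_all

lemma partition_H_nonneg: "0 \<le> partition_H M (dyn_join (space M) f P n)"
proof -
  have "t * ln t \<le> 0" if "0 \<le> t" "t \<le> 1" for t :: real
    using that by (cases "t = 0") (auto simp: mult_nonneg_nonpos)
  then show ?thesis unfolding partition_H_dyn_join by (auto intro!: sum_nonpos)
qed

text \<open>Mutual information is nonnegative: Gibbs' inequality compares the joint law
  \<open>p\<close> of the first word and the shifted second word with the product \<open>q\<close>
  of their laws. Invariance of the measure makes the law of the second word independent of the
  shift.\<close>

lemma partition_H_subadditive:
  "partition_H M (dyn_join (space M) f P (Suc (m + n))) \<le>
    partition_H M (dyn_join (space M) f P m) + partition_H M (dyn_join (space M) f P n)"
proof -
  let ?X = "space M"
  define F where "F = (\<lambda>(a, b). cell m a \<inter> ((f ^^ Suc m) -` cell n b \<inter> ?X))"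
  define p where "p ab = measure M (F ab)" for ab
  define q where "q = (\<lambda>(a, b). measure M (cell m a) * measure M (cell n b))"
  define I where "I = words m \<times> words n"
  have finI: "finite I" unfolding I_def using finite_words by simp
  have disj: "disjoint_family_on F I"
    unfolding disjoint_family_on_def
  proof (intro ballI impI)
    fix u v assume uv: "u \<in> I" "v \<in> I" "u \<noteq> v"
    obtain a b a' b' where [simp]: "u = (a, b)" "v = (a', b')" by (metis surj_pair)
    have "a \<noteq> a' \<Longrightarrow> cell m a \<inter> cell m a' = {}" "b \<noteq> b' \<Longrightarrow> cell n b \<inter> cell n b' = {}"
      using uv itin_cell_disjoint[OF part, of f] unfolding disjoint_family_on_def I_def by auto
    then show "F u \<inter> F v = {}" using uv(3) unfolding F_def by auto
  qed
  have FI: "dyn_join ?X f P (Suc (m + n)) = F ` I"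
  proof
    show "F ` I \<subseteq> dyn_join ?X f P (Suc (m + n))"
    proof (rule image_subsetI)
      fix u assume "u \<in> I"
      then obtain a b where u: "u = (a, b)" and ab: "(a, b) \<in> I" by (cases u) auto
      show "F u \<in> dyn_join ?X f P (Suc (m + n))"
        unfolding u mem_dyn_join_iff[OF Pow_space] F_def prod.case itin_cell_append[OF image_space]
        by (rule exI[of _ "\<lambda>i. if i \<le> m then a i else b (i - Suc m)"])
           (use ab in \<open>auto simp: I_def PiE_iff\<close>)
    qed
    show "dyn_join ?X f P (Suc (m + n)) \<subseteq> F ` I"
    proof
      fix D assume "D \<in> dyn_join ?X f P (Suc (m + n))"
      then obtain c where c: "\<forall>i\<le>Suc (m + n). c i \<in> P" "D = cell (Suc (m + n)) c"
        unfolding mem_dyn_join_iff[OF Pow_space] by blast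
      define a where "a = restrict c {..m}"
      define b where "b = restrict (\<lambda>i. c (i + Suc m)) {..n}"
      have "D = F (a, b)"
        unfolding F_def prod.case itin_cell_append[OF image_space] c(2)
        by (rule itin_cell_cong) (auto simp: a_def b_def)
      moreover have "(a, b) \<in> I" using c(1) by (auto simp: I_def a_def b_def)
      ultimately show "D \<in> F ` I" by blast
    qed
  qed
  have pre: "(f ^^ Suc m) -` cell n b \<inter> ?X \<in> sets M" if "b \<in> words n" for b
    using cell_sets[OF that] by (intro measurable_sets[OF funpow_measurable])
  have marg1: "(\<Sum>b\<in>words n. p (a, b)) = measure M (cell m a)" if "a \<in> words m" for a
    unfolding p_def F_def prod.case
  proof (rule sum_measure_Int_cover[OF finite_words])
    show "disjoint_family_on (\<lambda>b. (f ^^ Suc m) -` cell n b \<inter> ?X) (words n)"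
      using itin_cell_disjoint[OF part, of f n] unfolding disjoint_family_on_def by blast
    show "(\<lambda>b. (f ^^ Suc m) -` cell n b \<inter> ?X) ` words n \<subseteq> sets M" using pre by blast
    have "(f ^^ Suc m) x \<in> ?X" if "x \<in> ?X" for x
      using measurable_space[OF funpow_measurable that] .
    then show "(\<Union>b\<in>words n. (f ^^ Suc m) -` cell n b \<inter> ?X) = ?X"
      by (rule UN_vimage_cover[OF Union_cell])
    show "cell m a \<in> sets M" using cell_sets[OF that] .
  qed
  have marg2: "(\<Sum>a\<in>words m. p (a, b)) = measure M (cell n b)" if b: "b \<in> words n" for b
  proof -
    have "(\<Sum>a\<in>words m. p (a, b)) = (\<Sum>a\<in>words m. measure M (((f ^^ Suc m) -` cell n b \<inter> ?X) \<inter> cell m a))"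
      unfolding p_def F_def prod.case by (simp only: Int_commute)
    also have "\<dots> = measure M ((f ^^ Suc m) -` cell n b \<inter> ?X)" by (rule sum_cells[OF pre[OF b]])
    also have "\<dots> = measure M (cell n b)" by (rule measure_vimage_funpow[OF cell_sets[OF b]])
    finally show ?thesis .
  qed
  \<comment> \<open>Used twice: as the condition on zeros in Gibbs' inequality, and to split the
    logarithm of a product only where both factors are positive.\<close>
  have zero: "p (a, b) = 0" if "a \<in> words m" "b \<in> words n" "measure M (cell m a) = 0 \<or> measure M (cell n b) = 0" for a b
  proof -
    have "p (a, b) \<le> (\<Sum>b\<in>words n. p (a, b))"
      using finite_words that(2) by (intro member_le_sum) (auto simp: p_def)
    moreover have "p (a, b) \<le> (\<Sum>a\<in>words m. p (a, b))"
      using finite_words that(1) by (intro member_le_sum[of a _ "\<lambda>a. p (a, b)"]) (auto simp: p_def)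
    moreover have "0 \<le> p (a, b)" by (simp add: p_def)
    ultimately show ?thesis using marg1 marg2 that by auto
  qed
  have "partition_H M (dyn_join ?X f P (Suc (m + n))) = - (\<Sum>i\<in>I. p i * ln (p i))"
    unfolding partition_H_def FI p_def
    using sum_measure_image_disjoint[OF finI disj, of "\<lambda>t. t * ln t" M] by simp
  also have "\<dots> \<le> - (\<Sum>i\<in>I. p i * ln (q i))"
  proof (rule gibbs_inequality[OF finI])
    show "0 \<le> p i" "0 \<le> q i" for i by (auto simp: p_def q_def split: prod.split)
    show "q i = 0 \<Longrightarrow> p i = 0" if "i \<in> I" for i
      using that zero by (cases i) (auto simp: q_def I_def)
    have "sum q I = 1"
      unfolding I_def q_def by (simp add: sum.cartesian_product[symmetric] sum_product[symmetric] sum_cell)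
    moreover have "sum p I = 1"
      unfolding I_def using marg1 sum_cell[of m] by (simp add: sum.cartesian_product' )
    ultimately show "sum q I \<le> sum p I" by simp
  qed
  also have "(\<Sum>i\<in>I. p i * ln (q i)) =
      (\<Sum>(a, b)\<in>I. p (a, b) * ln (measure M (cell m a)) + p (a, b) * ln (measure M (cell n b)))"
  proof (rule sum.cong[OF refl], clarify)
    fix a b assume ab: "(a, b) \<in> I"
    show "p (a, b) * ln (q (a, b)) = p (a, b) * ln (measure M (cell m a)) + p (a, b) * ln (measure M (cell n b))"
    proof (cases "p (a, b) = 0")
      case False
      then have "measure M (cell m a) > 0" "measure M (cell n b) > 0"
        using zero[of a b] ab by (auto simp: I_def zero_less_measure_iff)
      then show ?thesis by (simp add: q_def ln_mult algebra_simps)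
    qed simp
  qed
  also have "\<dots> = (\<Sum>a\<in>words m. \<Sum>b\<in>words n. p (a, b) * ln (measure M (cell m a))) +
      (\<Sum>a\<in>words m. \<Sum>b\<in>words n. p (a, b) * ln (measure M (cell n b)))"
    unfolding I_def by (simp add: sum.cartesian_product[symmetric] sum.distrib)
  also have "(\<Sum>a\<in>words m. \<Sum>b\<in>words n. p (a, b) * ln (measure M (cell m a))) =
      (\<Sum>a\<in>words m. measure M (cell m a) * ln (measure M (cell m a)))"
    by (intro sum.cong refl) (simp add: sum_distrib_right[symmetric] marg1)
  also have "(\<Sum>a\<in>words m. \<Sum>b\<in>words n. p (a, b) * ln (measure M (cell n b))) =
      (\<Sum>b\<in>words n. measure M (cell n b) * ln (measure M (cell n b)))"
    by (subst sum.swap, intro sum.cong refl) (simp add: sum_distrib_right[symmetric] marg2)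
  finally show ?thesis unfolding partition_H_dyn_join by simp
qed

lemma partition_entropy_tendsto:
  "(\<lambda>n. 1 / real n * partition_H M (dyn_join (space M) f P n)) \<longlonglongrightarrow> partition_entropy f M P"
proof -
  have "convergent (\<lambda>n. 1 / real n * partition_H M (dyn_join (space M) f P n))"
    by (rule fekete_convergent_Suc) (rule partition_H_nonneg, rule partition_H_subadditive)
  then show ?thesis unfolding partition_entropy_def by (simp add: convergent_LIMSEQ_iff)
qed

end
end

section \<open>Upper bound for the entropy of a partition\<close>

lemma compact_inner_approx:
  fixes N :: "'a::{second_countable_topology, complete_space} measure"
  assumes "finite_measure N" "sets N = sets borel" "A \<in> sets borel" "0 < e"
  shows "\<exists>K\<subseteq>A. compact K \<and> measure N A < measure N K + e"
proof (rule ccontr)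
  assume *: "\<not> ?thesis"
  interpret finite_measure N by fact
  have le: "measure N K \<le> measure N A - e" if "K \<subseteq> A" "compact K" for K
  proof (rule ccontr)
    assume "\<not> ?thesis"
    then have "measure N A < measure N K + e" by simp
    then show False using * \<open>K \<subseteq> A\<close> \<open>compact K\<close> by blast
  qed
  have ge0: "0 \<le> measure N A - e" using le[of "{}"] by simp
  have fin: "emeasure N (space N) \<noteq> \<infinity>" by simp
  have "emeasure N A = (SUP K\<in>{K. K \<subseteq> A \<and> compact K}. emeasure N K)"
    by (rule inner_regular[OF assms(2) fin assms(3)])
  also have "\<dots> \<le> ennreal (measure N A - e)"
    using le by (intro SUP_least) (auto simp: emeasure_eq_measure intro!: ennreal_leI)
  finally have "measure N A \<le> measure N A - e"
    using ge0 by (simp add: emeasure_eq_measure ennreal_le_iff)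
  then show False using \<open>0 < e\<close> by simp
qed

text \<open>Serves to recover the index \<open>i\<close> from a point of \<open>K i\<close> that is
  known only up to an error below \<delta>.\<close>

lemma finite_compact_separation:
  fixes K :: "'i \<Rightarrow> 'a::heine_borel set"
  assumes "finite I" "\<And>i. i \<in> I \<Longrightarrow> compact (K i)" "disjoint_family_on K I"
  shows "\<exists>\<delta>>0. \<forall>i\<in>I. \<forall>j\<in>I. \<forall>x\<in>K i. \<forall>y\<in>K j. dist x y < \<delta> \<longrightarrow> i = j"
proof -
  have "\<exists>d>0. \<forall>x\<in>K i. \<forall>y\<in>K j. i \<noteq> j \<longrightarrow> d \<le> dist x y" if "i \<in> I" "j \<in> I" for i j
  proof (cases "i = j")
    case False
    then have "\<exists>d>0. \<forall>x\<in>K i. \<forall>y\<in>K j. d \<le> dist x y"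
      using that assms by (intro separate_compact_closed) (auto simp: compact_imp_closed disjoint_family_on_def)
    then show ?thesis by blast
  qed (auto intro: exI[of _ 1])
  then obtain d where d: "\<And>i j. i \<in> I \<Longrightarrow> j \<in> I \<Longrightarrow> 0 < d i j"
    "\<And>i j x y. i \<in> I \<Longrightarrow> j \<in> I \<Longrightarrow> x \<in> K i \<Longrightarrow> y \<in> K j \<Longrightarrow> i \<noteq> j \<Longrightarrow> d i j \<le> dist x y"
    by metis
  define \<delta> where "\<delta> = Min (insert 1 ((\<lambda>(i, j). d i j) ` (I \<times> I)))"
  have "0 < \<delta>" unfolding \<delta>_def using assms(1) d(1) by (subst Min_gr_iff) auto
  moreover have "\<delta> \<le> d i j" if "i \<in> I" "j \<in> I" for i j
    unfolding \<delta>_def using assms(1) that by (intro Min_le) auto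
  ultimately show ?thesis
    by (intro exI[of _ \<delta>]) (meson d(2) leD order_trans)
qed

text \<open>Itineraries along \<open>P\<close> are encoded by first naming a member of the spanning family and then
  correcting it on the times at which the orbit is in the small set \<open>bad\<close>. Gibbs' inequality
  bounds the entropy by the mean length of this code.\<close>

lemma partition_H_code_bound:
  fixes M :: "'a measure" and \<W> :: "'w set" and r :: "'w \<Rightarrow> nat \<Rightarrow> 'a set"
  assumes mp: "measure_preserving_map M f"
    and P: "finite P" "P \<subseteq> sets M" "partition_on (space M) P"
    and W: "finite \<W>" "\<W> \<noteq> {}" and w: "\<And>x. x \<in> space M \<Longrightarrow> w x \<in> \<W>"
    and bad: "bad \<in> sets M"
    and r: "\<And>x i A. x \<in> space M \<Longrightarrow> i \<le> n \<Longrightarrow> (f ^^ i) x \<in> A - bad \<Longrightarrow> A \<in> P \<Longrightarrow> r (w x) i = A"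
    and \<epsilon>: "0 < \<epsilon>" "\<epsilon> < 1"
  shows "partition_H M (dyn_join (space M) f P n) \<le>
    ln (real (card \<W>)) + real (Suc n) * (- ln (1 - \<epsilon>) + ln (real (card P) / \<epsilon>) * measure M bad)"
proof -
  interpret measure_preserving_map M f by fact
  let ?X = "space M"
  let ?cell = "itin_cell ?X f n"
  let ?I = "{..n} \<rightarrow>\<^sub>E P"
  define k where "k = real (card P)"
  have "P \<noteq> {}" using partition_onD1[OF P(3)] not_empty by auto
  then have k1: "1 \<le> k" unfolding k_def using P(1)
    by (simp add: Suc_le_eq card_gt_0_iff)
  define N where "N = real (card \<W>)"
  have N1: "1 \<le> N" unfolding N_def using W by (simp add: Suc_le_eq card_gt_0_iff)
  \<comment> \<open>Probability that the true element is \<open>A\<close> when the guess is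
    \<open>B\<close>: mass \<open>1 - \<epsilon>\<close> goes to the guess and the rest is spread
    over \<open>P\<close>. The totals are at most 1 also when the guess lies outside
    \<open>P\<close>.\<close>
  define t where "t A B = (if A = B then 1 - \<epsilon> else \<epsilon> / k)" for A B :: "'a set"
  have tpos: "0 < t A B" for A B unfolding t_def using \<epsilon> k1 by simp
  have tsum: "(\<Sum>A\<in>P. t A B) \<le> 1" for B
  proof -
    have "(\<Sum>A\<in>P. t A B) \<le> (\<Sum>A\<in>P. (if A = B then 1 - \<epsilon> else 0) + \<epsilon> / k)"
      using \<epsilon> k1 by (intro sum_mono) (auto simp: t_def)
    also have "\<dots> = (\<Sum>A\<in>P. if A = B then 1 - \<epsilon> else 0) + \<epsilon>"
      using k1 by (simp add: sum.distrib k_def)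
    also have "(\<Sum>A\<in>P. if A = B then 1 - \<epsilon> else 0) \<le> 1 - \<epsilon>"
      using P(1) \<epsilon> by (simp add: sum.delta')
    finally show ?thesis by simp
  qed
  define c1 where "c1 = - ln (1 - \<epsilon>)"
  define c2 where "c2 = ln (k / \<epsilon>)"
  have c1: "0 \<le> c1" unfolding c1_def using \<epsilon> by simp
  have c2: "0 \<le> c2" unfolding c2_def using \<epsilon> k1 by (intro ln_ge_zero) (simp add: field_simps)
  define \<psi> where "\<psi> y = c1 + c2 * indicator bad y" for y
  \<comment> \<open>The equal mixture of the product laws belonging to the members of
    \<open>\<W>\<close>. Keeping only the summand of \<open>w x\<close> costs \<open>ln N\<close>;
    this is the price of naming the member. Each time step then costs \<open>c1\<close>, and
    \<open>c2\<close> more on \<open>bad\<close>.\<close>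
  define q where "q a = (\<Sum>W\<in>\<W>. (\<Prod>i\<le>n. t (a i) (r W i)) / N)" for a
  define p where "p a = measure M (?cell a)" for a
  have finI: "finite ?I" by (rule finite_words[OF P])
  have qpos: "0 < q a" for a
    unfolding q_def using W tpos N1 by (intro sum_pos divide_pos_pos prod_pos) auto
  have psum: "sum p ?I = 1" unfolding p_def by (rule sum_cell[OF P])
  have qsum: "sum q ?I \<le> 1"
  proof -
    have "sum q ?I = (\<Sum>W\<in>\<W>. (\<Sum>a\<in>?I. \<Prod>i\<le>n. t (a i) (r W i)) / N)"
      unfolding q_def by (subst sum.swap) (simp add: sum_divide_distrib)
    also have "\<dots> = (\<Sum>W\<in>\<W>. (\<Prod>i\<le>n. \<Sum>A\<in>P. t A (r W i)) / N)"
      using P(1) by (subst prod_sum_PiE) auto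
    also have "\<dots> \<le> (\<Sum>W\<in>\<W>. 1 / N)"
      using N1 tsum less_imp_le[OF tpos]
      by (intro sum_mono divide_right_mono prod_le_1 conjI sum_nonneg) auto
    also have "\<dots> = 1" using W N1 by (simp add: N_def)
    finally show ?thesis .
  qed
  have point: "- ln (q a) \<le> ln N + (\<Sum>i\<le>n. \<psi> ((f ^^ i) x))" if x: "x \<in> ?cell a" and a: "a \<in> ?I" for x a
  proof -
    have xX: "x \<in> ?X" using x by (simp add: itin_cell_def)
    define pr where "pr = (\<Prod>i\<le>n. t (a i) (r (w x) i))"
    have prpos: "0 < pr" unfolding pr_def using tpos by (intro prod_pos) auto
    have nn: "0 \<le> (\<Prod>i\<le>n. t (a i) (r W i)) / N" for W
      using N1 less_imp_le[OF tpos] by (intro divide_nonneg_pos prod_nonneg) auto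
    have "pr / N \<le> q a"
      unfolding q_def pr_def by (rule member_le_sum[OF w[OF xX] nn W(1)])
    then have "ln (pr / N) \<le> ln (q a)" using prpos N1 by (intro ln_mono) auto
    then have "- ln (q a) \<le> ln N - ln pr" using prpos N1 by (simp add: ln_div)
    also have "ln pr = (\<Sum>i\<le>n. ln (t (a i) (r (w x) i)))"
      unfolding pr_def using tpos by (intro ln_prod) (auto simp: less_imp_neq[symmetric])
    also have "ln N - (\<Sum>i\<le>n. ln (t (a i) (r (w x) i))) = ln N + (\<Sum>i\<le>n. - ln (t (a i) (r (w x) i)))"
      by (simp add: sum_negf)
    also have "(\<Sum>i\<le>n. - ln (t (a i) (r (w x) i))) \<le> (\<Sum>i\<le>n. \<psi> ((f ^^ i) x))"
    proof (rule sum_mono)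
      fix i assume "i \<in> {..n}"
      then have i: "i \<le> n" by simp
      have fa: "(f ^^ i) x \<in> a i" using x i by (simp add: itin_cell_def)
      have aP: "a i \<in> P" using a i by (auto simp: PiE_iff)
      show "- ln (t (a i) (r (w x) i)) \<le> \<psi> ((f ^^ i) x)"
      proof (cases "r (w x) i = a i")
        case True
        then show ?thesis using c2 by (simp add: t_def \<psi>_def c1_def indicator_def)
      next
        case False
        then have "(f ^^ i) x \<in> bad" using r[OF xX i _ aP] fa by blast
        moreover have "- ln (\<epsilon> / k) = c2" unfolding c2_def using \<epsilon> k1 by (simp add: ln_div)
        ultimately show ?thesis using False c1 by (auto simp: t_def \<psi>_def)
      qed
    qed
    finally show ?thesis by simp
  qed
  have \<psi>_meas[measurable]: "\<psi> \<in> borel_measurable M" unfolding \<psi>_def[abs_def] using bad by measurable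
  have \<psi>_int: "integrable M \<psi>"
    unfolding \<psi>_def[abs_def] using bad by (intro Bochner_Integration.integrable_add integrable_mult_right) (auto simp: emeasure_eq_measure)
  have \<psi>f_int: "integrable M (\<lambda>x. \<psi> ((f ^^ i) x))" for i
    using \<psi>_int integrable_distr[of "f ^^ i" M M \<psi>] by (simp add: funpow_inv)
  have \<psi>_val: "(\<integral>x. \<psi> ((f ^^ i) x) \<partial>M) = c1 + c2 * measure M bad" for i
  proof -
    have "(\<integral>x. \<psi> ((f ^^ i) x) \<partial>M) = integral\<^sup>L (distr M M (f ^^ i)) \<psi>"
      by (rule integral_distr[symmetric]) auto
    also have "\<dots> = integral\<^sup>L M \<psi>" by (simp only: funpow_inv)
    also have "\<dots> = c1 + c2 * measure M bad"
      unfolding \<psi>_def[abs_def] using bad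
      by (subst Bochner_Integration.integral_add) (auto simp: emeasure_eq_measure prob_space intro!: integrable_mult_right)
    finally show ?thesis .
  qed
  \<comment> \<open>An upper bound for the code length along the orbit of \<open>x\<close>. By
    invariance its mean is \<open>n + 1\<close> times the mean of \<psi>, plus
    \<open>ln N\<close>.\<close>
  define G where "G x = ln N + (\<Sum>i\<le>n. \<psi> ((f ^^ i) x))" for x
  have G_int: "integrable M G" unfolding G_def[abs_def] using \<psi>f_int by auto
  have cell_meas: "?cell a \<in> sets M" if "a \<in> ?I" for a by (rule cell_sets[OF P that])
  have "partition_H M (dyn_join ?X f P n) = - (\<Sum>a\<in>?I. p a * ln (p a))"
    unfolding p_def by (rule partition_H_dyn_join[OF P])
  also have "\<dots> \<le> - (\<Sum>a\<in>?I. p a * ln (q a))"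
  proof (rule gibbs_inequality[OF finI])
    show "0 \<le> p a" for a by (simp add: p_def)
    show "0 \<le> q a" for a using qpos[of a] by simp
    show "p a = 0" if "q a = 0" for a using qpos[of a] that by simp
    show "sum q ?I \<le> sum p ?I" using qsum psum by simp
  qed
  also have "\<dots> = (\<Sum>a\<in>?I. p a * - ln (q a))" by (simp add: sum_negf)
  also have "\<dots> \<le> (\<Sum>a\<in>?I. \<integral>x. indicator (?cell a) x * G x \<partial>M)"
  proof (rule sum_mono)
    fix a assume a: "a \<in> ?I"
    have "p a * - ln (q a) = (\<integral>x. indicator (?cell a) x * - ln (q a) \<partial>M)"
      using cell_meas[OF a] by (simp add: p_def)
    also have "\<dots> \<le> (\<integral>x. indicator (?cell a) x * G x \<partial>M)"
    proof (rule integral_mono)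
      show "integrable M (\<lambda>x. indicator (?cell a) x * - ln (q a))"
        using cell_meas[OF a] by (intro integrable_mult_left) (auto simp: emeasure_eq_measure)
      show "integrable M (\<lambda>x. indicator (?cell a) x * G x)"
        using integrable_mult_indicator[OF cell_meas[OF a] G_int] by simp
      show "indicator (?cell a) x * - ln (q a) \<le> indicator (?cell a) x * G x" for x
        using point[OF _ a, of x] by (auto simp: indicator_def G_def)
    qed
    finally show "p a * - ln (q a) \<le> (\<integral>x. indicator (?cell a) x * G x \<partial>M)" .
  qed
  also have "\<dots> = (\<integral>x. (\<Sum>a\<in>?I. indicator (?cell a) x * G x) \<partial>M)"
    using integrable_mult_indicator[OF cell_meas G_int]
    by (intro Bochner_Integration.integral_sum[symmetric]) simp
  also have "\<dots> = (\<integral>x. G x \<partial>M)"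
  proof (rule Bochner_Integration.integral_cong[OF refl])
    fix x assume x: "x \<in> ?X"
    obtain b where b: "b \<in> ?I" "x \<in> ?cell b" using Union_cell[OF P, of n] x by blast
    have "indicator (?cell a) x * G x = (if a = b then G x else 0)" if "a \<in> ?I" for a
    proof (cases "a = b")
      case False
      then have "?cell a \<inter> ?cell b = {}"
        using disjoint_family_onD[OF itin_cell_disjoint[OF P(3)] that b(1)] by blast
      then have "x \<notin> ?cell a" using b(2) by blast
      then show ?thesis using False by simp
    qed (use b in simp)
    then have "(\<Sum>a\<in>?I. indicator (?cell a) x * G x) = (\<Sum>a\<in>?I. if a = b then G x else 0)"
      by (intro sum.cong refl) 
    also have "\<dots> = G x" using b(1) finI by simp
    finally show "(\<Sum>a\<in>?I. indicator (?cell a) x * G x) = G x" .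
  qed
  also have "\<dots> = ln N + real (Suc n) * (c1 + c2 * measure M bad)"
    unfolding G_def using \<psi>f_int
    by (subst Bochner_Integration.integral_add) (auto simp: prob_space \<psi>_val Bochner_Integration.integral_sum)
  finally show ?thesis by (simp add: N_def c1_def c2_def k_def)
qed

text \<open>The elements of \<open>P\<close> are shrunk to compact sets that are a distance \<delta>
  apart. Outside \<open>bad\<close>, knowing an iterate up to \<delta> then determines its element,
  so the member of the spanning family predicts it. The corrections cost an amount per step that
  vanishes with \<epsilon>.\<close>

lemma partition_entropy_le:
  fixes M :: "'a::euclidean_space measure"
  assumes mp: "measure_preserving_map M f"
    and setsM: "sets M = sets (restrict_space borel X)" and X: "X \<in> sets borel"
    and growth: "spanning_growth X f h"
    and P: "finite P" "P \<subseteq> sets M" "partition_on (space M) P"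
  shows "partition_entropy f M P \<le> h"
proof -
  interpret measure_preserving_map M f by fact
  have spaceM: "space M = X" using sets_eq_imp_space_eq[OF setsM] by (simp add: space_restrict_space)
  have borelM: "A \<in> sets borel" "A \<subseteq> X" if "A \<in> sets M" for A
    using that X unfolding setsM by (auto simp: sets_restrict_space_iff)
  have "partition_entropy f M P \<le> h + (- ln (1 - \<epsilon>) + \<epsilon>)" if \<epsilon>: "0 < \<epsilon>" "\<epsilon> < 1" for \<epsilon>
  proof -
    define k where "k = real (card P)"
    have "P \<noteq> {}" using partition_onD1[OF P(3)] not_empty by auto
    then have k1: "1 \<le> k" unfolding k_def using P(1) by (simp add: Suc_le_eq card_gt_0_iff)
    define c2 where "c2 = ln (k / \<epsilon>)"
    have c2: "0 \<le> c2" unfolding c2_def using \<epsilon> k1 by (intro ln_ge_zero) (simp add: field_simps)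
    \<comment> \<open>Chosen so that \<open>bad\<close>, a union of \<open>k\<close> sets of measure
      at most \<eta>, satisfies \<open>c2 * measure M bad \<le> \<epsilon>\<close>; adding 1 makes
      the denominator positive given only \<open>0 \<le> c2\<close>.\<close>
    define \<eta> where "\<eta> = \<epsilon> / (c2 + 1) / k"
    have \<eta>: "0 < \<eta>" unfolding \<eta>_def using \<epsilon> c2 k1 by simp
    define N where "N = distr M borel (\<lambda>x. x)"
    have id_meas: "(\<lambda>x. x) \<in> measurable M borel"
      using borelM measurable_restrict_space1[of "\<lambda>x. x" borel borel X]
      by (simp add: measurable_cong_sets[OF setsM refl])
    interpret N: prob_space N unfolding N_def by (rule prob_space_distr[OF id_meas])
    have measN: "measure N A = measure M (A \<inter> X)" if "A \<in> sets borel" for A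
      unfolding N_def using that by (subst measure_distr[OF id_meas]) (auto simp: spaceM)
    have "\<exists>K\<subseteq>A. compact K \<and> measure N A < measure N K + \<eta>" if "A \<in> P" for A
      using borelM(1) P(2) that \<eta>
      by (intro compact_inner_approx N.finite_measure_axioms) (auto simp: N_def)
    then obtain K where K: "\<And>A. A \<in> P \<Longrightarrow> K A \<subseteq> A" "\<And>A. A \<in> P \<Longrightarrow> compact (K A)"
        "\<And>A. A \<in> P \<Longrightarrow> measure N A < measure N (K A) + \<eta>" by metis
    have PX: "A \<subseteq> X" if "A \<in> P" for A using that partition_onD1[OF P(3)] spaceM by blast
    have disjP: "A \<inter> B = {}" if "A \<in> P" "B \<in> P" "A \<noteq> B" for A B
      using that by (intro disjointD[OF partition_onD2[OF P(3)]])
    have K_sets: "K A \<in> sets M" if "A \<in> P" for A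
      using K(2)[OF that] K(1)[OF that] PX[OF that] X unfolding setsM
      by (auto simp: sets_restrict_space_iff borel_compact)
    have K_meas: "measure M (A - K A) \<le> \<eta>" if "A \<in> P" for A
    proof -
      have "A \<inter> X = A" "K A \<inter> X = K A" using PX[OF that] K(1)[OF that] by auto
      then have "measure M A < measure M (K A) + \<eta>"
        using K(3)[OF that] measN[of A] measN[of "K A"] borelM(1) P(2) K_sets that by auto
      moreover have "measure M (A - K A) = measure M A - measure M (K A)"
        using that P(2) K_sets K(1) by (intro finite_measure_Diff) auto
      ultimately show ?thesis by simp
    qed
    define bad where "bad = (\<Union>A\<in>P. A - K A)"
    have bad_sets: "bad \<in> sets M"
      unfolding bad_def using P(1,2) K_sets by (intro sets.finite_UN) auto
    have "measure M bad \<le> (\<Sum>A\<in>P. measure M (A - K A))"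
      unfolding bad_def using P(1,2) K_sets by (intro finite_measure_subadditive_finite) auto
    also have "\<dots> \<le> (\<Sum>A\<in>P. \<eta>)" by (intro sum_mono K_meas)
    also have "\<dots> = \<epsilon> / (c2 + 1)" using k1 by (simp add: \<eta>_def k_def)
    finally have bad_le: "measure M bad \<le> \<epsilon> / (c2 + 1)" .
    have "c2 * measure M bad \<le> c2 * (\<epsilon> / (c2 + 1))" using c2 bad_le by (intro mult_left_mono)
    also have "\<dots> \<le> \<epsilon>" using c2 \<epsilon> by (simp add: field_simps)
    finally have c2bad: "c2 * measure M bad \<le> \<epsilon>" .
    have disjK: "disjoint_family_on K P"
      unfolding disjoint_family_on_def using K(1) disjP by blast
    have "\<exists>\<delta>>0. \<forall>A\<in>P. \<forall>B\<in>P. \<forall>x\<in>K A. \<forall>y\<in>K B. dist x y < \<delta> \<longrightarrow> A = B"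
      by (rule finite_compact_separation[of P K, OF P(1) K(2) disjK])
    then obtain \<delta> where \<delta>: "0 < \<delta>"
      "\<And>A B x y. A \<in> P \<Longrightarrow> B \<in> P \<Longrightarrow> x \<in> K A \<Longrightarrow> y \<in> K B \<Longrightarrow> dist x y < \<delta> \<Longrightarrow> A = B"
      by blast
    obtain g where g: "(\<lambda>n. 1 / real n * ln (g n)) \<longlonglongrightarrow> h"
      and W: "\<And>n. \<exists>\<W>. finite \<W> \<and> \<Union>\<W> = X \<and> real (card \<W>) \<le> g n \<and>
       (\<forall>W\<in>\<W>. \<forall>p\<in>W. \<forall>q\<in>W. \<forall>i\<le>n. dist ((f ^^ i) p) ((f ^^ i) q) < \<delta>)"
      using growth[unfolded spanning_growth_def, rule_format, OF \<delta>(1)] by auto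
    have bound: "partition_H M (dyn_join (space M) f P n) \<le> ln (g n) + real (Suc n) * (- ln (1 - \<epsilon>) + \<epsilon>)" for n
    proof -
      obtain \<W> where \<W>': "finite \<W> \<and> \<Union>\<W> = X \<and> real (card \<W>) \<le> g n \<and>
       (\<forall>W\<in>\<W>. \<forall>p\<in>W. \<forall>q\<in>W. \<forall>i\<le>n. dist ((f ^^ i) p) ((f ^^ i) q) < \<delta>)"
        using W[of n] ..
      then have \<W>: "finite \<W>" "\<Union>\<W> = X" "real (card \<W>) \<le> g n"
       "\<And>W p q i. W \<in> \<W> \<Longrightarrow> p \<in> W \<Longrightarrow> q \<in> W \<Longrightarrow> i \<le> n \<Longrightarrow> dist ((f ^^ i) p) ((f ^^ i) q) < \<delta>"
        by (simp_all only:)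
      have "\<forall>x\<in>X. \<exists>W\<in>\<W>. x \<in> W" using \<W>(2) by blast
      then obtain w where w: "\<And>x. x \<in> X \<Longrightarrow> w x \<in> \<W>" "\<And>x. x \<in> X \<Longrightarrow> x \<in> w x" by metis
      \<comment> \<open>Any point of \<open>W\<close> whose iterate lies in one of the compact sets
        may be asked: by the separation, all of them name the same element.\<close>
      define r where "r W i = (SOME A. A \<in> P \<and> (\<exists>y\<in>W. (f ^^ i) y \<in> K A))" for W i
      have r: "r (w x) i = A" if "x \<in> X" "i \<le> n" "(f ^^ i) x \<in> A - bad" "A \<in> P" for x i A
      proof -
        have xA: "(f ^^ i) x \<in> K A" using that unfolding bad_def by blast
        have ex: "A \<in> P \<and> (\<exists>y\<in>w x. (f ^^ i) y \<in> K A)" using xA that w by blast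
        have "r (w x) i \<in> P \<and> (\<exists>y\<in>w x. (f ^^ i) y \<in> K (r (w x) i))"
          unfolding r_def by (rule someI[of _ A]) (rule ex)
        then obtain y where y: "r (w x) i \<in> P" "y \<in> w x" "(f ^^ i) y \<in> K (r (w x) i)" by blast
        show ?thesis
          by (rule \<delta>(2)[OF y(1) that(4) y(3) xA]) (rule \<W>(4)[OF w(1)[OF that(1)] y(2) w(2)[OF that(1)] that(2)])
      qed
      have "\<W> \<noteq> {}" using \<W>(2) not_empty spaceM by auto
      then have pos: "0 < real (card \<W>)" using \<W>(1) by (simp add: card_gt_0_iff)
      have "partition_H M (dyn_join (space M) f P n) \<le>
        ln (real (card \<W>)) + real (Suc n) * (- ln (1 - \<epsilon>) + ln (real (card P) / \<epsilon>) * measure M bad)"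
        using w(1) r \<epsilon>
        by (intro partition_H_code_bound[OF mp P \<W>(1) \<open>\<W> \<noteq> {}\<close> _ bad_sets, of w n r])
           (auto simp: spaceM)
      also have "\<dots> \<le> ln (g n) + real (Suc n) * (- ln (1 - \<epsilon>) + \<epsilon>)"
        using c2bad \<W>(3) pos unfolding c2_def k_def
        by (intro add_mono mult_left_mono ln_mono) auto
      finally show ?thesis .
    qed
    define c where "c = - ln (1 - \<epsilon>) + \<epsilon>"
    have "(\<lambda>n. 1 / real n * ln (g n) + (real (Suc n) / real n) * c) \<longlonglongrightarrow> h + 1 * c"
      by (intro tendsto_add tendsto_mult g LIMSEQ_Suc_n_over_n tendsto_const)
    moreover have "1 / real n * partition_H M (dyn_join (space M) f P n) \<le>
        1 / real n * ln (g n) + (real (Suc n) / real n) * c" for n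
      using mult_left_mono[OF bound[of n], of "1 / real n"] by (simp add: c_def distrib_left)
    ultimately have "partition_entropy f M P \<le> h + 1 * c"
      using LIMSEQ_le[OF partition_entropy_tendsto[OF P]] by blast
    then show ?thesis by (simp add: c_def)
  qed
  then have "eventually (\<lambda>\<epsilon>. partition_entropy f M P \<le> h + (- ln (1 - \<epsilon>) + \<epsilon>)) (at_right 0)"
    using eventually_at_right_real[of 0 1] by (auto elim!: eventually_mono)
  moreover have "((\<lambda>\<epsilon>. h + (- ln (1 - \<epsilon>) + \<epsilon>)) \<longlongrightarrow> h + (- ln (1 - 0) + 0)) (at_right 0)"
    by (intro tendsto_intros) auto
  ultimately have "partition_entropy f M P \<le> h + (- ln (1 - 0) + 0)"
    by (intro tendsto_lowerbound[of _ _ "at_right (0::real)"]) auto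
  then show ?thesis by simp
qed

section \<open>The skew product and its attractor\<close>

lemma measurable_fst_borel[measurable (raw)]:
  fixes g :: "'a \<Rightarrow> real \<times> real"
  shows "g \<in> borel_measurable M \<Longrightarrow> (\<lambda>x. fst (g x)) \<in> borel_measurable M"
  by (rule measurable_compose[of g M borel fst]) (auto intro!: borel_measurable_continuous_onI continuous_intros)

lemma measurable_snd_borel[measurable (raw)]:
  fixes g :: "'a \<Rightarrow> real \<times> real"
  shows "g \<in> borel_measurable M \<Longrightarrow> (\<lambda>x. snd (g x)) \<in> borel_measurable M"
  by (rule measurable_compose[of g M borel snd]) (auto intro!: borel_measurable_continuous_onI continuous_intros)

section \<open>Digit words, their number, and spanning families of the square\<close>

locale skew_product =
  fixes \<beta> \<tau> :: real
  assumes beta: "1 < \<beta>" "\<beta> < 2" and tau: "0 < \<tau>" "\<tau> < 1 / 2"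
begin

abbreviation "f \<equiv> skew_map \<beta> \<tau>"
abbreviation "X \<equiv> attractor \<beta> \<tau>"
abbreviation "Q \<equiv> {0..1::real} \<times> {0..1::real}"

definition T :: "real \<Rightarrow> real" where
  "T x = (if x \<le> inverse \<beta> then \<beta> * x else \<beta> * x - 1)"

definition psi :: "bool \<Rightarrow> real \<Rightarrow> real" where
  "psi b y = \<tau> * y + (if b then 1 - \<tau> else 0)"

primrec word :: "nat \<Rightarrow> real \<Rightarrow> bool list" where
  "word 0 x = []"
| "word (Suc n) x = (inverse \<beta> < x) # word n (T x)"

lemma f_eq: "f (x, y) = (T x, psi (inverse \<beta> < x) y)"
  by (auto simp: skew_map_def T_def psi_def)

lemma inverse_beta: "0 < inverse \<beta>" "inverse \<beta> < 1"
  using beta by (auto simp: field_simps)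

lemma T_bounds: "0 \<le> x \<Longrightarrow> x \<le> 1 \<Longrightarrow> 0 \<le> T x \<and> T x \<le> 1"
proof -
  assume x: "0 \<le> x" "x \<le> 1"
  have le: "\<beta> * x \<le> \<beta>" using x beta by (simp add: mult_left_le)
  show ?thesis
  proof (cases "x \<le> inverse \<beta>")
    case True
    then show ?thesis using x beta by (simp add: T_def field_simps)
  next
    case False
    then have "1 < \<beta> * x" using beta by (simp add: field_simps)
    then have "0 \<le> \<beta> * x - 1" "\<beta> * x - 1 \<le> 1" using le beta by linarith+
    then show ?thesis using False by (simp only: T_def if_False)
  qed
qed

lemma psi_bounds: "0 \<le> y \<Longrightarrow> y \<le> 1 \<Longrightarrow> 0 \<le> psi b y \<and> psi b y \<le> 1"
proof -
  assume y: "0 \<le> y" "y \<le> 1"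
  have "\<tau> * y \<le> \<tau>" "0 \<le> \<tau> * y" using y tau by (auto simp: mult_left_le)
  then have "0 \<le> \<tau> * y + 0" "\<tau> * y + 0 \<le> 1" "0 \<le> \<tau> * y + (1 - \<tau>)" "\<tau> * y + (1 - \<tau>) \<le> 1"
    using tau by linarith+
  then show ?thesis unfolding psi_def by (cases b) (simp_all only: if_True if_False)
qed

lemma f_Q: "p \<in> Q \<Longrightarrow> f p \<in> Q"
  using T_bounds psi_bounds by (cases p) (auto simp: f_eq)

lemma funpow_Q: "p \<in> Q \<Longrightarrow> (f ^^ n) p \<in> Q"
proof (induction n)
  case (Suc n)
  then show ?case using f_Q by (simp only: funpow.simps o_apply)
qed simp

lemma finite_word: "finite (word n ` A)"
proof (rule finite_subset)
  have "length (word n x) = n" for x by (induction n arbitrary: x) auto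
  then show "word n ` A \<subseteq> {xs. set xs \<subseteq> UNIV \<and> length xs = n}" by auto
qed (rule finite_lists_length_eq, simp)

text \<open>The branch of digit 0 is full, so only one branch per level carries a proper interval
  \<open>{0..c}\<close>; tracking \<open>c\<close> keeps the overcounting polynomial.\<close>

lemma card_word:
  "0 \<le> c \<Longrightarrow> c \<le> 1 \<Longrightarrow> real (card (word n ` {0..c})) \<le> 1 + real n * \<beta> ^ n * c"
proof (induction n arbitrary: c)
  case 0
  have "word 0 ` {0..c} \<subseteq> {[]}" by auto
  then have "card (word 0 ` {0..c}) \<le> card {[] :: bool list}" by (intro card_mono) auto
  then show ?case by simp
next
  case (Suc n)
  have img: "card (Cons b ` word n ` A) \<le> card (word n ` A)" for b A
    by (intro card_image_le finite_word)
  have bn: "1 \<le> \<beta> ^ n" using beta by (intro one_le_power) simp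
  show ?case
  proof (cases "c \<le> inverse \<beta>")
    case True
    have bc: "0 \<le> \<beta> * c" "\<beta> * c \<le> 1" using True Suc.prems beta by (auto simp: field_simps)
    have "word (Suc n) ` {0..c} \<subseteq> Cons False ` word n ` {0..\<beta> * c}"
      using True beta by (auto simp: T_def image_image intro!: imageI)
    then have "card (word (Suc n) ` {0..c}) \<le> card (Cons False ` word n ` {0..\<beta> * c})"
      by (intro card_mono finite_imageI finite_word)
    also note img
    finally have "real (card (word (Suc n) ` {0..c})) \<le> 1 + real n * \<beta> ^ n * (\<beta> * c)"
      using Suc.IH[OF bc] by linarith
    also have "\<dots> \<le> 1 + real (Suc n) * \<beta> ^ Suc n * c"
      using Suc.prems beta by (simp add: algebra_simps)
    finally show ?thesis .
  next
    case False
    have bc: "0 \<le> \<beta> * c - 1" "\<beta> * c - 1 \<le> 1"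
    proof -
      have "\<beta> * c \<le> \<beta>" using Suc.prems beta by (simp add: mult_left_le)
      then show "\<beta> * c - 1 \<le> 1" using beta by linarith
      show "0 \<le> \<beta> * c - 1" using False beta by (simp add: field_simps)
    qed
    have sub: "word (Suc n) ` {0..c} \<subseteq> Cons False ` word n ` {0..1} \<union> Cons True ` word n ` {0..\<beta> * c - 1}"
    proof (rule image_subsetI)
      fix x assume x: "x \<in> {0..c}"
      show "word (Suc n) x \<in> Cons False ` word n ` {0..1} \<union> Cons True ` word n ` {0..\<beta> * c - 1}"
      proof (cases "x \<le> inverse \<beta>")
        case True
        then have "T x \<in> {0..1}" using T_bounds[of x] x Suc.prems by auto
        then show ?thesis using True by auto
      next
        case False
        then have "T x \<in> {0..\<beta> * c - 1}" using x beta by (auto simp: T_def field_simps)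
        then show ?thesis using False by auto
      qed
    qed
    have "card (word (Suc n) ` {0..c}) \<le>
        card (Cons False ` word n ` {0..1} \<union> Cons True ` word n ` {0..\<beta> * c - 1})"
      by (intro card_mono[OF _ sub] finite_UnI finite_imageI finite_word)
    also have "\<dots> \<le> card (Cons False ` word n ` {0..1}) + card (Cons True ` word n ` {0..\<beta> * c - 1})"
      by (rule card_Un_le)
    also have "\<dots> \<le> card (word n ` {0..1}) + card (word n ` {0..\<beta> * c - 1})"
      by (intro add_mono img)
    finally have "real (card (word (Suc n) ` {0..c})) \<le>
        (1 + real n * \<beta> ^ n * 1) + (1 + real n * \<beta> ^ n * (\<beta> * c - 1))"
      using Suc.IH[of 1] Suc.IH[OF bc] by linarith
    also have "\<dots> = 1 + real n * \<beta> ^ Suc n * c + 1" by (simp add: algebra_simps)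
    \<comment> \<open>The second 1 is absorbed by one more copy of
      \<open>\<beta> ^ Suc n * c\<close>, which is at least 1 because \<open>c\<close> exceeds
      \<open>inverse \<beta>\<close>.\<close>
    also have "\<dots> \<le> 1 + real (Suc n) * \<beta> ^ Suc n * c"
      using mult_mono[OF bn, of 1 "\<beta> * c"] bc beta by (simp add: algebra_simps)
    finally show ?thesis .
  qed
qed

lemma take_word: "i \<le> n \<Longrightarrow> take i (word n x) = word i x"
proof (induction n arbitrary: i x)
  case (Suc n)
  then show ?case by (cases i) auto
qed simp

text \<open>Both branches have the same slopes, horizontally and vertically. As long as the digits
  agree, differences are scaled without any dependence on the digits themselves.\<close>

lemma funpow_diff:
  "word n x = word n x' \<Longrightarrow>
    (f ^^ n) (x, y) - (f ^^ n) (x', y') = (\<beta> ^ n * (x - x'), \<tau> ^ n * (y - y'))"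
proof (induction n arbitrary: x x' y y')
  case (Suc n)
  then have eq: "(inverse \<beta> < x) = (inverse \<beta> < x')" "word n (T x) = word n (T x')" by simp_all
  have "(f ^^ Suc n) (x, y) - (f ^^ Suc n) (x', y') =
     (f ^^ n) (T x, psi (inverse \<beta> < x) y) - (f ^^ n) (T x', psi (inverse \<beta> < x') y')"
    by (simp only: funpow_Suc_right o_apply f_eq)
  also have "\<dots> = (\<beta> ^ n * (T x - T x'), \<tau> ^ n * (psi (inverse \<beta> < x) y - psi (inverse \<beta> < x') y'))"
    by (rule Suc.IH[OF eq(2)])
  also have "T x - T x' = \<beta> * (x - x')" using eq(1) by (auto simp: T_def algebra_simps)
  also have "psi (inverse \<beta> < x) y - psi (inverse \<beta> < x') y' = \<tau> * (y - y')"
    using eq(1) by (auto simp: psi_def algebra_simps)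
  finally show ?case by simp
qed simp

text \<open>Common digits let the horizontal difference grow by \<open>\<beta> ^ n\<close>, while
  the iterates stay in the unit square.\<close>

lemma word_eq_imp_close:
  assumes "word n x = word n x'" "x \<in> {0..1}" "x' \<in> {0..1}"
  shows "\<bar>x - x'\<bar> \<le> inverse \<beta> ^ n"
proof -
  have "(f ^^ n) (x, 0) \<in> Q" "(f ^^ n) (x', 0) \<in> Q" using assms by (auto intro!: funpow_Q)
  moreover have "fst ((f ^^ n) (x, 0)) - fst ((f ^^ n) (x', 0)) = \<beta> ^ n * (x - x')"
    using funpow_diff[OF assms(1), of 0 0] by (metis fst_conv fst_diff)
  ultimately have "\<bar>\<beta> ^ n * (x - x')\<bar> \<le> 1" by (auto simp: mem_Times_iff abs_le_iff)
  then have "\<beta> ^ n * \<bar>x - x'\<bar> \<le> 1" using beta by (simp add: abs_mult)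
  then show ?thesis using beta by (simp add: field_simps)
qed

text \<open>A piece fixes \<open>n + N\<close> digits and one height class of width
  \<open>1 / K\<close>. The \<open>N\<close> extra digits keep the expanding horizontal difference
  below \<open>inverse \<beta> ^ N\<close> up to time \<open>n\<close>; vertical differences
  contract, so one fixed resolution serves all times.\<close>

lemma spanning_growth_attractor:
  assumes "Y \<subseteq> Q"
  shows "spanning_growth Y f (ln \<beta>)"
  unfolding spanning_growth_def
proof (intro allI impI)
  fix \<delta> :: real assume \<delta>: "0 < \<delta>"
  obtain N where N: "inverse \<beta> ^ N < \<delta> / 2"
    using real_arch_pow_inv[of "\<delta> / 2" "inverse \<beta>"] \<delta> inverse_beta by auto
  obtain K :: nat where K: "0 < K" "inverse (real K) < \<delta> / 2"
    using reals_Archimedean[of "\<delta> / 2"] \<delta> by (metis half_gt_zero zero_less_Suc)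
  \<comment> \<open>The factor before \<open>real (K + 1)\<close> dominates the bound of
    \<open>card_word\<close> for \<open>n + N\<close> digits. There are \<open>K + 1\<close> height
    classes, the last one being reached at height 1 only.\<close>
  define g where "g n = real (Suc n) * (2 + real N) * \<beta> ^ (n + N) * real (K + 1)" for n
  have lng: "ln (g n) = ln (real (Suc n)) + (real n + real N) * ln \<beta> + (ln (2 + real N) + ln (real (K + 1)))" for n
    unfolding g_def using beta by (simp add: ln_mult ln_realpow)
  have lim: "(\<lambda>n. 1 / real n * ln (g n)) \<longlonglongrightarrow> ln \<beta>"
  proof -
    have "(\<lambda>n. ln (real n) / real n) \<longlonglongrightarrow> 0" by (rule lim_ln_over_n)
    then have "(\<lambda>n. ln (real (Suc n)) / real (Suc n)) \<longlonglongrightarrow> 0" by (rule LIMSEQ_Suc)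
    then have "(\<lambda>n. ln (real (Suc n)) / real (Suc n) * (real (Suc n) / real n) + ln \<beta> +
       (real N * ln \<beta> + (ln (2 + real N) + ln (real (K + 1)))) * (1 / real n)) \<longlonglongrightarrow>
       0 * 1 + ln \<beta> + (real N * ln \<beta> + (ln (2 + real N) + ln (real (K + 1)))) * 0"
      by (intro tendsto_add tendsto_mult LIMSEQ_Suc_n_over_n tendsto_const lim_1_over_n)
    then have *: "(\<lambda>n. ln (real (Suc n)) / real (Suc n) * (real (Suc n) / real n) + ln \<beta> +
       (real N * ln \<beta> + (ln (2 + real N) + ln (real (K + 1)))) * (1 / real n)) \<longlonglongrightarrow> ln \<beta>"
      by simp
    show ?thesis
    proof (rule Lim_transform_eventually[OF *], rule eventually_sequentiallyI[of 1])
      fix n :: nat assume "1 \<le> n"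
      then show "ln (real (Suc n)) / real (Suc n) * (real (Suc n) / real n) + ln \<beta> +
         (real N * ln \<beta> + (ln (2 + real N) + ln (real (K + 1)))) * (1 / real n) = 1 / real n * ln (g n)"
        unfolding lng by (simp add: field_simps del: of_nat_Suc)
    qed
  qed
  have "\<exists>\<W>. finite \<W> \<and> \<Union>\<W> = Y \<and> real (card \<W>) \<le> g n \<and>
       (\<forall>W\<in>\<W>. \<forall>p\<in>W. \<forall>q\<in>W. \<forall>i\<le>n. dist ((f ^^ i) p) ((f ^^ i) q) < \<delta>)" for n
  proof -
    define C where "C = (\<lambda>(w, j). {p \<in> Y. word (n + N) (fst p) = w \<and> nat \<lfloor>real K * snd p\<rfloor> = j})"
    define I where "I = word (n + N) ` {0..1} \<times> {0..K}"
    have finI: "finite I" unfolding I_def using finite_word by simp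
    have cover: "\<Union>(C ` I) = Y"
    proof
      show "\<Union>(C ` I) \<subseteq> Y" by (auto simp: C_def)
      show "Y \<subseteq> \<Union>(C ` I)"
      proof
        fix p assume p: "p \<in> Y"
        have "fst p \<in> {0..1}" "snd p \<in> {0..1}" using p assms by auto
        then have "real K * snd p \<le> real K * 1" by (intro mult_left_mono) auto
        then have "nat \<lfloor>real K * snd p\<rfloor> \<le> K" by linarith
        then have "(word (n + N) (fst p), nat \<lfloor>real K * snd p\<rfloor>) \<in> I"
          using \<open>fst p \<in> {0..1}\<close> by (simp add: I_def)
        moreover have "p \<in> C (word (n + N) (fst p), nat \<lfloor>real K * snd p\<rfloor>)" using p by (simp add: C_def)
        ultimately show "p \<in> \<Union>(C ` I)" by blast
      qed
    qed
    have "real (card (C ` I)) \<le> real (card I)" using finI by (intro of_nat_mono card_image_le)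
    also have "\<dots> = real (card (word (n + N) ` {0..1})) * real (K + 1)"
      unfolding I_def by (simp add: card_cartesian_product distrib_left)
    also have "\<dots> \<le> (1 + real (n + N) * \<beta> ^ (n + N) * 1) * real (K + 1)"
      by (intro mult_right_mono card_word) auto
    also have "\<dots> \<le> g n"
      unfolding g_def
    proof (rule mult_right_mono)
      have "1 + real (n + N) * \<beta> ^ (n + N) * 1 \<le> \<beta> ^ (n + N) + real (n + N) * \<beta> ^ (n + N)"
        using beta by (simp add: one_le_power)
      also have "\<dots> = (1 + real n + real N) * \<beta> ^ (n + N)" by (simp add: algebra_simps)
      also have "\<dots> \<le> (real (Suc n) * (2 + real N)) * \<beta> ^ (n + N)"
        using beta by (intro mult_right_mono) (auto simp: algebra_simps)
      finally show "1 + real (n + N) * \<beta> ^ (n + N) * 1 \<le> real (Suc n) * (2 + real N) * \<beta> ^ (n + N)" .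
    qed simp
    finally have card: "real (card (C ` I)) \<le> g n" .
    have small: "dist ((f ^^ i) p) ((f ^^ i) q) < \<delta>" if W: "W \<in> C ` I" "p \<in> W" "q \<in> W" and i: "i \<le> n" for W p q i
    proof -
      obtain x y x' y' where [simp]: "p = (x, y)" "q = (x', y')" by (metis surj_pair)
      have Q: "x \<in> {0..1}" "x' \<in> {0..1}" and y: "0 \<le> y" "0 \<le> y'"
        and pq: "word (n + N) x = word (n + N) x'"
        and fl: "nat \<lfloor>real K * y\<rfloor> = nat \<lfloor>real K * y'\<rfloor>"
        using W assms by (auto simp: C_def)
      have "0 \<le> real K * y" "0 \<le> real K * y'" using y by simp_all
      then have floor_eq: "\<lfloor>real K * y\<rfloor> = \<lfloor>real K * y'\<rfloor>" using fl by linarith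
      have wi: "word i x = word i x'" using pq take_word[of i "n + N"] i by (metis trans_le_add1)
      have "\<beta> ^ i * \<bar>x - x'\<bar> \<le> \<beta> ^ n * inverse \<beta> ^ (n + N)"
        using word_eq_imp_close[OF pq Q] i beta by (intro mult_mono power_increasing) auto
      also have "\<dots> = inverse \<beta> ^ N" using beta by (simp add: power_add field_simps)
      finally have 1: "\<bar>\<beta> ^ i * (x - x')\<bar> < \<delta> / 2" using N beta by (simp add: abs_mult)
      have "\<bar>real K * y - real K * y'\<bar> < 1" using floor_eq by linarith
      then have "real K * \<bar>y - y'\<bar> < 1" by (simp add: right_diff_distrib[symmetric] abs_mult)
      then have "\<bar>y - y'\<bar> < inverse (real K)" using K(1) by (simp add: field_simps)
      moreover have "\<tau> ^ i * \<bar>y - y'\<bar> \<le> 1 * \<bar>y - y'\<bar>"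
        using tau by (intro mult_right_mono power_le_one) auto
      ultimately have 2: "\<bar>\<tau> ^ i * (y - y')\<bar> < \<delta> / 2" using K(2) tau by (simp add: abs_mult)
      have "dist ((f ^^ i) p) ((f ^^ i) q) = norm (\<beta> ^ i * (x - x'), \<tau> ^ i * (y - y'))"
        by (simp add: dist_norm funpow_diff[OF wi])
      also have "\<dots> \<le> \<bar>\<beta> ^ i * (x - x')\<bar> + \<bar>\<tau> ^ i * (y - y')\<bar>"
        using norm_Pair_le[of "\<beta> ^ i * (x - x')" "\<tau> ^ i * (y - y')"] by simp
      finally show ?thesis using 1 2 by linarith
    qed
    show ?thesis
      by (intro exI[of _ "C ` I"] conjI ballI allI impI finite_imageI finI cover card)
         (rule small; assumption)
  qed
  then show "\<exists>g. (\<lambda>n. 1 / real n * ln (g n)) \<longlonglongrightarrow> ln \<beta> \<and>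
     (\<forall>n. \<exists>\<W>. finite \<W> \<and> \<Union>\<W> = Y \<and> real (card \<W>) \<le> g n \<and>
       (\<forall>W\<in>\<W>. \<forall>p\<in>W. \<forall>q\<in>W. \<forall>i\<le>n. dist ((f ^^ i) p) ((f ^^ i) q) < \<delta>))"
    using lim by blast
qed

section \<open>The attractor and its forward invariance\<close>

definition core :: "(real \<times> real) set" where
  "core = (\<Inter>i. (f ^^ i) ` Q)"

lemma X_eq: "X = closure core"
  unfolding attractor_def core_def ..

lemma core_Q: "core \<subseteq> Q"
  unfolding core_def by (rule INF_lower2[of 0]) auto

lemma core_X: "core \<subseteq> X" unfolding X_eq by (rule closure_subset)

lemma X_Q: "X \<subseteq> Q"
  unfolding X_eq by (rule closure_minimal[OF core_Q]) (intro closed_Times closed_atLeastAtMost)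

lemma closed_X: "closed X" unfolding X_eq by simp

lemma compact_X: "compact X"
  using compact_Int_closed[OF compact_Times[OF compact_Icc compact_Icc] closed_X, of 0 1 0 1] X_Q
  by (simp add: Int_absorb1)

lemma funpow_image_Suc: "(f ^^ Suc i) ` A = f ` (f ^^ i) ` A"
  by (simp add: image_comp)

lemma f_core: "f ` core \<subseteq> core"
proof
  fix p assume "p \<in> f ` core"
  then obtain q where q: "q \<in> core" "p = f q" by blast
  show "p \<in> core" unfolding core_def
  proof
    fix i show "p \<in> (f ^^ i) ` Q"
    proof (cases i)
      case 0
      then show ?thesis using q core_Q f_Q by auto
    next
      case (Suc j)
      have "q \<in> (f ^^ j) ` Q" using q(1) unfolding core_def by blast
      then show ?thesis using q(2) unfolding Suc funpow_image_Suc by blast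
    qed
  qed
qed

text \<open>Each digit of the past is admissible on an initial interval of \<open>{0<..1}\<close>, hence fibres shrink
  as the first coordinate grows.\<close>

lemma funpow_image_decreasing:
  "(x, y) \<in> (f ^^ i) ` Q \<Longrightarrow> 0 < x' \<Longrightarrow> x' \<le> x \<Longrightarrow> (x', y) \<in> (f ^^ i) ` Q"
proof (induction i arbitrary: x y x')
  case 0
  then show ?case by auto
next
  case (Suc i)
  obtain u v where uv: "(u, v) \<in> (f ^^ i) ` Q" "(x, y) = f (u, v)"
    using Suc.prems(1) unfolding funpow_image_Suc by auto
  define u' where "u' = (if inverse \<beta> < u then (x' + 1) / \<beta> else x' / \<beta>)"
  have x: "x = T u" "y = psi (inverse \<beta> < u) v" using uv(2) by (auto simp: f_eq)
  have u': "0 < u'" "u' \<le> u" "(inverse \<beta> < u') = (inverse \<beta> < u)" "T u' = x'"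
  proof -
    show "0 < u'" using Suc.prems(2) beta by (simp add: u'_def)
    show "u' \<le> u" using x(1) Suc.prems(3) beta by (auto simp: u'_def T_def field_simps split: if_splits)
    \<comment> \<open>The place where \<open>0 < x'\<close> is essential: the preimage of 0 along
      digit 1 would be \<open>inverse \<beta>\<close>, a point whose digit is 0.\<close>
    have *: "(x' + 1) / \<beta> > inverse \<beta>" using Suc.prems(2) beta by (simp add: field_simps)
    then show dig: "(inverse \<beta> < u') = (inverse \<beta> < u)"
      using \<open>u' \<le> u\<close> by (auto simp: u'_def)
    show "T u' = x'"
      using dig beta unfolding T_def by (auto simp: u'_def not_less split: if_splits)
  qed
  have "(u', v) \<in> (f ^^ i) ` Q" by (rule Suc.IH[OF uv(1) u'(1,2)])
  moreover have "(x', y) = f (u', v)" using u'(3,4) x by (simp add: f_eq)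
  ultimately show ?case unfolding funpow_image_Suc by blast
qed

lemma core_decreasing: "(x, y) \<in> core \<Longrightarrow> 0 < x' \<Longrightarrow> x' \<le> x \<Longrightarrow> (x', y) \<in> core"
  unfolding core_def using funpow_image_decreasing by blast

text \<open>A point of the attractor over \<open>inverse \<beta>\<close> may be a limit of points of
  \<open>core\<close> from the right, where the other branch acts. Since fibres of
  \<open>core\<close> grow to the left, such approximants can be pushed back onto abscissa
  \<open>inverse \<beta>\<close> without leaving \<open>core\<close>, and on that side the map is
  continuous.\<close>

lemma f_X: "f ` X \<subseteq> X"
proof
  fix p' assume "p' \<in> f ` X"
  then obtain x y where xy: "(x, y) \<in> X" "p' = f (x, y)" by auto
  obtain s where s: "\<And>n. s n \<in> core" "s \<longlonglongrightarrow> (x, y)"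
    using xy(1) unfolding X_eq closure_sequential by blast
  have lim: "(\<lambda>n. fst (s n)) \<longlonglongrightarrow> x" "(\<lambda>n. snd (s n)) \<longlonglongrightarrow> y"
    using tendsto_fst[OF s(2)] tendsto_snd[OF s(2)] by simp_all
  show "p' \<in> X"
  proof (cases "x \<le> inverse \<beta>")
    case True
    define r where "r n = (min (fst (s n)) (inverse \<beta>), snd (s n))" for n
    have "r n \<in> core" for n
    proof (cases "fst (s n) \<le> inverse \<beta>")
      case False
      then show ?thesis using core_decreasing[of "fst (s n)" "snd (s n)" "inverse \<beta>"] s(1) inverse_beta
        by (simp add: r_def min_def)
    qed (use s(1) in \<open>simp add: r_def\<close>)
    then have "f (r n) \<in> core" for n using f_core by blast
    moreover have "f (r n) = (\<beta> * min (fst (s n)) (inverse \<beta>), \<tau> * snd (s n))" for n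
      by (simp add: r_def f_eq T_def psi_def)
    ultimately have "(\<beta> * min (fst (s n)) (inverse \<beta>), \<tau> * snd (s n)) \<in> core" for n by metis
    moreover have "(\<lambda>n. (\<beta> * min (fst (s n)) (inverse \<beta>), \<tau> * snd (s n))) \<longlonglongrightarrow>
        (\<beta> * min x (inverse \<beta>), \<tau> * y)"
      by (intro tendsto_intros lim)
    ultimately have "(\<beta> * min x (inverse \<beta>), \<tau> * y) \<in> X"
      unfolding X_eq closure_sequential by (intro exI conjI allI) 
    moreover have "p' = (\<beta> * min x (inverse \<beta>), \<tau> * y)"
      using True xy(2) by (simp add: f_eq T_def psi_def)
    ultimately show ?thesis by simp
  next
    case False
    then have ev: "eventually (\<lambda>n. inverse \<beta> < fst (s n)) sequentially"
      using order_tendstoD(1)[OF lim(1), of "inverse \<beta>"] by simp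
    have "(\<lambda>n. (\<beta> * fst (s n) - 1, \<tau> * snd (s n) + (1 - \<tau>))) \<longlonglongrightarrow> (\<beta> * x - 1, \<tau> * y + (1 - \<tau>))"
      by (intro tendsto_intros lim)
    then have "(\<lambda>n. f (s n)) \<longlonglongrightarrow> (\<beta> * x - 1, \<tau> * y + (1 - \<tau>))"
    proof (rule Lim_transform_eventually)
      show "eventually (\<lambda>n. (\<beta> * fst (s n) - 1, \<tau> * snd (s n) + (1 - \<tau>)) = f (s n)) sequentially"
        using ev by eventually_elim (simp add: skew_map_def split_beta)
    qed
    moreover have "\<forall>n. f (s n) \<in> core" using s(1) f_core by blast
    ultimately have "(\<beta> * x - 1, \<tau> * y + (1 - \<tau>)) \<in> X"
      unfolding X_eq closure_sequential by (intro exI[of _ "\<lambda>n. f (s n)"] conjI)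
    moreover have "p' = (\<beta> * x - 1, \<tau> * y + (1 - \<tau>))" using False xy(2) by (simp add: skew_map_def)
    ultimately show ?thesis by simp
  qed
qed

text \<open>Backward orbits along digit 0 keep height 0 and divide the abscissa by \<beta>. The
  bottom edge thus belongs to the attractor, so a cover of the attractor covers a whole unit
  interval.\<close>

lemma base_core:
  assumes "x \<in> {0..1}"
  shows "(x, 0) \<in> core"
  unfolding core_def
proof
  fix i show "(x, 0) \<in> (f ^^ i) ` Q"
    using assms
  proof (induction i arbitrary: x)
    case (Suc i)
    have "x / \<beta> \<in> {0..1}" using Suc.prems beta by (auto simp: field_simps)
    then have "(x / \<beta>, 0) \<in> (f ^^ i) ` Q" by (rule Suc.IH)
    moreover have "(x, 0) = f (x / \<beta>, 0)" using Suc.prems beta by (simp add: f_eq T_def psi_def field_simps)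
    ultimately show ?case unfolding funpow_image_Suc by blast
  qed auto
qed

lemma base_X: "x \<in> {0..1} \<Longrightarrow> (x, 0) \<in> X"
  using base_core core_X by blast

section \<open>The two strips and the lower bound for topological entropy\<close>

text \<open>The digit is read from the height of the image and not from the abscissa: the condition
  \<open>fst p \<le> inverse \<beta>\<close> is not an open one, whereas the two strips are
  relatively open and also form a partition.\<close>

definition strips :: "(real \<times> real) set set" where
  "strips = {X \<inter> {p. snd p < 1/2}, X \<inter> {p. 1/2 < snd p}}"

text \<open>After one step heights are at most \<tau> or at least \<open>1 - \<tau>\<close>. This is
  a closed condition, so it survives the closure, and it leaves a gap around 1/2.\<close>

lemma X_strips: "p \<in> X \<Longrightarrow> snd p \<noteq> 1/2"
proof -
  have "core \<subseteq> f ` Q" unfolding core_def by (rule INF_lower2[of 1]) auto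
  also have "\<dots> \<subseteq> {p. snd p \<le> \<tau>} \<union> {p. 1 - \<tau> \<le> snd p}"
    using tau by (auto simp: f_eq psi_def mult_left_le)
  finally have "core \<subseteq> {p. snd p \<le> \<tau>} \<union> {p. 1 - \<tau> \<le> snd p}" .
  then have "X \<subseteq> {p. snd p \<le> \<tau>} \<union> {p. 1 - \<tau> \<le> snd p}"
    unfolding X_eq
    by (rule closure_minimal) (intro closed_Un closed_Collect_le continuous_intros)
  then show "p \<in> X \<Longrightarrow> snd p \<noteq> 1/2" using tau by auto
qed

lemma strips_Union: "\<Union>strips = X"
  using X_strips unfolding strips_def by force

lemma strips_open_covering: "open_covering X strips"
  unfolding open_covering_def
proof
  show "\<forall>A\<in>strips. openin (top_of_set X) A"
    unfolding strips_def by (auto intro!: openin_open_Int open_Collect_less continuous_intros)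
qed (rule strips_Union)

lemma strips_partition: "partition_on X strips"
proof (rule partition_onI)
  show "\<Union>strips = X" by (rule strips_Union)
  show "\<And>p q. p \<in> strips \<Longrightarrow> q \<in> strips \<Longrightarrow> p \<noteq> q \<Longrightarrow> disjnt p q"
    by (auto simp: strips_def disjnt_def)
  \<comment> \<open>Witnesses that neither strip is empty: the corner \<open>(0, 0)\<close> below,
    the image of \<open>(1, 0)\<close> above.\<close>
  have "(0, 0) \<in> X" "(1, 0) \<in> X" by (auto intro: base_X)
  moreover have "f (1, 0) \<in> X" using f_X \<open>(1, 0) \<in> X\<close> by blast
  moreover have "f (1, 0) = (\<beta> - 1, 1 - \<tau>)" using inverse_beta by (simp add: f_eq T_def psi_def)
  ultimately show "{} \<notin> strips" using tau unfolding strips_def by force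
qed

text \<open>The strip visited at time \<open>Suc i\<close> reveals the digit at time
  \<open>i\<close>; hence the \<open>n + 1\<close> strips of a cell fix just \<open>n\<close>
  digits.\<close>

lemma strips_cell_word:
  assumes "\<And>i. i \<le> n \<Longrightarrow> a i \<in> strips" "p \<in> itin_cell X f n a" "q \<in> itin_cell X f n a"
  shows "word n (fst p) = word n (fst q)"
proof -
  have dig: "inverse \<beta> < fst u \<longleftrightarrow> 1/2 < snd (f u)" if "u \<in> X" for u
  proof -
    have "u \<in> Q" using that X_Q by blast
    then have "0 \<le> \<tau> * snd u" "\<tau> * snd u \<le> \<tau>" using tau by (auto simp: mult_left_le)
    moreover have "snd (f u) = \<tau> * snd u + (if inverse \<beta> < fst u then 1 - \<tau> else 0)"
      by (cases u) (simp add: f_eq psi_def)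
    ultimately show ?thesis using tau by (simp only: split: if_split) linarith
  qed
  have inX: "(f ^^ i) u \<in> X" if "u \<in> X" for i u
    using that f_X by (induction i) auto
  have "word m (fst u) = word m (fst v)"
    if "u \<in> X" "v \<in> X" "\<And>i. i < m \<Longrightarrow> (1/2 < snd ((f ^^ Suc i) u)) = (1/2 < snd ((f ^^ Suc i) v))" for m u v
    using that
  proof (induction m arbitrary: u v)
    case (Suc m)
    have fX: "f u \<in> X" "f v \<in> X" using Suc.prems(1,2) f_X by blast+
    have "word m (fst (f u)) = word m (fst (f v))"
    proof (rule Suc.IH[OF fX])
      fix i assume "i < m"
      then show "(1/2 < snd ((f ^^ Suc i) (f u))) = (1/2 < snd ((f ^^ Suc i) (f v)))"
        using Suc.prems(3)[of "Suc i"] by (simp only: funpow_Suc_right o_apply Suc_less_eq)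
    qed
    moreover have "(inverse \<beta> < fst u) = (inverse \<beta> < fst v)"
      using Suc.prems(3)[of 0] dig[OF Suc.prems(1)] dig[OF Suc.prems(2)] by simp
    ultimately show ?case by (cases u; cases v) (simp add: f_eq)
  qed simp
  moreover have "(1/2 < snd ((f ^^ Suc i) p)) = (1/2 < snd ((f ^^ Suc i) q))" if "i < n" for i
  proof -
    have "a (Suc i) \<in> strips" "(f ^^ Suc i) p \<in> a (Suc i)" "(f ^^ Suc i) q \<in> a (Suc i)"
      using assms that unfolding itin_cell_def by (auto simp del: funpow.simps)
    then show ?thesis unfolding strips_def by auto
  qed
  moreover have "p \<in> X" "q \<in> X" using assms by (auto simp: itin_cell_def)
  ultimately show ?thesis by blast
qed

lemma strips_join_width:
  assumes "D \<in> dyn_join X f strips n" "p \<in> D" "q \<in> D"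
  shows "\<bar>fst p - fst q\<bar> \<le> inverse \<beta> ^ n"
proof -
  have "strips \<subseteq> Pow X" by (auto simp: strips_def)
  then obtain a where a: "\<forall>i\<le>n. a i \<in> strips" "D = itin_cell X f n a"
    using assms(1) mem_dyn_join_iff by metis
  have "word n (fst p) = word n (fst q)" using strips_cell_word[of n a p q] a assms by simp
  moreover have "p \<in> Q" "q \<in> Q" using a(2) assms X_Q by (auto simp: itin_cell_def)
  ultimately show ?thesis by (intro word_eq_imp_close) auto
qed

text \<open>A length count on the bottom edge: every element of the join meets it in a set of width
  at most \<open>inverse \<beta> ^ n\<close>, and a subcover has to cover length 1.\<close>

lemma cover_entropy_strips: "ln \<beta> \<le> cover_entropy X f strips"
proof -
  have sub: "strips \<subseteq> Pow X" by (auto simp: strips_def)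
  have ne: "X \<noteq> {}" using base_X[of 0] by auto
  have fin: "finite strips" by (simp add: strips_def)
  note cov = sub f_X subset_refl fin strips_Union
  have ge: "real n * ln \<beta> - ln 2 \<le> cover_H X (dyn_join X f strips n)" for n
  proof -
    obtain V where V: "V \<subseteq> dyn_join X f strips n" "finite V" "\<Union>V = X"
        "card V = cover_number X (dyn_join X f strips n)"
      by (metis dyn_join_finite_subcover[OF cov] cover_number_attained)
    \<comment> \<open>An arbitrary reference point of \<open>D\<close>. As it need not be an
      endpoint, the interval around it extends to both sides, which is the origin of the harmless
      \<open>ln 2\<close>.\<close>
    define x0 where "x0 D = fst (SOME p. p \<in> D)" for D :: "(real \<times> real) set"
    let ?w = "inverse \<beta> ^ n"
    have w: "0 < ?w" using beta by simp
    have "{0..1} \<subseteq> (\<Union>D\<in>V. {x0 D - ?w..x0 D + ?w})"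
    proof
      fix x :: real assume "x \<in> {0..1}"
      then have "(x, 0) \<in> \<Union>V" using base_X V(3) by simp
      then obtain D where D: "D \<in> V" "(x, 0) \<in> D" by blast
      have "(SOME p. p \<in> D) \<in> D" using D(2) by (rule someI)
      then have "\<bar>x - x0 D\<bar> \<le> ?w"
        unfolding x0_def using strips_join_width[of D n "(x, 0)" "SOME p. p \<in> D"] D V(1) by auto
      then show "x \<in> (\<Union>D\<in>V. {x0 D - ?w..x0 D + ?w})" using D(1) by (auto simp: abs_le_iff intro!: bexI[of _ D])
    qed
    moreover have "(\<Union>D\<in>V. {x0 D - ?w..x0 D + ?w}) \<in> fmeasurable lborel"
      using V(2) fmeasurable_cbox[of "x0 D - ?w" "x0 D + ?w" for D]
      by (intro fmeasurable.finite_UN) (auto simp: cbox_interval)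
    ultimately have "measure lborel {0..1::real} \<le> measure lborel (\<Union>D\<in>V. {x0 D - ?w..x0 D + ?w})"
      by (intro measure_mono_fmeasurable) auto
    also have "\<dots> \<le> (\<Sum>D\<in>V. measure lborel {x0 D - ?w..x0 D + ?w})"
      using V(2) by (intro measure_UNION_le) auto
    also have "\<dots> = real (card V) * (2 * ?w)" using w by simp
    finally have 1: "1 \<le> real (card V) * (2 * ?w)" by simp
    then have "\<beta> ^ n / 2 \<le> real (card V)" using beta by (simp add: field_simps)
    then have "ln (\<beta> ^ n / 2) \<le> ln (real (card V))" using beta by (intro ln_mono) auto
    moreover have "ln (\<beta> ^ n / 2) = real n * ln \<beta> - ln 2" using beta by (simp add: ln_div ln_realpow)
    ultimately show ?thesis unfolding cover_H_def using V(4) by simp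
  qed
  have "(\<lambda>n. ln \<beta> - ln 2 * (1 / real n)) \<longlonglongrightarrow> ln \<beta> - ln 2 * 0"
    by (intro tendsto_intros lim_1_over_n)
  moreover have "\<exists>N. \<forall>n\<ge>N. ln \<beta> - ln 2 * (1 / real n) \<le> 1 / real n * cover_H X (dyn_join X f strips n)"
  proof (intro exI[of _ 1] allI impI)
    fix n :: nat assume "1 \<le> n"
    then show "ln \<beta> - ln 2 * (1 / real n) \<le> 1 / real n * cover_H X (dyn_join X f strips n)"
      using mult_left_mono[OF ge[of n], of "1 / real n"] by (simp add: right_diff_distrib)
  qed
  ultimately have "ln \<beta> - ln 2 * 0 \<le> cover_entropy X f strips"
    using LIMSEQ_le cover_entropy_tendsto[OF cov ne] by blast
  then show ?thesis by simp
qed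

lemma topological_entropy_X: "topological_entropy X f = ereal (ln \<beta>)"
proof (rule antisym)
  have ne: "X \<noteq> {}" using base_X[of 0] by auto
  show "topological_entropy X f \<le> ereal (ln \<beta>)"
    unfolding topological_entropy_def
    using cover_entropy_le[OF compact_X ne f_X spanning_growth_attractor[OF X_Q]]
    by (intro SUP_least) auto
  have "ereal (ln \<beta>) \<le> ereal (cover_entropy X f strips)" using cover_entropy_strips by simp
  also have "\<dots> \<le> topological_entropy X f"
    unfolding topological_entropy_def using strips_open_covering by (intro SUP_upper) auto
  finally show "ereal (ln \<beta>) \<le> topological_entropy X f" .
qed

section \<open>The tower over the returns to the full interval\<close>

text \<open>\<open>{lev n<..1}\<close> is the set of points sharing the first \<open>n\<close> digits \<open>dig 0, \<dots>, dig (n - 1)\<close> of 1. Points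
  of \<open>{lev n<..lev (Suc n)}\<close>, an interval of length \<open>wt n\<close>, return to the full interval after
  \<open>Suc n\<close> steps, and \<open>ret n\<close> is the action of this return on the second coordinate. The deviating
  digit is 0, so there is no return from level \<open>n\<close> if \<open>dig n\<close> fails.\<close>

definition orb :: "nat \<Rightarrow> real" where "orb n = (T ^^ n) 1"
definition dig :: "nat \<Rightarrow> bool" where "dig n \<longleftrightarrow> inverse \<beta> < orb n"
definition lev :: "nat \<Rightarrow> real" where "lev n = 1 - orb n * inverse \<beta> ^ n"
definition wt :: "nat \<Rightarrow> real" where "wt n = (if dig n then inverse \<beta> ^ Suc n else 0)"

primrec off :: "nat \<Rightarrow> real" where
  "off 0 = 0"
| "off (Suc n) = psi (dig n) (off n)"

definition ret :: "nat \<Rightarrow> real \<Rightarrow> real" where "ret n y = psi False (\<tau> ^ n * y + off n)"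

lemma orb_Suc: "orb (Suc n) = \<beta> * orb n - (if dig n then 1 else 0)"
  by (simp add: orb_def dig_def T_def)

text \<open>Positivity rests on the convention that \<open>inverse \<beta>\<close> has digit 0: it
  is sent to 1, not to 0.\<close>

lemma orb_bounds: "0 < orb n \<and> orb n \<le> 1"
proof (induction n)
  case (Suc n)
  have "T (orb n) \<le> 1" using T_bounds[of "orb n"] Suc by simp
  moreover have "0 < T (orb n)"
    using Suc beta by (auto simp: T_def field_simps)
  ultimately show ?case by (simp add: orb_def)
qed (simp add: orb_def)

lemma beta_inverse_power: "\<beta> ^ n * inverse \<beta> ^ n = 1" "inverse \<beta> ^ n * \<beta> ^ n = 1"
  using beta by (simp_all add: field_simps)

lemma lev_0: "lev 0 = 0" by (simp add: lev_def orb_def)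

lemma lev_Suc: "lev (Suc n) = lev n + wt n"
  using beta by (simp add: lev_def orb_Suc wt_def field_simps)

lemma wt_nonneg: "0 \<le> wt n" using beta by (simp add: wt_def)

lemma lev_mono: "m \<le> n \<Longrightarrow> lev m \<le> lev n"
  by (rule lift_Suc_mono_le[of lev]) (simp_all add: lev_Suc wt_nonneg)

lemma lev_bounds: "0 \<le> lev n \<and> lev n < 1"
proof
  show "0 \<le> lev n" using lev_mono[of 0 n] lev_0 by simp
  show "lev n < 1" using orb_bounds[of n] beta by (simp add: lev_def)
qed

lemma one_minus_lev: "1 - lev n \<le> inverse \<beta> ^ n"
  using orb_bounds[of n] beta by (simp add: lev_def mult_left_le_one_le)

lemma lev_tendsto: "lev \<longlonglongrightarrow> 1"
proof -
  have "(\<lambda>n. inverse \<beta> ^ n) \<longlonglongrightarrow> 0" using inverse_beta by (intro LIMSEQ_realpow_zero) auto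
  then have "(\<lambda>n. 1 - inverse \<beta> ^ n) \<longlonglongrightarrow> 1 - 0" by (rule tendsto_diff[OF tendsto_const])
  moreover have "(\<lambda>n. 1) \<longlonglongrightarrow> (1 :: real)" by simp
  ultimately show ?thesis
    using one_minus_lev lev_bounds
    by (intro tendsto_sandwich[of "\<lambda>n. 1 - inverse \<beta> ^ n" lev _ "\<lambda>_. 1"])
       (auto intro!: always_eventually simp: algebra_simps less_imp_le)
qed

lemma wt_sums: "wt sums 1"
proof -
  have "(\<Sum>i<n. wt i) = lev n" for n by (induction n) (simp_all add: lev_0 lev_Suc)
  then show ?thesis unfolding sums_def using lev_tendsto by simp
qed

lemma off_bounds: "0 \<le> off n \<and> off n + \<tau> ^ n \<le> 1"
proof (induction n)
  case (Suc n)
  have "psi (dig n) (off n) + \<tau> ^ Suc n = psi (dig n) (off n + \<tau> ^ n)"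
    by (simp add: psi_def algebra_simps)
  moreover have "0 \<le> \<tau> ^ n" using tau by simp
  ultimately show ?case
    using psi_bounds[of "off n" "dig n"] psi_bounds[of "off n + \<tau> ^ n" "dig n"] Suc by simp
qed simp

lemma ret_bounds:
  assumes "0 \<le> y" "y \<le> 1" shows "0 \<le> ret n y" "ret n y \<le> 1"
proof -
  have "0 \<le> \<tau> ^ n * y" "\<tau> ^ n * y \<le> \<tau> ^ n" using assms tau by (auto simp: mult_left_le)
  then show "0 \<le> ret n y" "ret n y \<le> 1"
    unfolding ret_def using psi_bounds[of "\<tau> ^ n * y + off n" False] off_bounds[of n] by auto
qed

text \<open>If \<open>dig n\<close> holds, \<open>lev (Suc n)\<close> is exactly the abscissa sent
  to \<open>inverse \<beta>\<close> at time \<open>n\<close>, so larger points share the digit 1. If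
  it fails, the iterate lies to the left of \<open>orb n\<close> or at it, so its digit is 0 as
  well. The number \<open>off n\<close> is the height reached from height 0.\<close>

lemma funpow_above_lev:
  "lev n < x \<Longrightarrow> x \<le> 1 \<Longrightarrow> (f ^^ n) (x, y) = (\<beta> ^ n * (x - lev n), \<tau> ^ n * y + off n)"
proof (induction n)
  case 0
  then show ?case by (simp add: lev_0)
next
  case (Suc n)
  have x: "lev n < x" using Suc.prems(1) wt_nonneg[of n] by (simp add: lev_Suc)
  have dig: "inverse \<beta> < \<beta> ^ n * (x - lev n) \<longleftrightarrow> dig n"
  proof (cases "dig n")
    case True
    then have "inverse \<beta> ^ Suc n < x - lev n" using Suc.prems(1) by (simp add: lev_Suc wt_def)
    then have "\<beta> ^ n * inverse \<beta> ^ Suc n < \<beta> ^ n * (x - lev n)"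
      using beta by (intro mult_strict_left_mono) auto
    then show ?thesis using True beta_inverse_power[of n] beta by (simp add: field_simps)
  next
    case False
    have "\<beta> ^ n * (x - lev n) \<le> \<beta> ^ n * (1 - lev n)"
      using Suc.prems(2) beta by (intro mult_left_mono) auto
    also have "\<dots> = orb n" using beta_inverse_power[of n] by (simp add: lev_def)
    finally show ?thesis using False by (simp add: dig_def)
  qed
  have "\<beta> ^ Suc n * wt n = (if dig n then 1 else 0)"
    using beta_inverse_power[of "Suc n"] by (simp add: wt_def)
  then have "T (\<beta> ^ n * (x - lev n)) = \<beta> ^ Suc n * (x - lev (Suc n))"
    using dig by (auto simp: T_def lev_Suc algebra_simps not_less[symmetric])
  moreover have "psi (dig n) (\<tau> ^ n * y + off n) = \<tau> ^ Suc n * y + off (Suc n)"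
    by (simp add: psi_def algebra_simps)
  ultimately show ?case using Suc.IH[OF x Suc.prems(2)] dig by (simp add: f_eq)
qed

text \<open>To deviate from a digit 1 is to lie in \<open>{0<..inverse \<beta>}\<close> at time
  \<open>n\<close>, and digit 0 expands this interval onto all of \<open>{0<..1}\<close>. This is
  why every branch is full.\<close>

lemma funpow_return:
  assumes "lev n < x" "x \<le> lev (Suc n)"
  shows "(f ^^ Suc n) (x, y) = (\<beta> ^ Suc n * (x - lev n), ret n y)"
proof -
  have d: "dig n" using assms by (auto simp: lev_Suc wt_def split: if_splits)
  have x1: "x \<le> 1" using assms(2) lev_bounds[of "Suc n"] by simp
  have "\<beta> ^ n * (x - lev n) \<le> \<beta> ^ n * inverse \<beta> ^ Suc n"
    using assms(2) d beta by (intro mult_left_mono) (auto simp: lev_Suc wt_def)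
  also have "\<dots> = inverse \<beta>" using beta_inverse_power[of n] by (simp add: algebra_simps)
  finally have "\<beta> ^ n * (x - lev n) \<le> inverse \<beta>" .
  then show ?thesis
    using funpow_above_lev[OF assms(1) x1] by (simp add: f_eq T_def ret_def)
qed

lemma f_measurable[measurable]: "f \<in> borel_measurable borel"
  unfolding skew_map_def split_beta' by measurable

lemma funpow_f_measurable[measurable]: "(f ^^ n) \<in> borel_measurable borel"
proof (induction n)
  case (Suc n)
  then show ?case using measurable_comp[OF Suc f_measurable] by simp
qed (simp add: id_def)

lemma ret_measurable[measurable]: "ret n \<in> borel_measurable borel"
  unfolding ret_def[abs_def] psi_def by measurable

section \<open>The stationary law of the height\<close>

definition wt_pmf :: "nat pmf" where "wt_pmf = embed_pmf wt"

lemma pmf_wt_pmf: "pmf wt_pmf n = wt n"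
  unfolding wt_pmf_def
proof (rule pmf_embed_pmf)
  show "(\<integral>\<^sup>+ n. ennreal (wt n) \<partial>count_space UNIV) = 1"
    by (simp add: nn_integral_count_space_nat suminf_ennreal_eq[OF wt_nonneg wt_sums])
qed (rule wt_nonneg)

text \<open>Unrolling \<open>ret n y = \<tau> ^ Suc n * y + \<tau> * off n\<close> along a stream of
  blocks, the latest block first, gives these terms; \<open>past\<close> is the height produced by
  the whole infinite past.\<close>

primrec past_term :: "nat \<Rightarrow> nat stream \<Rightarrow> real" where
  "past_term 0 s = \<tau> * off (shd s)"
| "past_term (Suc k) s = \<tau> ^ Suc (shd s) * past_term k (stl s)"

definition past :: "nat stream \<Rightarrow> real" where "past s = (\<Sum>k. past_term k s)"

lemma past_term_bounds: "0 \<le> past_term k s \<and> past_term k s \<le> \<tau> ^ k"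
proof (induction k arbitrary: s)
  case 0
  have "0 \<le> \<tau> ^ shd s" using tau by simp
  then have "0 \<le> off (shd s)" "off (shd s) \<le> 1" using off_bounds[of "shd s"] by linarith+
  then have "0 \<le> \<tau> * off (shd s)" "\<tau> * off (shd s) \<le> 1"
    using tau mult_mono[of \<tau> 1 "off (shd s)" 1] by auto
  then show ?case by simp
next
  case (Suc k)
  have "\<tau> ^ Suc (shd s) \<le> \<tau>" using tau by (simp add: mult_left_le power_le_one)
  then have "\<tau> ^ Suc (shd s) * past_term k (stl s) \<le> \<tau> * \<tau> ^ k"
    using Suc[of "stl s"] tau by (intro mult_mono) auto
  then show ?case using Suc[of "stl s"] tau by simp
qed

lemma summable_past_term: "summable (\<lambda>k. past_term k s)"
proof (rule summable_comparison_test)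
  show "\<exists>N. \<forall>k\<ge>N. norm (past_term k s) \<le> \<tau> ^ k" using past_term_bounds by auto
  show "summable (\<lambda>k. \<tau> ^ k)" using tau by (intro summable_geometric) auto
qed

lemma past_Cons: "past (n ## s) = ret n (past s)"
proof -
  have "past (n ## s) = past_term 0 (n ## s) + (\<Sum>k. past_term (Suc k) (n ## s))"
    unfolding past_def using suminf_split_head[OF summable_past_term[of "n ## s"]] by simp
  also have "(\<Sum>k. past_term (Suc k) (n ## s)) = \<tau> ^ Suc n * past s"
    unfolding past_def using suminf_mult[OF summable_past_term[of s], of "\<tau> ^ Suc n"] by simp
  finally show ?thesis by (simp add: ret_def psi_def algebra_simps)
qed

lemma past_bounds: "past s \<in> {0..1}"
proof -
  have "(\<Sum>k<n. past_term k s) \<le> 1" for n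
  proof (induction n arbitrary: s)
    case (Suc n)
    have "(\<Sum>k<Suc n. past_term k s) = \<tau> * off (shd s) + \<tau> ^ Suc (shd s) * (\<Sum>k<n. past_term k (stl s))"
      by (subst sum.lessThan_Suc_shift) (simp add: sum_distrib_left)
    also have "\<dots> \<le> \<tau> * off (shd s) + \<tau> ^ Suc (shd s) * 1"
      using Suc tau by (intro add_left_mono mult_left_mono) auto
    also have "\<dots> = ret (shd s) 1" by (simp add: ret_def psi_def algebra_simps)
    also have "\<dots> \<le> 1" by (rule ret_bounds) auto
    finally show ?case .
  qed simp
  then have "past s \<le> 1" unfolding past_def by (intro suminf_le_const summable_past_term)
  moreover have "0 \<le> past s" unfolding past_def using past_term_bounds by (intro suminf_nonneg summable_past_term) auto
  ultimately show ?thesis by simp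
qed

lemma past_measurable[measurable]: "past \<in> borel_measurable (stream_space (count_space UNIV))"
proof -
  have "past_term k \<in> borel_measurable (stream_space (count_space UNIV))" for k
  proof (induction k)
    case 0
    have "(\<lambda>n. \<tau> * off n) \<in> measurable (count_space UNIV) borel" by simp
    from measurable_compose[OF measurable_shd this] show ?case by simp
  next
    case (Suc k)
    have "(\<lambda>n. \<tau> ^ Suc n) \<in> measurable (count_space UNIV) borel" by simp
    from measurable_compose[OF measurable_shd this]
    have "(\<lambda>s. \<tau> ^ Suc (shd s)) \<in> borel_measurable (stream_space (count_space UNIV))" .
    moreover have "(\<lambda>s. past_term k (stl s)) \<in> borel_measurable (stream_space (count_space UNIV))"
      by (rule measurable_compose[OF measurable_stl Suc])
    ultimately show ?case unfolding past_term.simps by (rule borel_measurable_times)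
  qed
  then show ?thesis unfolding past_def[abs_def] by (intro borel_measurable_suminf)
qed

lemma sets_stream_wt: "sets (stream_space (measure_pmf wt_pmf)) = sets (stream_space (count_space UNIV))"
  by (rule sets_stream_space_cong) simp

lemma past_measurable_wt[measurable]: "past \<in> borel_measurable (stream_space (measure_pmf wt_pmf))"
  using past_measurable by (simp add: measurable_cong_sets[OF sets_stream_wt refl])

definition etaM :: "real measure" where
  "etaM = distr (stream_space (measure_pmf wt_pmf)) borel past"

lemma sets_etaM[measurable_cong, simp]: "sets etaM = sets borel" and space_etaM[simp]: "space etaM = UNIV"
  by (simp_all add: etaM_def)

lemma prob_space_etaM: "prob_space etaM"
  unfolding etaM_def
  by (intro prob_space.prob_space_distr prob_space.prob_space_stream_space measure_pmf.prob_space_axioms past_measurable_wt)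

sublocale etaM: prob_space etaM by (rule prob_space_etaM)

lemma AE_etaM: "AE y in etaM. y \<in> {0..1}"
  unfolding etaM_def by (subst AE_distr_iff) (auto simp: past_bounds[simplified])

text \<open>Stationarity for the random iteration of \<open>ret n\<close> with probabilities
  \<open>wt n\<close>: an independent block put in front of an i.i.d. stream leaves its law
  unchanged, and on heights it acts by \<open>ret\<close>.\<close>

lemma etaM_selfsimilar:
  assumes [measurable]: "g \<in> borel_measurable borel"
  shows "(\<integral>\<^sup>+y. g y \<partial>etaM) = (\<Sum>n. ennreal (wt n) * (\<integral>\<^sup>+y. g (ret n y) \<partial>etaM))"
proof -
  have "(\<integral>\<^sup>+y. g y \<partial>etaM) = (\<integral>\<^sup>+s. g (past s) \<partial>stream_space (measure_pmf wt_pmf))"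
    unfolding etaM_def by (subst nn_integral_distr) auto
  also have "\<dots> = (\<integral>\<^sup>+n. (\<integral>\<^sup>+s. g (past (n ## s)) \<partial>stream_space (measure_pmf wt_pmf)) \<partial>measure_pmf wt_pmf)"
    by (rule prob_space.nn_integral_stream_space[OF measure_pmf.prob_space_axioms]) measurable
  also have "\<dots> = (\<integral>\<^sup>+n. (\<integral>\<^sup>+y. g (ret n y) \<partial>etaM) \<partial>measure_pmf wt_pmf)"
    unfolding past_Cons etaM_def by (subst nn_integral_distr) auto
  also have "\<dots> = (\<Sum>n. ennreal (wt n) * (\<integral>\<^sup>+y. g (ret n y) \<partial>etaM))"
    by (simp add: nn_integral_measure_pmf pmf_wt_pmf nn_integral_count_space_nat)
  finally show ?thesis .
qed

section \<open>The product measure and its invariance under the return map\<close>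

definition unitM :: "real measure" where "unitM = density lborel (indicator {0<..1})"

lemma sets_unitM[measurable_cong, simp]: "sets unitM = sets borel" and space_unitM[simp]: "space unitM = UNIV"
  by (simp_all add: unitM_def)

definition rho :: "(real \<times> real) measure" where "rho = unitM \<Otimes>\<^sub>M etaM"

lemma sets_rho[measurable_cong, simp]: "sets rho = sets borel" and space_rho[simp]: "space rho = UNIV"
proof -
  show "sets rho = sets borel"
    unfolding rho_def borel_prod[symmetric] by (rule sets_pair_measure_cong) auto
  then show "space rho = UNIV" using sets_eq_imp_space_eq by fastforce
qed

lemma nn_integral_unitM:
  "g \<in> borel_measurable borel \<Longrightarrow> (\<integral>\<^sup>+x. g x \<partial>unitM) = (\<integral>\<^sup>+x. indicator {0<..1} x * g x \<partial>lborel)"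
  unfolding unitM_def by (subst nn_integral_density) auto

lemma measurable_etaM_fst[measurable]:
  fixes g :: "real \<times> real \<Rightarrow> ennreal"
  assumes [measurable]: "g \<in> borel_measurable borel"
  shows "(\<lambda>x. \<integral>\<^sup>+y. g (x, y) \<partial>etaM) \<in> borel_measurable borel"
proof -
  have "g \<in> borel_measurable (borel \<Otimes>\<^sub>M etaM)"
    using assms unfolding measurable_cong_sets[OF sets_pair_measure_cong[OF refl sets_etaM] refl] borel_prod .
  then show ?thesis by (rule etaM.borel_measurable_nn_integral_fst)
qed

lemma nn_integral_rho:
  assumes [measurable]: "g \<in> borel_measurable borel"
  shows "(\<integral>\<^sup>+q. g q \<partial>rho) = (\<integral>\<^sup>+x. indicator {0<..1} x * (\<integral>\<^sup>+y. g (x, y) \<partial>etaM) \<partial>lborel)"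
proof -
  have "(\<integral>\<^sup>+q. g q \<partial>rho) = (\<integral>\<^sup>+x. (\<integral>\<^sup>+y. g (x, y) \<partial>etaM) \<partial>unitM)"
    unfolding rho_def
    by (rule etaM.nn_integral_fst[symmetric])
       (use assms in \<open>simp add: measurable_cong_sets[OF sets_pair_measure_cong[OF sets_unitM sets_etaM] refl] borel_prod\<close>)
  also have "\<dots> = (\<integral>\<^sup>+x. indicator {0<..1} x * (\<integral>\<^sup>+y. g (x, y) \<partial>etaM) \<partial>lborel)"
    by (rule nn_integral_unitM) measurable
  finally show ?thesis .
qed

lemma emeasure_rho_UNIV: "emeasure rho UNIV = 1"
proof -
  have "emeasure rho UNIV = (\<integral>\<^sup>+q. 1 \<partial>rho)" by simp
  also have "\<dots> = 1" by (subst nn_integral_rho) (simp_all add: etaM.emeasure_space_1[simplified])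
  finally show ?thesis .
qed

sublocale rho: prob_space rho
  by standard (simp add: emeasure_rho_UNIV)

lemma AE_rho_fst: "AE q in rho. fst q \<in> {0<..1}"
proof (rule AE_I)
  show "{q \<in> space rho. fst q \<notin> {0<..1}} \<subseteq> {q. fst q \<notin> {0<..1}}" by auto
  have "emeasure rho {q. fst q \<notin> {0<..1}} = (\<integral>\<^sup>+q. indicator {q. fst q \<notin> {0<..1}} q \<partial>rho)"
    by (rule nn_integral_indicator[symmetric]) simp
  also have "\<dots> = (\<integral>\<^sup>+q. indicator (- {0<..1}) (fst q) \<partial>rho)"
    by (intro nn_integral_cong) (simp add: indicator_def)
  also have "\<dots> = 0"
    by (subst nn_integral_rho) (auto simp: indicator_def nn_integral_0_iff_AE)
  finally show "emeasure rho {q. fst q \<notin> {0<..1}} = 0" .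
  show "{q. fst q \<notin> {0<..1}} \<in> sets rho" by simp
qed

lemma AE_rho_Q: "AE q in rho. q \<in> Q"
proof -
  have "AE q in rho. snd q \<in> {0..1}"
  proof (rule AE_I)
    show "{q \<in> space rho. snd q \<notin> {0..1}} \<subseteq> {q. snd q \<notin> {0..1}}" by auto
    have "(\<integral>\<^sup>+y. indicator (- {0..1}) y \<partial>etaM) = 0"
      using AE_etaM by (subst nn_integral_0_iff_AE) (auto simp: indicator_def)
    then have "(\<integral>\<^sup>+q. indicator (- {0..1}) (snd q) \<partial>rho) = 0"
      by (subst nn_integral_rho) auto
    moreover have "emeasure rho {q. snd q \<notin> {0..1}} = (\<integral>\<^sup>+q. indicator {q. snd q \<notin> {0..1}} q \<partial>rho)"
      by (rule nn_integral_indicator[symmetric]) simp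
    moreover have "\<dots> = (\<integral>\<^sup>+q. indicator (- {0..1}) (snd q) \<partial>rho)"
      by (intro nn_integral_cong) (simp add: indicator_def)
    ultimately show "emeasure rho {q. snd q \<notin> {0..1}} = 0" by simp
    show "{q. snd q \<notin> {0..1}} \<in> sets rho" by simp
  qed
  then show ?thesis using AE_rho_fst by eventually_elim (auto simp: mem_Times_iff)
qed

text \<open>An affine change of variables: the branch stretches an interval of length
  \<open>wt n\<close> over \<open>{0<..1}\<close>. If \<open>dig n\<close> fails, the interval is
  empty and both sides vanish.\<close>

lemma nn_integral_rho_return:
  assumes [measurable]: "g \<in> borel_measurable borel"
  shows "(\<integral>\<^sup>+q. indicator {lev n<..lev (Suc n)} (fst q) * g ((f ^^ Suc n) q) \<partial>rho) =
    ennreal (wt n) * (\<integral>\<^sup>+x. indicator {0<..1} x * (\<integral>\<^sup>+y. g (x, ret n y) \<partial>etaM) \<partial>lborel)"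
proof (cases "dig n")
  case False
  then show ?thesis by (simp add: lev_Suc wt_def)
next
  case True
  let ?w = "inverse \<beta> ^ Suc n"
  have w: "wt n = ?w" "0 < ?w" "\<beta> ^ Suc n * ?w = 1" using True beta beta_inverse_power[of "Suc n"] by (auto simp: wt_def)
  define h where "h x = indicator {lev n<..lev (Suc n)} x * (\<integral>\<^sup>+y. g (\<beta> ^ Suc n * (x - lev n), ret n y) \<partial>etaM)" for x
  have [measurable]: "(\<lambda>q. g (\<beta> ^ Suc n * (fst q - lev n), ret n (snd q))) \<in> borel_measurable borel"
    by measurable
  have [measurable]: "h \<in> borel_measurable borel"
    unfolding h_def[abs_def]
    using measurable_etaM_fst[of "\<lambda>q. g (\<beta> ^ Suc n * (fst q - lev n), ret n (snd q))"] by simp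
  have "(\<integral>\<^sup>+q. indicator {lev n<..lev (Suc n)} (fst q) * g ((f ^^ Suc n) q) \<partial>rho) =
     (\<integral>\<^sup>+x. indicator {0<..1} x * (\<integral>\<^sup>+y. indicator {lev n<..lev (Suc n)} x * g ((f ^^ Suc n) (x, y)) \<partial>etaM) \<partial>lborel)"
    by (subst nn_integral_rho) (simp_all del: funpow.simps)
  also have "\<dots> = (\<integral>\<^sup>+x. h x \<partial>lborel)"
  proof (rule nn_integral_cong)
    fix x
    show "indicator {0<..1} x * (\<integral>\<^sup>+y. indicator {lev n<..lev (Suc n)} x * g ((f ^^ Suc n) (x, y)) \<partial>etaM) = h x"
    proof (cases "x \<in> {lev n<..lev (Suc n)}")
      case True
      then have "0 < x" "x \<le> 1" using lev_bounds[of n] lev_bounds[of "Suc n"] by auto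
      then show ?thesis using True funpow_return[of n x] by (simp add: h_def del: funpow.simps)
    qed (simp add: h_def)
  qed
  also have "\<dots> = ennreal \<bar>?w\<bar> * (\<integral>\<^sup>+x. h (lev n + ?w * x) \<partial>lborel)"
    using w by (intro nn_integral_real_affine) auto
  also have "(\<integral>\<^sup>+x. h (lev n + ?w * x) \<partial>lborel) = (\<integral>\<^sup>+x. indicator {0<..1} x * (\<integral>\<^sup>+y. g (x, ret n y) \<partial>etaM) \<partial>lborel)"
  proof (rule nn_integral_cong)
    fix x
    have "\<beta> ^ Suc n * (lev n + ?w * x - lev n) = x"
      using w(3) by (simp only: add_diff_cancel_left' mult.assoc[symmetric] mult_1)
    moreover have "lev n + v * x \<in> {lev n<..lev n + v} \<longleftrightarrow> x \<in> {0<..1}" if "0 < v" for v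
      using that by (simp add: zero_less_mult_iff)
    then have "lev n + ?w * x \<in> {lev n<..lev (Suc n)} \<longleftrightarrow> x \<in> {0<..1}"
      unfolding lev_Suc w(1) using w(2) by blast
    ultimately show "h (lev n + ?w * x) = indicator {0<..1} x * (\<integral>\<^sup>+y. g (x, ret n y) \<partial>etaM)"
      unfolding h_def by (simp only: indicator_def of_bool_def)
  qed
  finally show ?thesis using w(1,2) by simp
qed

text \<open>Each branch reproduces Lebesgue measure with weight \<open>wt n\<close> in the first
  coordinate; summing these weights over the heights \<open>ret n y\<close> restores
  \<open>etaM\<close>.\<close>

lemma rho_selfsimilar:
  assumes [measurable]: "g \<in> borel_measurable borel"
  shows "(\<Sum>n. \<integral>\<^sup>+q. indicator {lev n<..lev (Suc n)} (fst q) * g ((f ^^ Suc n) q) \<partial>rho) = (\<integral>\<^sup>+q. g q \<partial>rho)"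
proof -
  have meas[measurable]: "(\<lambda>x. \<integral>\<^sup>+y. g (x, ret n y) \<partial>etaM) \<in> borel_measurable borel" for n
    using measurable_etaM_fst[of "\<lambda>q. g (fst q, ret n (snd q))"] by simp
  have "(\<integral>\<^sup>+q. g q \<partial>rho) = (\<integral>\<^sup>+x. indicator {0<..1} x * (\<Sum>n. ennreal (wt n) * (\<integral>\<^sup>+y. g (x, ret n y) \<partial>etaM)) \<partial>lborel)"
    by (subst nn_integral_rho, measurable, subst etaM_selfsimilar) auto
  also have "\<dots> = (\<integral>\<^sup>+x. (\<Sum>n. ennreal (wt n) * (indicator {0<..1} x * (\<integral>\<^sup>+y. g (x, ret n y) \<partial>etaM))) \<partial>lborel)"
    by (subst ennreal_suminf_cmult[symmetric]) (simp only: mult.left_commute)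
  also have "\<dots> = (\<Sum>n. \<integral>\<^sup>+x. ennreal (wt n) * (indicator {0<..1} x * (\<integral>\<^sup>+y. g (x, ret n y) \<partial>etaM)) \<partial>lborel)"
    by (rule nn_integral_suminf) measurable
  also have "\<dots> = (\<Sum>n. ennreal (wt n) * (\<integral>\<^sup>+x. indicator {0<..1} x * (\<integral>\<^sup>+y. g (x, ret n y) \<partial>etaM) \<partial>lborel))"
    by (subst nn_integral_cmult) auto
  finally show ?thesis by (simp only: nn_integral_rho_return[OF assms])
qed

section \<open>The tower measure, its invariance and its first marginal\<close>

definition tower :: "(nat \<times> real \<times> real) measure" where
  "tower = density (count_space UNIV \<Otimes>\<^sub>M rho) (\<lambda>(n, q). indicator {lev n<..} (fst q))"

text \<open>The Kakutani skyscraper folded down into the plane: level \<open>n\<close> carries the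
  points whose return time exceeds \<open>n\<close>. The measure is left unnormalised; its total
  mass is the mean return time.\<close>

definition towerM :: "(real \<times> real) measure" where
  "towerM = distr tower borel (\<lambda>(n, q). (f ^^ n) q)"

lemma sets_towerM[measurable_cong, simp]: "sets towerM = sets borel" and space_towerM[simp]: "space towerM = UNIV"
  by (simp_all add: towerM_def)

lemma nn_integral_towerM:
  assumes [measurable]: "g \<in> borel_measurable borel"
  shows "(\<integral>\<^sup>+q. g q \<partial>towerM) = (\<Sum>n. \<integral>\<^sup>+q. indicator {lev n<..} (fst q) * g ((f ^^ n) q) \<partial>rho)"
proof -
  let ?C = "count_space (UNIV :: nat set)"
  have m0: "(\<lambda>(n, q). (f ^^ n) q) \<in> measurable (?C \<Otimes>\<^sub>M rho) borel"
    by (rule measurable_pair_measure_countable1) (auto simp: measurable_cong_sets[OF sets_rho refl])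
  then have m1: "(\<lambda>(n, q). (f ^^ n) q) \<in> measurable tower borel"
    by (simp add: tower_def)
  have m2: "(\<lambda>(n, q). indicator {lev n<..} (fst q) :: ennreal) \<in> borel_measurable (?C \<Otimes>\<^sub>M rho)"
    by (rule measurable_pair_measure_countable1) auto
  have m3: "(\<lambda>z. g (case z of (n, q) \<Rightarrow> (f ^^ n) q)) \<in> borel_measurable (?C \<Otimes>\<^sub>M rho)"
    by (rule measurable_compose[OF m0 assms])
  have m4: "(\<lambda>z. (case z of (n, q) \<Rightarrow> indicator {lev n<..} (fst q)) * g (case z of (n, q) \<Rightarrow> (f ^^ n) q))
      \<in> borel_measurable (?C \<Otimes>\<^sub>M rho)"
    by (rule borel_measurable_times_ennreal[OF m2 m3])
  have "(\<integral>\<^sup>+q. g q \<partial>towerM) = (\<integral>\<^sup>+z. g (case z of (n, q) \<Rightarrow> (f ^^ n) q) \<partial>tower)"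
    unfolding towerM_def by (rule nn_integral_distr[OF m1]) simp
  also have "\<dots> = (\<integral>\<^sup>+z. (case z of (n, q) \<Rightarrow> indicator {lev n<..} (fst q)) * g (case z of (n, q) \<Rightarrow> (f ^^ n) q) \<partial>(?C \<Otimes>\<^sub>M rho))"
    unfolding tower_def by (rule nn_integral_density[OF m2 m3])
  also have "\<dots> = (\<integral>\<^sup>+n. (\<integral>\<^sup>+q. indicator {lev n<..} (fst q) * g ((f ^^ n) q) \<partial>rho) \<partial>?C)"
    using rho.nn_integral_fst[OF m4] by simp
  also have "\<dots> = (\<Sum>n. \<integral>\<^sup>+q. indicator {lev n<..} (fst q) * g ((f ^^ n) q) \<partial>rho)"
    by (rule nn_integral_count_space_nat)
  finally show ?thesis .
qed

lemma emeasure_towerM: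
  assumes "A \<in> sets borel"
  shows "emeasure towerM A = (\<Sum>n. \<integral>\<^sup>+q. indicator {lev n<..} (fst q) * indicator A ((f ^^ n) q) \<partial>rho)"
  using nn_integral_towerM[of "indicator A"] assms by simp

lemma tower_level_0: "A \<in> sets borel \<Longrightarrow>
  (\<integral>\<^sup>+q. indicator {lev 0<..} (fst q) * indicator A ((f ^^ 0) q) \<partial>rho) = emeasure rho A"
proof -
  assume A: "A \<in> sets borel"
  have "(\<integral>\<^sup>+q. indicator {lev 0<..} (fst q) * indicator A ((f ^^ 0) q) \<partial>rho) = (\<integral>\<^sup>+q. indicator A q \<partial>rho)"
    by (rule nn_integral_cong_AE) (use AE_rho_fst in eventually_elim, simp add: lev_0 indicator_def)
  then show ?thesis using A by simp
qed

lemma rho_le_towerM: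
  assumes "A \<in> sets borel"
  shows "emeasure rho A \<le> emeasure towerM A"
  using sum_le_suminf[of "\<lambda>n. \<integral>\<^sup>+q. indicator {lev n<..} (fst q) * indicator A ((f ^^ n) q) \<partial>rho" "{0}"]
  unfolding emeasure_towerM[OF assms] tower_level_0[OF assms, symmetric] by simp

lemma fst_vimage_borel: "A \<in> sets borel \<Longrightarrow> fst -` A \<in> sets (borel :: (real \<times> real) measure)"
  by (rule measurable_sets_borel) simp_all

text \<open>One step lifts level \<open>n\<close> to level \<open>n + 1\<close>, except over
  \<open>{lev n<..lev (Suc n)}\<close>, where points fall back to the base. By
  \<open>rho_selfsimilar\<close> all these returns together rebuild level 0.\<close>

lemma tower_invariant:
  assumes A: "A \<in> sets borel"
  shows "emeasure towerM (f -` A) = emeasure towerM A"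
proof -
  define I where "I n = (\<integral>\<^sup>+q. indicator {lev n<..} (fst q) * indicator A ((f ^^ n) q) \<partial>rho)" for n
  define R where "R n = (\<integral>\<^sup>+q. indicator {lev n<..lev (Suc n)} (fst q) * indicator A ((f ^^ Suc n) q) \<partial>rho)" for n
  have [measurable]: "f -` A \<in> sets borel" using measurable_sets_borel[OF f_measurable A] .
  have [measurable]: "A \<in> sets borel" by (rule A)
  have "emeasure towerM (f -` A) = (\<Sum>n. \<integral>\<^sup>+q. indicator {lev n<..} (fst q) * indicator A ((f ^^ Suc n) q) \<partial>rho)"
    by (subst emeasure_towerM) (simp_all add: indicator_vimage)
  also have "\<dots> = (\<Sum>n. R n + I (Suc n))"
  proof (rule arg_cong[where f = suminf], rule ext)
    fix n
    have "(\<integral>\<^sup>+q. indicator {lev n<..} (fst q) * indicator A ((f ^^ Suc n) q) \<partial>rho) =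
      (\<integral>\<^sup>+q. indicator {lev n<..lev (Suc n)} (fst q) * indicator A ((f ^^ Suc n) q) +
           indicator {lev (Suc n)<..} (fst q) * indicator A ((f ^^ Suc n) q) \<partial>rho)"
      using lev_mono[of n "Suc n"] by (intro nn_integral_cong) (auto simp: indicator_def)
    also have "\<dots> = R n + I (Suc n)"
      unfolding R_def I_def by (rule nn_integral_add) measurable
    finally show "(\<integral>\<^sup>+q. indicator {lev n<..} (fst q) * indicator A ((f ^^ Suc n) q) \<partial>rho) = R n + I (Suc n)" .
  qed
  also have "\<dots> = (\<Sum>n. R n) + (\<Sum>n. I (Suc n))" by (rule suminf_add[symmetric]) auto
  also have "(\<Sum>n. R n) = I 0"
    unfolding R_def I_def using rho_selfsimilar[of "indicator A"] tower_level_0[OF A] A by simp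
  also have "I 0 + (\<Sum>n. I (Suc n)) = (\<Sum>n. I n)"
    using suminf_offset[of I 1] by (simp add: add.commute)
  also have "\<dots> = emeasure towerM A" unfolding I_def by (rule emeasure_towerM[OF A, symmetric])
  finally show ?thesis .
qed

lemma tower_invariant_funpow:
  assumes A: "A \<in> sets borel"
  shows "emeasure towerM ((f ^^ k) -` A) = emeasure towerM A"
proof (induction k)
  case (Suc k)
  have "(f ^^ Suc k) -` A = f -` ((f ^^ k) -` A)" by (auto simp: funpow_swap1)
  then show ?case by (simp only: tower_invariant[OF measurable_sets_borel[OF funpow_f_measurable A]] Suc)
qed simp

text \<open>On level \<open>n\<close> the abscissa has been stretched by \<open>\<beta> ^ n\<close>,
  so this level contributes density at most \<open>inverse \<beta> ^ n\<close>.\<close>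

lemma tower_marginal:
  assumes A: "A \<in> sets borel"
  shows "emeasure towerM (fst -` A) \<le> ennreal (\<beta> / (\<beta> - 1)) * emeasure lborel A"
proof -
  have [measurable]: "A \<in> sets borel" by (rule A)
  have fA[measurable]: "fst -` A \<in> sets (borel :: (real \<times> real) measure)"
    by (rule fst_vimage_borel[OF A])
  have le: "(\<integral>\<^sup>+q. indicator {lev n<..} (fst q) * indicator (fst -` A) ((f ^^ n) q) \<partial>rho) \<le>
      ennreal (inverse \<beta> ^ n) * emeasure lborel A" for n
  proof -
    let ?w = "inverse \<beta> ^ n"
    have w: "0 < ?w" "\<beta> ^ n * ?w = 1" using beta beta_inverse_power[of n] by auto
    have "(\<integral>\<^sup>+q. indicator {lev n<..} (fst q) * indicator (fst -` A) ((f ^^ n) q) \<partial>rho) =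
      (\<integral>\<^sup>+x. indicator {0<..1} x * (\<integral>\<^sup>+y. indicator {lev n<..} x * indicator (fst -` A) ((f ^^ n) (x, y)) \<partial>etaM) \<partial>lborel)"
      by (subst nn_integral_rho) simp_all
    also have "\<dots> \<le> (\<integral>\<^sup>+x. indicator A (\<beta> ^ n * (x - lev n)) \<partial>lborel)"
    proof (rule nn_integral_mono)
      fix x
      show "indicator {0<..1} x * (\<integral>\<^sup>+y. indicator {lev n<..} x * indicator (fst -` A) ((f ^^ n) (x, y)) \<partial>etaM)
          \<le> indicator A (\<beta> ^ n * (x - lev n))"
      proof (cases "lev n < x \<and> x \<le> 1")
        case True
        then have "(\<integral>\<^sup>+y. indicator {lev n<..} x * indicator (fst -` A) ((f ^^ n) (x, y)) \<partial>etaM) =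
          (\<integral>\<^sup>+y. indicator A (\<beta> ^ n * (x - lev n)) \<partial>etaM)"
          by (intro nn_integral_cong) (simp add: funpow_above_lev indicator_def)
        also have "\<dots> = indicator A (\<beta> ^ n * (x - lev n))"
          by (simp add: etaM.emeasure_space_1[simplified])
        finally show ?thesis by (auto simp: indicator_def)
      qed (auto simp: indicator_def)
    qed
    also have "\<dots> = ennreal \<bar>?w\<bar> * (\<integral>\<^sup>+x. indicator A (\<beta> ^ n * (lev n + ?w * x - lev n)) \<partial>lborel)"
    proof (rule nn_integral_real_affine)
      show "?w \<noteq> 0" using w(1) by linarith
    qed measurable
    also have "(\<lambda>x. \<beta> ^ n * (lev n + ?w * x - lev n)) = (\<lambda>x. x)"
      using w(2) by (simp only: add_diff_cancel_left' mult.assoc[symmetric] mult_1)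
    also have "(\<integral>\<^sup>+x. indicator A x \<partial>lborel) = emeasure lborel A" by simp
    finally show ?thesis using w(1) by simp
  qed
  have "emeasure towerM (fst -` A) \<le> (\<Sum>n. ennreal (inverse \<beta> ^ n) * emeasure lborel A)"
    unfolding emeasure_towerM[OF fA] by (intro suminf_le le) auto
  also have "\<dots> = (\<Sum>n. ennreal (inverse \<beta> ^ n)) * emeasure lborel A" by simp
  also have "(\<Sum>n. ennreal (inverse \<beta> ^ n)) = ennreal (\<beta> / (\<beta> - 1))"
  proof (rule suminf_ennreal_eq)
    show "0 \<le> inverse \<beta> ^ n" for n using beta by simp
    have "(\<lambda>n. inverse \<beta> ^ n) sums (1 / (1 - inverse \<beta>))"
      using inverse_beta by (intro geometric_sums) auto
    also have "1 / (1 - inverse \<beta>) = \<beta> / (\<beta> - 1)" using beta by (simp add: field_simps)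
    finally show "(\<lambda>n. inverse \<beta> ^ n) sums (\<beta> / (\<beta> - 1))" .
  qed
  finally show ?thesis .
qed

section \<open>Finiteness, support in the attractor, and normalisation\<close>

lemma Q_sets[measurable]: "Q \<in> sets (borel :: (real \<times> real) measure)"
  by (intro borel_closed closed_Times closed_atLeastAtMost)

lemma tower_outside_Q: "emeasure towerM (- Q) = 0"
proof -
  have "(\<integral>\<^sup>+q. indicator {lev n<..} (fst q) * indicator (- Q) ((f ^^ n) q) \<partial>rho) = (\<integral>\<^sup>+q. 0 \<partial>rho)" for n
    by (rule nn_integral_cong_AE) (use AE_rho_Q in eventually_elim, use funpow_Q in \<open>auto simp: indicator_def\<close>)
  then show ?thesis by (subst emeasure_towerM) auto
qed

lemma emeasure_towerM_UNIV: "1 \<le> emeasure towerM UNIV" "emeasure towerM UNIV < \<infinity>"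
proof -
  show "1 \<le> emeasure towerM UNIV" using rho_le_towerM[of UNIV] by (simp add: emeasure_rho_UNIV)
  have "fst -` {0..1::real} \<in> sets (borel :: (real \<times> real) measure)"
    by (rule fst_vimage_borel) simp
  then have "emeasure towerM UNIV \<le> emeasure towerM (- Q \<union> fst -` {0..1})"
    by (intro emeasure_mono) (auto simp: mem_Times_iff)
  also have "\<dots> \<le> emeasure towerM (- Q) + emeasure towerM (fst -` {0..1})"
    using \<open>fst -` {0..1::real} \<in> sets borel\<close> by (intro emeasure_subadditive) auto
  also have "\<dots> \<le> ennreal (\<beta> / (\<beta> - 1)) * emeasure lborel {0..1::real}"
    using tower_marginal[of "{0..1}"] by (simp add: tower_outside_Q)
  also have "\<dots> < \<infinity>" by (simp add: ennreal_mult_less_top)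
  finally show "emeasure towerM UNIV < \<infinity>" .
qed

text \<open>Borel maps need not have Borel images. Here the height tells the branches apart, so
  \<open>g\<close> is a Borel left inverse on the square, and the image consists of the
  \<open>p\<close> with \<open>g p \<in> A\<close> and \<open>f (g p) = p\<close>.\<close>

lemma f_image_borel:
  assumes A: "A \<subseteq> Q" "A \<in> sets borel"
  shows "f ` A \<in> sets borel"
proof -
  define g where "g p = (if snd p \<le> 1/2 then (fst p / \<beta>, snd p / \<tau>)
    else ((fst p + 1) / \<beta>, (snd p - (1 - \<tau>)) / \<tau>))" for p :: "real \<times> real"
  have gf: "g (f p) = p" if pQ: "p \<in> Q" for p
  proof (cases p)
    case (Pair x y)
    have y: "0 \<le> y" "y \<le> 1" using pQ Pair by auto
    then have "0 \<le> \<tau> * y" "\<tau> * y \<le> \<tau>" using tau by (auto simp: mult_left_le)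
    then have "\<tau> * y \<le> 1/2" "\<not> \<tau> * y + (1 - \<tau>) \<le> 1/2" using tau by linarith+
    then show ?thesis using Pair beta tau by (simp add: g_def skew_map_def)
  qed
  have [measurable]: "g \<in> borel_measurable borel" unfolding g_def[abs_def] by measurable
  have gA: "g -` A \<in> sets borel" by (rule measurable_sets_borel[OF _ A(2)]) simp
  have [measurable]: "(\<lambda>p. f (g p)) \<in> borel_measurable borel" by measurable
  have "{p \<in> space borel. fst (f (g p)) = fst p} \<inter> {p \<in> space borel. snd (f (g p)) = snd p} \<in> sets borel"
    by measurable
  then have "g -` A \<inter> ({p \<in> space borel. fst (f (g p)) = fst p} \<inter> {p \<in> space borel. snd (f (g p)) = snd p}) \<in> sets borel"
    using gA by (rule sets.Int[rotated])
  moreover have "f ` A = g -` A \<inter> ({p \<in> space borel. fst (f (g p)) = fst p} \<inter> {p \<in> space borel. snd (f (g p)) = snd p})"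
  proof
    show "f ` A \<subseteq> g -` A \<inter> ({p \<in> space borel. fst (f (g p)) = fst p} \<inter> {p \<in> space borel. snd (f (g p)) = snd p})"
      using gf A(1) by auto
    show "g -` A \<inter> ({p \<in> space borel. fst (f (g p)) = fst p} \<inter> {p \<in> space borel. snd (f (g p)) = snd p}) \<subseteq> f ` A"
    proof
      fix p assume p: "p \<in> g -` A \<inter> ({p \<in> space borel. fst (f (g p)) = fst p} \<inter> {p \<in> space borel. snd (f (g p)) = snd p})"
      then have "f (g p) = p" "g p \<in> A" by (auto simp: prod_eq_iff)
      then show "p \<in> f ` A" by (metis imageI)
    qed
  qed
  ultimately show ?thesis by simp
qed

lemma funpow_image_Q: "(f ^^ i) ` Q \<subseteq> Q \<and> (f ^^ i) ` Q \<in> sets borel"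
proof (induction i)
  case (Suc i)
  have "f ` (f ^^ i) ` Q \<subseteq> Q"
    by (rule image_subsetI) (rule f_Q[OF subsetD[OF conjunct1[OF Suc]]])
  moreover have "f ` (f ^^ i) ` Q \<in> sets borel"
    by (rule f_image_borel[OF conjunct1[OF Suc] conjunct2[OF Suc]])
  ultimately show ?case unfolding funpow_image_Suc ..
qed simp

lemma X_sets[measurable]: "X \<in> sets borel" using closed_X by simp

text \<open>By invariance, the complement of an iterated image of the square has the mass of its
  preimage under that iterate, and this preimage avoids the square.\<close>

lemma tower_outside_X: "emeasure towerM (- X) = 0"
proof -
  have "emeasure towerM (- ((f ^^ i) ` Q)) = 0" for i
  proof -
    have m: "- ((f ^^ i) ` Q) \<in> sets borel" using funpow_image_Q[of i] by auto
    have "emeasure towerM (- ((f ^^ i) ` Q)) = emeasure towerM ((f ^^ i) -` (- ((f ^^ i) ` Q)))"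
      by (rule tower_invariant_funpow[OF m, symmetric])
    also have "\<dots> \<le> emeasure towerM (- Q)"
    proof (rule emeasure_mono)
      show "(f ^^ i) -` (- ((f ^^ i) ` Q)) \<subseteq> - Q" by blast
    qed auto
    finally show ?thesis by (simp add: tower_outside_Q)
  qed
  moreover have "- ((f ^^ i) ` Q) \<in> sets towerM" for i
    using funpow_image_Q[of i] by (simp only: sets_towerM borel_comp)
  ultimately have "- ((f ^^ i) ` Q) \<in> null_sets towerM" for i by (rule null_setsI)
  then have "(\<Union>i. - ((f ^^ i) ` Q)) \<in> null_sets towerM" by (rule null_sets_UN)
  moreover have "- X \<subseteq> (\<Union>i. - ((f ^^ i) ` Q))" using core_X unfolding core_def by blast
  moreover have "- X \<in> sets towerM" by auto
  ultimately show ?thesis by (meson null_setsD1 null_sets_subset)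
qed

lemma AE_rho_X: "AE q in rho. q \<in> X"
proof (rule AE_I)
  show "{q \<in> space rho. q \<notin> X} \<subseteq> - X" by auto
  show "emeasure rho (- X) = 0" using rho_le_towerM[of "- X"] tower_outside_X by auto
  show "- X \<in> sets rho" by auto
qed

text \<open>Taking \<open>uniform_measure\<close> over the full space amounts to division by the
  total mass.\<close>

definition nuX :: "(real \<times> real) measure" where
  "nuX = restrict_space (uniform_measure towerM UNIV) X"

lemma sets_nuX: "sets nuX = sets (restrict_space borel X)"
  unfolding nuX_def by (intro sets_restrict_space_cong) simp

lemma space_nuX[simp]: "space nuX = X"
  unfolding nuX_def by (simp add: space_restrict_space)

lemma mem_sets_nuX: "A \<in> sets nuX \<longleftrightarrow> A \<in> sets borel \<and> A \<subseteq> X"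
  unfolding sets_nuX by (subst sets_restrict_space_iff) auto

lemma emeasure_nuX: "A \<in> sets nuX \<Longrightarrow> emeasure nuX A = emeasure towerM A / emeasure towerM UNIV"
proof -
  assume "A \<in> sets nuX"
  then have A: "A \<in> sets borel" "A \<subseteq> X" by (simp_all only: mem_sets_nuX)
  then have "emeasure nuX A = emeasure (uniform_measure towerM UNIV) A"
    unfolding nuX_def by (intro emeasure_restrict_space) auto
  also have "\<dots> = emeasure towerM A / emeasure towerM UNIV" using A by simp
  finally show ?thesis .
qed

lemma tower_Int_X: "A \<in> sets borel \<Longrightarrow> emeasure towerM (A \<inter> X) = emeasure towerM A"
proof -
  assume A: "A \<in> sets borel"
  have "emeasure towerM A \<le> emeasure towerM ((A \<inter> X) \<union> - X)" using A by (intro emeasure_mono) auto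
  also have "\<dots> \<le> emeasure towerM (A \<inter> X) + emeasure towerM (- X)" using A by (intro emeasure_subadditive) auto
  finally have "emeasure towerM A \<le> emeasure towerM (A \<inter> X)" by (simp add: tower_outside_X)
  moreover have "emeasure towerM (A \<inter> X) \<le> emeasure towerM A" using A by (intro emeasure_mono) auto
  ultimately show ?thesis by (rule antisym[rotated])
qed

lemma measure_preserving_nuX: "measure_preserving_map nuX f"
proof -
  have "emeasure nuX (space nuX) = emeasure towerM UNIV / emeasure towerM UNIV"
    using emeasure_nuX[of X] tower_Int_X[of UNIV] by (simp add: mem_sets_nuX)
  also have "\<dots> = 1"
    using emeasure_towerM_UNIV by (intro ennreal_divide_self) auto
  finally interpret prob_space nuX by (rule prob_spaceI)
  have meas: "f \<in> measurable nuX nuX"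
  proof (rule measurableI)
    show "f x \<in> space nuX" if "x \<in> space nuX" for x using that f_X by auto
    fix A assume "A \<in> sets nuX"
    then have "f -` A \<in> sets borel" using measurable_sets_borel[OF f_measurable] by (simp add: mem_sets_nuX)
    then show "f -` A \<inter> space nuX \<in> sets nuX" by (simp add: mem_sets_nuX)
  qed
  have "distr nuX nuX f = nuX"
  proof (rule measure_eqI)
    fix A assume A: "A \<in> sets (distr nuX nuX f)"
    then have An: "A \<in> sets nuX" and Ab: "A \<in> sets borel" by (simp_all add: mem_sets_nuX)
    have fA: "f -` A \<in> sets borel" by (rule measurable_sets_borel[OF f_measurable Ab])
    have "emeasure (distr nuX nuX f) A = emeasure nuX (f -` A \<inter> X)"
      using emeasure_distr[OF meas An] by simp
    also have "\<dots> = emeasure nuX A"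
      using fA An Ab by (simp add: emeasure_nuX mem_sets_nuX tower_Int_X tower_invariant)
    finally show "emeasure (distr nuX nuX f) A = emeasure nuX A" .
  qed simp
  with meas show ?thesis by unfold_locales auto
qed

section \<open>Ergodicity and metric entropy\<close>

lemma prob_space_unitM: "prob_space unitM"
proof
  have "emeasure unitM UNIV = (\<integral>\<^sup>+x. 1 \<partial>unitM)" by simp
  also have "\<dots> = (\<integral>\<^sup>+x. indicator {0<..1::real} x \<partial>lborel)"
    by (subst nn_integral_unitM) simp_all
  also have "\<dots> = 1" by simp
  finally show "emeasure unitM (space unitM) = 1" by simp
qed

sublocale unitM: prob_space unitM by (rule prob_space_unitM)

sublocale unit_eta: pair_sigma_finite unitM etaM ..

lemma nn_integral_rho_unitM:
  "g \<in> borel_measurable borel \<Longrightarrow> (\<integral>\<^sup>+q. g q \<partial>rho) = (\<integral>\<^sup>+x. (\<integral>\<^sup>+y. g (x, y) \<partial>etaM) \<partial>unitM)"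
  by (subst nn_integral_rho, assumption, subst nn_integral_unitM) simp_all

lemma AE_rho_fibres: "AE q in rho. P q \<Longrightarrow> AE x in unitM. AE y in etaM. P (x, y)"
  unfolding rho_def by (rule unit_eta.AE_pair)

lemma AE_unitM: "AE x in unitM. x \<in> {0<..1}"
  unfolding unitM_def by (subst AE_density) (auto simp: indicator_def)

lemma emeasure_unitM_atMost: "emeasure unitM {..x} = ennreal (max 0 (min 1 x))"
proof -
  have "emeasure unitM {..x} = (\<integral>\<^sup>+t. indicator {..x} t \<partial>unitM)" by simp
  also have "\<dots> = (\<integral>\<^sup>+t. indicator {0<..1} t * indicator {..x} t \<partial>lborel)"
    by (rule nn_integral_unitM) simp
  also have "\<dots> = (\<integral>\<^sup>+t. indicator {0<..max 0 (min 1 x)} t \<partial>lborel)"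
    by (intro nn_integral_cong) (auto simp: indicator_def)
  finally show ?thesis by simp
qed

lemma Pair_borel_measurable[measurable]: "Pair x \<in> borel_measurable (borel :: real measure)"
  for x :: real
  by (intro borel_measurable_continuous_onI continuous_intros)

lemma fibre_borel: "A \<in> sets (borel :: (real \<times> real) measure) \<Longrightarrow> Pair x -` A \<in> sets (borel :: real measure)"
  by (rule measurable_sets_borel[OF Pair_borel_measurable])

lemma nn_integral_fibre:
  fixes A :: "(real \<times> real) set"
  assumes "A \<in> sets borel"
  shows "(\<integral>\<^sup>+y. indicator A (x, y) \<partial>etaM) = emeasure etaM (Pair x -` A)"
proof -
  have "(\<integral>\<^sup>+y. indicator A (x, y) \<partial>etaM) = (\<integral>\<^sup>+y. indicator (Pair x -` A) y \<partial>etaM)"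
    by (intro nn_integral_cong) (simp add: indicator_def)
  also have "\<dots> = emeasure etaM (Pair x -` A)"
    by (rule nn_integral_indicator) (simp add: fibre_borel[OF assms])
  finally show ?thesis .
qed

text \<open>In the self-similarity of \<open>etaM\<close> a vanishing sum of nonnegative terms
  vanishes termwise, and \<open>dig n\<close> makes the weight of the term positive.\<close>

lemma fibre_return_null:
  fixes A :: "(real \<times> real) set"
  assumes A[measurable]: "A \<in> sets borel" and "emeasure etaM (Pair x -` A) = 0" and "dig n"
  shows "(\<integral>\<^sup>+y. indicator A (x, ret n y) \<partial>etaM) = 0"
proof -
  have [measurable]: "(\<lambda>y. indicator A (x, y) :: ennreal) \<in> borel_measurable borel" by measurable
  have "(\<Sum>n. ennreal (wt n) * (\<integral>\<^sup>+y. indicator A (x, ret n y) \<partial>etaM)) = 0"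
    using etaM_selfsimilar[of "\<lambda>y. indicator A (x, y)"] assms(2) by (simp add: nn_integral_fibre[OF A])
  then have "ennreal (wt n) * (\<integral>\<^sup>+y. indicator A (x, ret n y) \<partial>etaM) = 0"
    using sum_le_suminf[of "\<lambda>n. ennreal (wt n) * (\<integral>\<^sup>+y. indicator A (x, ret n y) \<partial>etaM)" "{n}"] by simp
  moreover have "0 < wt n" using assms(3) beta by (simp add: wt_def)
  ultimately show ?thesis by simp
qed

section \<open>Invariant sets are null or of full measure\<close>

context
  fixes B :: "(real \<times> real) set"
  assumes B[measurable]: "B \<in> sets borel" and BX: "B \<subseteq> X" and B_inv: "f -` B \<inter> X = B"
begin

lemma funpow_B: "q \<in> X \<Longrightarrow> (f ^^ k) q \<in> X \<and> ((f ^^ k) q \<in> B \<longleftrightarrow> q \<in> B)"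
proof (induction k)
  case (Suc k)
  then have "(f ^^ k) q \<in> X" by blast
  then have "f ((f ^^ k) q) \<in> X" "f ((f ^^ k) q) \<in> B \<longleftrightarrow> (f ^^ k) q \<in> B"
    using f_X B_inv by blast+
  then show ?case using Suc by simp
qed simp

text \<open>Two points on the same fibre approach each other under iteration, so they cannot enter
  separated compact sets inside \<open>B\<close> and inside its complement.\<close>

lemma fibre_product_small:
  assumes x: "x \<in> {0<..1}" and AE: "AE y in etaM. (x, y) \<in> X"
    and K: "K \<subseteq> B" "K' \<subseteq> - B" "\<And>p q. p \<in> K \<Longrightarrow> q \<in> K' \<Longrightarrow> \<delta> \<le> dist p q" and k: "\<tau> ^ k < \<delta>"
    and bad: "bad = - (K \<union> K')" "bad \<in> sets borel"
  shows "measure etaM (Pair x -` B) * (1 - measure etaM (Pair x -` B)) \<le>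
    measure etaM (Pair x -` ((f ^^ k) -` bad))"
proof -
  let ?u = "measure etaM (Pair x -` B)"
  let ?V = "Pair x -` ((f ^^ k) -` bad)"
  have u: "0 \<le> ?u" "?u \<le> 1" by auto
  have Bf: "Pair x -` B \<in> sets borel" by (rule fibre_borel[OF B])
  have Vf: "?V \<in> sets borel" by (intro fibre_borel measurable_sets_borel[OF funpow_f_measurable] bad)
  have close: "dist ((f ^^ k) (x, y)) ((f ^^ k) (x, y')) < \<delta>" if "(x, y) \<in> X" "(x, y') \<in> X" for y y'
  proof -
    have "y \<in> {0..1}" "y' \<in> {0..1}" using subsetD[OF X_Q that(1)] subsetD[OF X_Q that(2)] by simp_all
    then have "\<bar>y - y'\<bar> \<le> 1" by (auto simp: abs_le_iff)
    then have "\<tau> ^ k * \<bar>y - y'\<bar> \<le> \<tau> ^ k" using tau by (simp add: mult_left_le)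
    moreover have "dist ((f ^^ k) (x, y)) ((f ^^ k) (x, y')) = \<tau> ^ k * \<bar>y - y'\<bar>"
      using tau by (simp add: dist_norm funpow_diff norm_Pair abs_mult)
    ultimately show ?thesis using k by linarith
  qed
  show ?thesis
  \<comment> \<open>If one point of the fibre is in \<open>K\<close> at time \<open>k\<close>, none
    is in \<open>K'\<close>, so almost all of the fibre outside \<open>B\<close> is in
    \<open>bad\<close>; otherwise the part inside \<open>B\<close> is. Either way one factor of the
    product is bounded, and the other is at most 1.\<close>
  proof (cases "\<exists>y. (x, y) \<in> X \<and> (f ^^ k) (x, y) \<in> K")
    case True
    then obtain y0 where y0: "(x, y0) \<in> X" "(f ^^ k) (x, y0) \<in> K" by blast
    have "measure etaM (- (Pair x -` B)) \<le> measure etaM ?V"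
    proof (rule etaM.finite_measure_mono_AE)
      show "AE y in etaM. y \<in> - (Pair x -` B) \<longrightarrow> y \<in> ?V"
        using AE
      proof eventually_elim
        case (elim y)
        show ?case
        proof
          assume "y \<in> - (Pair x -` B)"
          then have "(f ^^ k) (x, y) \<notin> B" using funpow_B[OF elim] by simp
          moreover have "(f ^^ k) (x, y) \<notin> K'"
          proof
            assume "(f ^^ k) (x, y) \<in> K'"
            from K(3)[OF y0(2) this] close[OF y0(1) elim] show False by simp
          qed
          ultimately show "y \<in> ?V" using K(1) bad(1) by auto
        qed
      qed
    qed (use Vf in simp)
    moreover have "measure etaM (- (Pair x -` B)) = 1 - ?u"
      using etaM.prob_compl[of "Pair x -` B"] Bf by (simp add: Compl_eq_Diff_UNIV)
    moreover have "?u * (1 - ?u) \<le> 1 * (1 - ?u)" using u by (intro mult_right_mono) auto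
    ultimately show ?thesis by simp
  next
    case False
    have "?u \<le> measure etaM ?V"
    proof (rule etaM.finite_measure_mono_AE)
      show "AE y in etaM. y \<in> Pair x -` B \<longrightarrow> y \<in> ?V"
        using AE
      proof eventually_elim
        case (elim y)
        show ?case
        proof
          assume "y \<in> Pair x -` B"
          then have "(f ^^ k) (x, y) \<in> B" using funpow_B[OF elim] by simp
          moreover have "(f ^^ k) (x, y) \<notin> K" using False elim by blast
          ultimately show "y \<in> ?V" using K(2) bad(1) by auto
        qed
      qed
    qed (use Vf in simp)
    moreover have "?u * (1 - ?u) \<le> ?u * 1" using u by (intro mult_left_mono) auto
    ultimately show ?thesis by simp
  qed
qed

lemma fibre_measurable: "(\<lambda>x. measure etaM (Pair x -` B)) \<in> borel_measurable borel"
proof -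
  have "(\<lambda>x. emeasure etaM (Pair x -` B)) \<in> borel_measurable borel"
    using measurable_etaM_fst[of "indicator B"] by (simp add: nn_integral_fibre)
  then show ?thesis unfolding measure_def by (rule measurable_compose) simp
qed

text \<open>The product \<open>u x * (1 - u x)\<close> vanishes only for the values 0 and 1. Compact
  approximation is done for \<open>towerM\<close>, since this measure is invariant and the bound
  must not deteriorate with the time \<open>k\<close>; \<open>rho_le_towerM\<close> brings the
  estimate back to \<open>rho\<close>.\<close>

lemma fibre_zero_one: "AE x in unitM. emeasure etaM (Pair x -` B) = 0 \<or> emeasure etaM (Pair x -` B) = 1"
proof -
  define u where "u x = measure etaM (Pair x -` B)" for x
  have u_meas[measurable]: "u \<in> borel_measurable borel" unfolding u_def[abs_def] by (rule fibre_measurable)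
  have fin_towerM: "finite_measure towerM" using emeasure_towerM_UNIV(2) by (intro finite_measureI) auto
  interpret towerM: finite_measure towerM by (rule fin_towerM)
  have "(\<integral>\<^sup>+x. ennreal (u x * (1 - u x)) \<partial>unitM) \<le> 0 + ennreal \<epsilon>" if \<epsilon>: "0 < \<epsilon>" for \<epsilon>
  proof -
    obtain K where K: "K \<subseteq> B" "compact K" "measure towerM B < measure towerM K + \<epsilon> / 2"
      using compact_inner_approx[OF fin_towerM sets_towerM B, of "\<epsilon> / 2"] \<epsilon> by auto
    obtain K' where K': "K' \<subseteq> - B" "compact K'" "measure towerM (- B) < measure towerM K' + \<epsilon> / 2"
      using compact_inner_approx[OF fin_towerM sets_towerM borel_comp[OF B], of "\<epsilon> / 2"] \<epsilon> by auto
    have KK': "K \<inter> K' = {}" using K(1) K'(1) by blast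
    obtain \<delta> where \<delta>: "0 < \<delta>" "\<And>p q. p \<in> K \<Longrightarrow> q \<in> K' \<Longrightarrow> \<delta> \<le> dist p q"
      using separate_compact_closed[OF K(2) compact_imp_closed[OF K'(2)] KK'] by blast
    obtain k where k: "\<tau> ^ k < \<delta>" using real_arch_pow_inv[OF \<delta>(1), of \<tau>] tau by auto
    define bad where "bad = - (K \<union> K')"
    have Kb[measurable]: "K \<in> sets borel" "K' \<in> sets borel" using K K' by (auto intro: borel_compact)
    have bad_b[measurable]: "bad \<in> sets borel" unfolding bad_def by measurable
    have "measure towerM bad = measure towerM UNIV - measure towerM (K \<union> K')"
      unfolding bad_def using towerM.finite_measure_compl[of "K \<union> K'"] by (simp add: Compl_eq_Diff_UNIV)
    also have "measure towerM UNIV = measure towerM B + measure towerM (- B)"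
      using towerM.finite_measure_compl[of B] by (simp add: Compl_eq_Diff_UNIV)
    also have "measure towerM (K \<union> K') = measure towerM K + measure towerM K'"
      using KK' by (intro towerM.finite_measure_Union) auto
    finally have bad_small: "measure towerM bad \<le> \<epsilon>" using K(3) K'(3) by simp
    let ?V = "\<lambda>x. Pair x -` ((f ^^ k) -` bad)"
    have fb[measurable]: "(f ^^ k) -` bad \<in> sets borel" by (rule measurable_sets_borel[OF funpow_f_measurable bad_b])
    have "AE x in unitM. ennreal (u x * (1 - u x)) \<le> emeasure etaM (?V x)"
      using AE_unitM AE_rho_fibres[OF AE_rho_X]
    proof eventually_elim
      case (elim x)
      have "u x * (1 - u x) \<le> measure etaM (?V x)"
        unfolding u_def by (rule fibre_product_small[OF elim K(1) K'(1) \<delta>(2) k bad_def bad_b])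
      then show ?case by (simp add: etaM.emeasure_eq_measure ennreal_leI)
    qed
    then have "(\<integral>\<^sup>+x. ennreal (u x * (1 - u x)) \<partial>unitM) \<le> (\<integral>\<^sup>+x. emeasure etaM (?V x) \<partial>unitM)"
      by (rule nn_integral_mono_AE)
    also have "\<dots> = (\<integral>\<^sup>+q. indicator ((f ^^ k) -` bad) q \<partial>rho)"
      by (subst nn_integral_rho_unitM) (simp_all add: nn_integral_fibre)
    also have "\<dots> = emeasure rho ((f ^^ k) -` bad)" by (rule nn_integral_indicator) simp
    also have "\<dots> \<le> emeasure towerM ((f ^^ k) -` bad)" by (rule rho_le_towerM[OF fb])
    also have "\<dots> = emeasure towerM bad" by (rule tower_invariant_funpow[OF bad_b])
    also have "\<dots> \<le> ennreal \<epsilon>" using bad_small by (simp add: towerM.emeasure_eq_measure ennreal_leI)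
    finally show ?thesis by simp
  qed
  then have "(\<integral>\<^sup>+x. ennreal (u x * (1 - u x)) \<partial>unitM) \<le> 0"
    by (rule ennreal_le_epsilon)
  then have "AE x in unitM. ennreal (u x * (1 - u x)) = 0"
    by (subst (asm) le_zero_eq, subst (asm) nn_integral_0_iff_AE) auto
  then show ?thesis
  proof eventually_elim
    case (elim x)
    have u: "0 \<le> u x" "u x \<le> 1" by (auto simp: u_def)
    then have "u x * (1 - u x) \<le> 0" using elim by (simp add: ennreal_eq_0_iff)
    moreover have "0 \<le> u x * (1 - u x)" using u by (intro mult_nonneg_nonneg) auto
    ultimately have "u x = 0 \<or> u x = 1" by simp
    then show ?case by (auto simp: u_def etaM.emeasure_eq_measure)
  qed
qed

definition cumul :: "real \<Rightarrow> real" where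
  "cumul c = measure rho (B \<inter> {q. fst q \<le> c})"

text \<open>The return from level \<open>n\<close> takes the part of \<open>B\<close> over
  \<open>{lev n<..lev n + wt n * c}\<close> to the part over \<open>{0<..c}\<close>, with heights
  \<open>ret n y\<close>. On a fibre that is null or full, replacing \<open>ret n y\<close> by
  \<open>y\<close> does not change the mass of \<open>B\<close>: apply
  \<open>fibre_return_null\<close> to \<open>B\<close> or to its complement.\<close>

lemma cumul_branch:
  assumes c: "0 \<le> c" "c \<le> 1" and n: "dig n"
  shows "cumul (lev n + wt n * c) - cumul (lev n) = wt n * cumul c"
proof -
  have w: "wt n = inverse \<beta> ^ Suc n" "0 < wt n" using n beta by (auto simp: wt_def)
  have bw: "\<beta> ^ Suc n * wt n = 1" unfolding w(1) by (rule beta_inverse_power)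
  let ?A = "B \<inter> {q. fst q \<le> c}"
  have half[measurable]: "{q :: real \<times> real. fst q \<le> t} \<in> sets borel" for t by measurable
  have Ab[measurable]: "?A \<in> sets borel" by measurable
  let ?J = "B \<inter> {q. lev n < fst q \<and> fst q \<le> lev n + wt n * c}"
  have Jb[measurable]: "?J \<in> sets borel" by measurable
  have "emeasure rho ?J = (\<integral>\<^sup>+q. indicator ?J q \<partial>rho)" by simp
  also have "\<dots> = (\<integral>\<^sup>+q. indicator {lev n<..lev (Suc n)} (fst q) * indicator ?A ((f ^^ Suc n) q) \<partial>rho)"
  proof (rule nn_integral_cong_AE)
    show "AE q in rho. indicator ?J q =
        indicator {lev n<..lev (Suc n)} (fst q) * (indicator ?A ((f ^^ Suc n) q) :: ennreal)"
      using AE_rho_X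
    proof eventually_elim
      case (elim q)
      show ?case
      proof (cases "lev n < fst q \<and> fst q \<le> lev (Suc n)")
        case True
        have "fst ((f ^^ Suc n) q) = \<beta> ^ Suc n * (fst q - lev n)"
          using funpow_return[of n "fst q" "snd q"] True by (metis fst_conv prod.collapse)
        moreover have "\<beta> ^ Suc n * (fst q - lev n) \<le> c \<longleftrightarrow> fst q - lev n \<le> wt n * c"
        proof -
          have "\<beta> ^ Suc n * (fst q - lev n) \<le> c \<longleftrightarrow> wt n * (\<beta> ^ Suc n * (fst q - lev n)) \<le> wt n * c"
            using w(2) by (simp only: mult_le_cancel_left_pos)
          also have "wt n * (\<beta> ^ Suc n * (fst q - lev n)) = fst q - lev n"
            using bw by (simp only: mult.assoc[symmetric] mult.commute[of "wt n"] mult_1)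
          finally show ?thesis .
        qed
        moreover have "fst q - lev n \<le> wt n * c \<longleftrightarrow> fst q \<le> lev n + wt n * c" by linarith
        ultimately have "(f ^^ Suc n) q \<in> ?A \<longleftrightarrow> q \<in> B \<and> fst q \<le> lev n + wt n * c"
          using funpow_B[OF elim, of "Suc n"] by (simp only: Int_iff mem_Collect_eq)
        then have "(f ^^ Suc n) q \<in> ?A \<longleftrightarrow> q \<in> ?J" using True by blast
        then show ?thesis using True by (simp only: indicator_def) simp
      next
        case False
        have "wt n * c \<le> wt n * 1" using c w(2) by (intro mult_left_mono) auto
        then have "q \<notin> ?J" using False by (auto simp: lev_Suc)
        moreover have "fst q \<notin> {lev n<..lev (Suc n)}" using False by simp
        ultimately show ?thesis by (simp only: indicator_simps mult_zero_left not_False_eq_True)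
      qed
    qed
  qed
  also have "\<dots> = ennreal (wt n) * (\<integral>\<^sup>+x. indicator {0<..1} x * (\<integral>\<^sup>+y. indicator ?A (x, ret n y) \<partial>etaM) \<partial>lborel)"
    by (rule nn_integral_rho_return) simp
  also have "(\<integral>\<^sup>+x. indicator {0<..1} x * (\<integral>\<^sup>+y. indicator ?A (x, ret n y) \<partial>etaM) \<partial>lborel) =
      (\<integral>\<^sup>+x. (\<integral>\<^sup>+y. indicator ?A (x, ret n y) \<partial>etaM) \<partial>unitM)"
  proof (rule nn_integral_unitM[symmetric])
    show "(\<lambda>x. \<integral>\<^sup>+y. indicator ?A (x, ret n y) \<partial>etaM) \<in> borel_measurable borel"
      using measurable_etaM_fst[of "\<lambda>q. indicator ?A (fst q, ret n (snd q))"] by simp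
  qed
  also have "\<dots> = (\<integral>\<^sup>+x. (\<integral>\<^sup>+y. indicator ?A (x, y) \<partial>etaM) \<partial>unitM)"
  proof (rule nn_integral_cong_AE)
    show "AE x in unitM. (\<integral>\<^sup>+y. indicator ?A (x, ret n y) \<partial>etaM) = (\<integral>\<^sup>+y. indicator ?A (x, y) \<partial>etaM)"
      using fibre_zero_one
    proof eventually_elim
      case (elim x)
      have V: "(\<integral>\<^sup>+y. indicator B (x, ret n y) \<partial>etaM) = emeasure etaM (Pair x -` B)"
      proof (cases "emeasure etaM (Pair x -` B) = 0")
        case True
        then show ?thesis using fibre_return_null[OF B True n] by simp
      next
        case False
        then have one: "emeasure etaM (Pair x -` B) = 1" using elim by blast
        have "emeasure etaM (Pair x -` (- B)) = 0"
        proof -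
          have "Pair x -` (- B) = space etaM - Pair x -` B" by auto
          then show ?thesis
            using emeasure_compl[of "Pair x -` B" etaM] fibre_borel[OF B, of x] one etaM.emeasure_space_1
            by simp
        qed
        then have "(\<integral>\<^sup>+y. indicator (- B) (x, ret n y) \<partial>etaM) = 0"
          by (intro fibre_return_null n) auto
        then have null: "AE y in etaM. indicator (- B) (x, ret n y) = (0 :: ennreal)"
          by (subst (asm) nn_integral_0_iff_AE) auto
        have "(\<integral>\<^sup>+y. indicator B (x, ret n y) \<partial>etaM) = (\<integral>\<^sup>+y. 1 \<partial>etaM)"
          by (rule nn_integral_cong_AE) (use null in eventually_elim, simp add: indicator_def split: if_splits)
        then show ?thesis using one etaM.emeasure_space_1 by simp
      qed
      have "(\<integral>\<^sup>+y. indicator ?A (x, z y) \<partial>etaM) = indicator {..c} x * (\<integral>\<^sup>+y. indicator B (x, z y) \<partial>etaM)" for z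
        by (cases "x \<le> c") (auto simp: indicator_def)
      then show ?case using V by (simp only: nn_integral_fibre[OF B])
    qed
  qed
  also have "\<dots> = (\<integral>\<^sup>+q. indicator ?A q \<partial>rho)" by (rule nn_integral_rho_unitM[symmetric]) simp
  also have "\<dots> = emeasure rho ?A" by simp
  finally have "measure rho ?J = wt n * measure rho ?A"
    using w(2) by (simp add: rho.emeasure_eq_measure ennreal_mult[symmetric])
  moreover have "measure rho (B \<inter> {q. fst q \<le> lev n + wt n * c}) = measure rho (B \<inter> {q. fst q \<le> lev n}) + measure rho ?J"
  proof -
    have "B \<inter> {q. fst q \<le> lev n + wt n * c} = (B \<inter> {q. fst q \<le> lev n}) \<union> ?J"
      using c w(2) by (auto intro: order_trans[of _ "lev n"])
    then show ?thesis by (simp only:) (rule rho.finite_measure_Union, auto)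
  qed
  ultimately show ?thesis unfolding cumul_def by simp
qed

text \<open>The deviation \<open>D\<close> from the linear function is 0 at every
  \<open>lev n\<close>, and between two levels it is a copy of itself scaled by
  \<open>wt n \<le> inverse \<beta>\<close>. Iteration starting from
  \<open>\<bar>D c\<bar> \<le> 1\<close> forces it to vanish.\<close>

lemma cumul_linear:
  assumes "0 \<le> c" "c \<le> 1"
  shows "cumul c = measure rho B * c"
proof -
  define b where "b = measure rho B"
  define D where "D c = cumul c - b * c" for c
  have b: "0 \<le> b" "b \<le> 1" by (auto simp: b_def)
  have cumul0: "cumul 0 = 0"
  proof -
    have "AE q in rho. q \<notin> B \<inter> {q. fst q \<le> 0}" using AE_rho_fst by eventually_elim auto
    then show ?thesis unfolding cumul_def by (subst rho.prob_eq_0) auto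
  qed
  have cumul1: "cumul 1 = b"
    unfolding cumul_def b_def
  proof (rule rho.finite_measure_eq_AE)
    show "AE q in rho. (q \<in> B \<inter> {q. fst q \<le> 1}) = (q \<in> B)"
      using AE_rho_fst by eventually_elim auto
  qed auto
  have branch: "D (lev n + wt n * c) = D (lev n) + wt n * D c" if "0 \<le> c" "c \<le> 1" "dig n" for n c
    using cumul_branch[OF that] by (simp add: D_def algebra_simps)
  have Dlev: "D (lev n) = 0" for n
  proof (induction n)
    case 0
    then show ?case by (simp add: lev_0 D_def cumul0)
  next
    case (Suc n)
    show ?case
    proof (cases "dig n")
      case True
      then show ?thesis using branch[of 1 n] Suc by (simp add: lev_Suc D_def cumul1)
    qed (use Suc in \<open>simp add: lev_Suc wt_def\<close>)
  qed
  have bound: "\<bar>D c\<bar> \<le> inverse \<beta> ^ k" if "0 \<le> c" "c \<le> 1" for c k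
    using that
  proof (induction k arbitrary: c)
    case 0
    have "0 \<le> cumul c" "cumul c \<le> 1" by (auto simp: cumul_def)
    moreover have "0 \<le> b * c" "b * c \<le> 1" using b 0 by (auto intro: mult_le_one)
    ultimately show ?case by (simp add: D_def abs_le_iff)
  next
    case (Suc k)
    show ?case
    proof (cases "c = 0 \<or> c = 1")
      case True
      then have "D c = 0" using cumul0 cumul1 by (auto simp: D_def)
      then show ?thesis using beta by simp
    next
      case False
      then have c: "0 < c" "c < 1" using Suc.prems by auto
      obtain m0 where "c < lev m0"
        using order_tendstoD(1)[OF lev_tendsto c(2)] by (auto simp: eventually_sequentially)
      then have "\<exists>m. c \<le> lev m" by (intro exI[of _ m0]) simp
      \<comment> \<open>The least such level locates the branch containing \<open>c\<close>. Its
        interval is nonempty, hence \<open>wt n\<close> is not 0 and \<open>dig n\<close>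
        holds.\<close>
      then have ex: "c \<le> lev (LEAST m. c \<le> lev m)" by (rule LeastI_ex)
      then have "(LEAST m. c \<le> lev m) \<noteq> 0" using c lev_0 by (metis not_le)
      then obtain n where n: "(LEAST m. c \<le> lev m) = Suc n" by (metis not0_implies_Suc)
      have "\<not> c \<le> lev n" using not_less_Least[of n "\<lambda>m. c \<le> lev m"] n by simp
      then have cn: "lev n < c" "c \<le> lev n + wt n" using ex n by (auto simp: lev_Suc)
      then have dn: "dig n" by (auto simp: wt_def split: if_splits)
      then have w: "0 < wt n" "wt n \<le> inverse \<beta>"
        using inverse_beta power_decreasing[of 1 "Suc n" "inverse \<beta>"] by (auto simp: wt_def)
      define c' where "c' = (c - lev n) / wt n"
      have c': "0 \<le> c'" "c' \<le> 1" "c = lev n + wt n * c'" using cn w by (auto simp: c'_def field_simps)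
      have "D c = wt n * D c'" using branch[OF c'(1,2) dn] Dlev[of n] c'(3) by simp
      then have "\<bar>D c\<bar> = wt n * \<bar>D c'\<bar>" using w by (simp add: abs_mult)
      also have "\<dots> \<le> inverse \<beta> * inverse \<beta> ^ k"
        using Suc.IH[OF c'(1,2)] w beta by (intro mult_mono) auto
      finally show ?thesis by simp
    qed
  qed
  have "(\<lambda>k. inverse \<beta> ^ k) \<longlonglongrightarrow> 0" using inverse_beta by (intro LIMSEQ_realpow_zero) auto
  then have "\<bar>D c\<bar> \<le> 0" using bound[OF assms] by (intro LIMSEQ_le_const) auto
  then show ?thesis by (simp add: D_def b_def)
qed

text \<open>Thus \<open>B\<close> is independent of the first coordinate. As \<open>B\<close> agrees up to a null set with
  the preimage of a set of first coordinates, it is independent of itself.\<close>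

lemma rho_zero_one: "measure rho B = 0 \<or> measure rho B = 1"
proof -
  define b where "b = measure rho B"
  define M1 where "M1 = distr (density rho (indicator B)) borel fst"
  define N1 where "N1 = density unitM (\<lambda>_. ennreal b)"
  have M1: "emeasure M1 A = emeasure rho (B \<inter> fst -` A)" if A: "A \<in> sets borel" for A
  proof -
    have fA: "fst -` A \<in> sets (borel :: (real \<times> real) measure)" by (rule fst_vimage_borel[OF A])
    have "emeasure M1 A = emeasure (density rho (indicator B)) (fst -` A)"
      unfolding M1_def using A by (subst emeasure_distr) auto
    also have "\<dots> = (\<integral>\<^sup>+q. indicator B q * indicator (fst -` A) q \<partial>rho)"
      using fA by (intro emeasure_density) auto
    also have "\<dots> = (\<integral>\<^sup>+q. indicator (B \<inter> fst -` A) q \<partial>rho)"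
      by (intro nn_integral_cong) (auto simp: indicator_def)
    also have "\<dots> = emeasure rho (B \<inter> fst -` A)" using fA by (intro nn_integral_indicator) auto
    finally show ?thesis .
  qed
  have N1: "emeasure N1 A = ennreal b * emeasure unitM A" if "A \<in> sets borel" for A
    unfolding N1_def using that by (subst emeasure_density) (auto simp: nn_integral_cmult)
  have cumul_all: "cumul x = b * max 0 (min 1 x)" for x
  proof -
    have "cumul x = cumul (max 0 (min 1 x))"
      unfolding cumul_def
    proof (rule rho.finite_measure_eq_AE)
      show "AE q in rho. (q \<in> B \<inter> {q. fst q \<le> x}) = (q \<in> B \<inter> {q. fst q \<le> max 0 (min 1 x)})"
        using AE_rho_fst by eventually_elim auto
    qed auto
    then show ?thesis unfolding b_def by (subst cumul_linear[symmetric]) auto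
  qed
  \<comment> \<open>Linearity of \<open>cumul\<close> is independence for half-lines; equality of
    the two measures extends it to arbitrary Borel sets of abscissas, in particular to the set
    \<open>A\<close> of full fibres.\<close>
  have "M1 = N1"
  proof (rule measure_eqI_lessThan)
    show "sets M1 = sets borel" "sets N1 = sets borel" by (simp_all add: M1_def N1_def)
    fix x
    have "emeasure M1 {x<..} = ennreal (measure rho (B - (B \<inter> {q. fst q \<le> x})))"
    proof -
      have "B \<inter> fst -` {x<..} = B - (B \<inter> {q. fst q \<le> x})" by auto
      then show ?thesis using M1[of "{x<..}"] by (simp add: rho.emeasure_eq_measure)
    qed
    also have "measure rho (B - (B \<inter> {q. fst q \<le> x})) = b - b * max 0 (min 1 x)"
      unfolding cumul_all[symmetric] unfolding b_def cumul_def by (intro rho.finite_measure_Diff) auto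
    finally have 1: "emeasure M1 {x<..} = ennreal (b * (1 - max 0 (min 1 x)))" by (simp add: algebra_simps)
    show "emeasure M1 {x<..} < \<infinity>" unfolding 1 by simp
    have "measure unitM {..x} = max 0 (min 1 x)" 
      unfolding measure_def emeasure_unitM_atMost by (rule enn2real_ennreal) simp
    moreover have "UNIV - {..x} = {x<..}" by auto
    ultimately have "measure unitM {x<..} = 1 - max 0 (min 1 x)" using unitM.prob_compl[of "{..x}"] by simp
    then have "emeasure N1 {x<..} = ennreal b * ennreal (1 - max 0 (min 1 x))"
      using N1[of "{x<..}"] by (simp add: unitM.emeasure_eq_measure)
    then show "emeasure M1 {x<..} = emeasure N1 {x<..}"
      unfolding 1 by (subst (asm) ennreal_mult[symmetric]) (auto simp: b_def)
  qed
  define A where "A = {x. measure etaM (Pair x -` B) = 1}"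
  have A: "A \<in> sets borel"
  proof -
    have "{x \<in> space borel. measure etaM (Pair x -` B) = 1} \<in> sets borel"
      using fibre_measurable by measurable
    then show ?thesis by (simp add: A_def)
  qed
  have ind: "AE x in unitM. emeasure etaM (Pair x -` B) = indicator A x"
    using fibre_zero_one by eventually_elim (auto simp: A_def etaM.emeasure_eq_measure indicator_def)
  have "emeasure rho B = (\<integral>\<^sup>+x. emeasure etaM (Pair x -` B) \<partial>unitM)"
    using nn_integral_rho_unitM[of "indicator B"] by (simp add: nn_integral_fibre)
  also have "\<dots> = (\<integral>\<^sup>+x. indicator A x \<partial>unitM)" by (rule nn_integral_cong_AE[OF ind])
  also have "\<dots> = emeasure unitM A" using A by simp
  finally have bA: "b = measure unitM A" by (simp add: b_def measure_def)
  have AB: "B \<inter> fst -` A \<in> sets borel" using fst_vimage_borel[OF A] by auto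
  have "emeasure rho (B \<inter> fst -` A) = (\<integral>\<^sup>+q. indicator (B \<inter> fst -` A) q \<partial>rho)" using AB by simp
  also have "\<dots> = (\<integral>\<^sup>+x. (\<integral>\<^sup>+y. indicator (B \<inter> fst -` A) (x, y) \<partial>etaM) \<partial>unitM)"
    using AB by (intro nn_integral_rho_unitM) simp
  also have "\<dots> = (\<integral>\<^sup>+x. indicator A x \<partial>unitM)"
  proof (rule nn_integral_cong_AE)
    show "AE x in unitM. (\<integral>\<^sup>+y. indicator (B \<inter> fst -` A) (x, y) \<partial>etaM) = indicator A x"
      using ind
    proof eventually_elim
      case (elim x)
      have "(\<integral>\<^sup>+y. indicator (B \<inter> fst -` A) (x, y) \<partial>etaM) = indicator A x * (\<integral>\<^sup>+y. indicator B (x, y) \<partial>etaM)"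
        by (cases "x \<in> A") (auto simp: indicator_def)
      also have "(\<integral>\<^sup>+y. indicator B (x, y) \<partial>etaM) = indicator A x"
        using elim by (simp only: nn_integral_fibre[OF B])
      finally show ?case by (simp add: indicator_def)
    qed
  qed
  also have "\<dots> = emeasure unitM A" using A by simp
  \<comment> \<open>Independence evaluated at \<open>A\<close>: the left side is \<open>b\<close>
    times the measure of \<open>A\<close>, the right side is the measure of \<open>B\<close> over
    \<open>A\<close>, and the measure of \<open>A\<close> is \<open>b\<close> itself.\<close>
  finally have "ennreal b * emeasure unitM A = emeasure unitM A"
    using M1[OF A] N1[OF A] \<open>M1 = N1\<close> by simp
  then have "b * b = b" unfolding unitM.emeasure_eq_measure bA[symmetric]
    by (subst (asm) ennreal_mult[symmetric]) (auto simp: b_def)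
  then show ?thesis unfolding b_def by simp
qed

text \<open>On every level the iterate lies in \<open>B\<close> only if its base point does, up to a
  null set, so each level inherits nullity from the base.\<close>

lemma tower_null_of_rho_null:
  assumes "measure rho B = 0"
  shows "emeasure towerM B = 0"
proof -
  have "AE q in rho. q \<notin> B" using assms by (subst (asm) rho.prob_eq_0) auto
  then have notB: "AE q in rho. q \<in> X \<and> q \<notin> B" using AE_rho_X by eventually_elim blast
  have "(\<integral>\<^sup>+q. indicator {lev n<..} (fst q) * indicator B ((f ^^ n) q) \<partial>rho) = (\<integral>\<^sup>+q. 0 \<partial>rho)" for n
    by (rule nn_integral_cong_AE) (use notB in \<open>eventually_elim, use funpow_B in \<open>auto simp: indicator_def\<close>\<close>)
  then show ?thesis by (subst emeasure_towerM) auto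
qed

end

text \<open>Only null sets can be lifted from the base to the tower directly; the case of full
  measure is reduced to them by passing to \<open>X - B\<close>, which is invariant because
  \<open>f\<close> maps \<open>X\<close> into itself.\<close>

lemma ergodic_nuX: "ergodic_borel_prob X f nuX"
proof -
  interpret measure_preserving_map nuX f by (rule measure_preserving_nuX)
  have "measure nuX B = 0 \<or> measure nuX B = 1" if Bs: "B \<in> sets nuX" and inv': "f -` B \<inter> X = B" for B
  proof -
    have B: "B \<in> sets borel" "B \<subseteq> X" using Bs by (simp_all only: mem_sets_nuX)
    have C: "X - B \<in> sets borel" "X - B \<subseteq> X" using B by auto
    have invC: "f -` (X - B) \<inter> X = X - B" using inv' f_X by blast
    show ?thesis
    proof (cases "measure rho B = 0")
      case True
      then have "emeasure towerM B = 0" by (rule tower_null_of_rho_null[OF B inv'])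
      then have "emeasure nuX B = 0" using emeasure_nuX[OF Bs] by simp
      then show ?thesis by (simp add: measure_def)
    next
      case False
      then have one: "measure rho B = 1" using rho_zero_one[OF B inv'] by blast
      have "measure rho (X - B) \<le> measure rho (UNIV - B)" using B by (intro rho.finite_measure_mono) auto
      also have "\<dots> = 0" using rho.prob_compl[of B] B one by simp
      finally have "measure rho (X - B) = 0" by (simp add: measure_le_0_iff)
      then have "emeasure towerM (X - B) = 0" by (rule tower_null_of_rho_null[OF C invC])
      then have "emeasure nuX (X - B) = 0" using emeasure_nuX[of "X - B"] C by (simp add: mem_sets_nuX)
      then have "measure nuX (space nuX - B) = 0" by (simp add: measure_def)
      then show ?thesis using prob_compl[OF Bs] by simp
    qed
  qed
  then show ?thesis
    unfolding ergodic_borel_prob_def using prob_space_axioms sets_nuX meas inv by blast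
qed

section \<open>The metric entropy of the constructed measure\<close>

text \<open>The entropy of a join is the mean of \<open>- ln\<close> of the measure of its elements,
  and the bounded marginal density makes each of these measures at most
  \<open>C * inverse \<beta> ^ n\<close>.\<close>

lemma partition_entropy_strips: "ln \<beta> \<le> partition_entropy f nuX strips"
proof -
  interpret measure_preserving_map nuX f by (rule measure_preserving_nuX)
  have half: "{p :: real \<times> real. snd p < 1/2} \<in> sets borel" "{p :: real \<times> real. 1/2 < snd p} \<in> sets borel"
    by measurable
  have P: "finite strips" "strips \<subseteq> sets nuX" "partition_on (space nuX) strips"
    using strips_partition half by (auto simp: strips_def mem_sets_nuX)
  \<comment> \<open>The density bound times 2, for an interval reaching
    \<open>inverse \<beta> ^ n\<close> to either side of a point of \<open>D\<close>. Normalisation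
    cannot increase the measure, the total mass being at least 1.\<close>
  define C where "C = \<beta> / (\<beta> - 1) * 2"
  have C: "0 < C" using beta by (simp add: C_def)
  have small: "measure nuX D \<le> C * inverse \<beta> ^ n" if D: "D \<in> dyn_join X f strips n" and Ds: "D \<in> sets nuX" for D n
  proof (cases "D = {}")
    case False
    then obtain p where p: "p \<in> D" by blast
    let ?w = "inverse \<beta> ^ n"
    have w: "0 < ?w" using beta by simp
    have sub: "D \<subseteq> fst -` {fst p - ?w..fst p + ?w}"
    proof
      fix q assume "q \<in> D"
      then have "\<bar>fst p - fst q\<bar> \<le> ?w" by (rule strips_join_width[OF D p])
      then show "q \<in> fst -` {fst p - ?w..fst p + ?w}" by (auto simp: abs_le_iff)
    qed
    have "emeasure nuX D = emeasure towerM D / emeasure towerM UNIV" by (rule emeasure_nuX[OF Ds])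
    also have "\<dots> \<le> emeasure towerM D"
    proof (rule divide_le_posI_ennreal)
      show "0 < emeasure towerM UNIV" using emeasure_towerM_UNIV(1) by (rule less_le_trans[rotated]) simp
      show "emeasure towerM D \<le> emeasure towerM UNIV * emeasure towerM D"
        using mult_right_mono[OF emeasure_towerM_UNIV(1), of "emeasure towerM D"] by simp
    qed
    also have "\<dots> \<le> emeasure towerM (fst -` {fst p - ?w..fst p + ?w})"
      using fst_vimage_borel[of "{fst p - ?w..fst p + ?w}"] by (intro emeasure_mono sub) simp
    also have "\<dots> \<le> ennreal (\<beta> / (\<beta> - 1)) * emeasure lborel {fst p - ?w..fst p + ?w}"
      by (rule tower_marginal) simp
    also have "\<dots> = ennreal (C * ?w)"
      using w beta by (simp add: C_def ennreal_mult[symmetric])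
    finally show ?thesis using C w by (simp add: emeasure_eq_measure)
  qed (use C beta in simp)
  have ge: "real n * ln \<beta> - ln C \<le> partition_H nuX (dyn_join (space nuX) f strips n)" for n
  proof -
    let ?I = "{..n} \<rightarrow>\<^sub>E strips"
    let ?p = "\<lambda>a. measure nuX (itin_cell (space nuX) f n a)"
    have "real n * ln \<beta> - ln C = (\<Sum>a\<in>?I. ?p a) * (real n * ln \<beta> - ln C)"
      using sum_cell[OF P, of n] by simp
    also have "\<dots> = (\<Sum>a\<in>?I. ?p a * (real n * ln \<beta> - ln C))" by (rule sum_distrib_right)
    also have "\<dots> \<le> (\<Sum>a\<in>?I. - (?p a * ln (?p a)))"
    proof (rule sum_mono)
      fix a assume a: "a \<in> ?I"
      show "?p a * (real n * ln \<beta> - ln C) \<le> - (?p a * ln (?p a))"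
      proof (cases "?p a = 0")
        case False
        then have pos: "0 < ?p a" by (simp add: zero_less_measure_iff)
        have "itin_cell (space nuX) f n a \<in> dyn_join X f strips n"
          using a dyn_join_eq_PiE[OF Pow_space[OF P], of f n] by simp
        then have "?p a \<le> C * inverse \<beta> ^ n" using cell_sets[OF P a] by (rule small)
        then have "ln (?p a) \<le> ln (C * inverse \<beta> ^ n)" using pos by (rule ln_mono)
        also have "\<dots> = ln C - real n * ln \<beta>"
          using C beta by (simp add: ln_mult ln_realpow ln_inverse)
        finally have "?p a * (real n * ln \<beta> - ln C) \<le> ?p a * - ln (?p a)"
          using pos by (intro mult_left_mono) auto
        then show ?thesis by simp
      qed simp
    qed
    also have "\<dots> = partition_H nuX (dyn_join (space nuX) f strips n)"
      unfolding partition_H_dyn_join[OF P] by (simp add: sum_negf)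
    finally show ?thesis .
  qed
  have "(\<lambda>n. ln \<beta> - ln C * (1 / real n)) \<longlonglongrightarrow> ln \<beta> - ln C * 0"
    by (intro tendsto_intros lim_1_over_n)
  moreover have "\<exists>N. \<forall>n\<ge>N. ln \<beta> - ln C * (1 / real n) \<le> 1 / real n * partition_H nuX (dyn_join (space nuX) f strips n)"
  proof (intro exI[of _ 1] allI impI)
    fix n :: nat assume "1 \<le> n"
    then show "ln \<beta> - ln C * (1 / real n) \<le> 1 / real n * partition_H nuX (dyn_join (space nuX) f strips n)"
      using mult_left_mono[OF ge[of n], of "1 / real n"] by (simp add: right_diff_distrib)
  qed
  ultimately have "ln \<beta> - ln C * 0 \<le> partition_entropy f nuX strips"
    using LIMSEQ_le partition_entropy_tendsto[OF P] by blast
  then show ?thesis by simp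
qed

lemma metric_entropy_nuX: "metric_entropy f nuX = ereal (ln \<beta>)"
proof (rule antisym)
  show "metric_entropy f nuX \<le> ereal (ln \<beta>)"
    unfolding metric_entropy_def
    using partition_entropy_le[OF measure_preserving_nuX sets_nuX X_sets spanning_growth_attractor[OF X_Q]]
    by (intro SUP_least) auto
  have "{p :: real \<times> real. snd p < 1/2} \<in> sets borel" "{p :: real \<times> real. 1/2 < snd p} \<in> sets borel"
    by measurable
  then have P: "strips \<in> {P. finite P \<and> P \<subseteq> sets nuX \<and> partition_on (space nuX) P}"
    using strips_partition by (auto simp: strips_def mem_sets_nuX)
  have "ereal (ln \<beta>) \<le> ereal (partition_entropy f nuX strips)" using partition_entropy_strips by simp
  also have "\<dots> \<le> metric_entropy f nuX"
    unfolding metric_entropy_def by (rule SUP_upper[OF P])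
  finally show "ereal (ln \<beta>) \<le> metric_entropy f nuX" .
qed

end

theorem theorem3p1:
  fixes \<beta> \<tau> :: real
  assumes "1 < \<beta>" and "\<beta> < 2" and "0 < \<tau>" and "\<tau> < 1 / 2"
  shows "skew_map \<beta> \<tau> ` attractor \<beta> \<tau> \<subseteq> attractor \<beta> \<tau> \<and>
    topological_entropy (attractor \<beta> \<tau>) (skew_map \<beta> \<tau>) = ereal (ln \<beta>) \<and>
    (\<exists>\<nu> :: (real \<times> real) measure.
       ergodic_borel_prob (attractor \<beta> \<tau>) (skew_map \<beta> \<tau>) \<nu> \<and>
       metric_entropy (skew_map \<beta> \<tau>) \<nu> = topological_entropy (attractor \<beta> \<tau>) (skew_map \<beta> \<tau>) \<and>
       metric_entropy (skew_map \<beta> \<tau>) \<nu> = ereal (ln \<beta>))"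
proof -
  interpret skew_product \<beta> \<tau> by unfold_locales (rule assms)+
  show ?thesis
    using f_X topological_entropy_X ergodic_nuX metric_entropy_nuX by auto
qed

end
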